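(* Let $f$ be a bounded real-valued function on the primes, and suppose that for some constant $\kappa$, $$\sum_{2\le n\le x}f(P(n))\sim \kappa x\quad\text{and}\quad \sum_{\substack{2\le n\le x\\ \omega(n)\ge 2}}f(P_2(n))\sim \kappa x\qquad (x\to\infty).$$ Then $$\sum_{n=2}^{\infty}\frac{\mu(n)\omega(n)f(p(n))}{n}=0.$$
   Context: $\mu$ is the Möbius function and $\omega(n)$ is the number of distinct prime factors of $n$. For $n\ge 2$, $p(n)$ and $P(n)$ denote the smallest and largest prime factors of $n$; for $n$ with $\omega(n)\ge 2$, $P_2(n)$ is the largest prime factor of $n$ strictly less than $P(n)$ (the paper adopts the convention $f(P_2(n))=0$ when $\omega(n)<2$). *)

theory Defs
  imports "HOL-Analysis.Analysis" "HOL-Number_Theory.Number_Theory"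
    "HOL-Computational_Algebra.Squarefree"
begin

definition omega :: "nat \<Rightarrow> nat" where
  "omega n = card (prime_factors n)"

definition moebius_mu :: "nat \<Rightarrow> int" where
  "moebius_mu n = (if squarefree n then (-1) ^ omega n else 0)"

text \<open>The next three definitions use \<open>Min\<close> and \<open>Max\<close>, hence are meaningful only
  if the set in question is nonempty, that is, for \<open>n \<ge> 2\<close> in the first two and for
  \<open>omega n \<ge> 2\<close> in the third.\<close>

definition least_pf :: "nat \<Rightarrow> nat" where
  "least_pf n = Min (prime_factors n)"

definition greatest_pf :: "nat \<Rightarrow> nat" where
  "greatest_pf n = Max (prime_factors n)"

definition second_pf :: "nat \<Rightarrow> nat" where
  "second_pf n = Max {q \<in> prime_factors n. q < greatest_pf n}"

text \<open>\<open>S x \<sim> \<kappa> x\<close> as \<open>x \<rightarrow> \<infinity>\<close>, in the sense that \<open>S x / x\<close> tends to \<open>\<kappa>\<close>.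
  For \<open>\<kappa> \<noteq> 0\<close> this is the usual asymptotic equivalence; for \<open>\<kappa> = 0\<close> it says that
  \<open>S x = o(x)\<close>, whereas the relation \<open>asymp_equiv\<close> of the library, taken
  literally, would require \<open>S x\<close> to vanish for all large \<open>x\<close>.\<close>

definition asymp_linear :: "(real \<Rightarrow> real) \<Rightarrow> real \<Rightarrow> bool" where
  "asymp_linear S \<kappa> \<longleftrightarrow> ((\<lambda>x. S x / x) \<longlongrightarrow> \<kappa>) at_top"

end

theory Submission
  imports Defs "HOL-Probability.Probability" "HOL-Real_Asymp.Real_Asymp"
begin

text \<open>
  By Alladi's duality, the function \<open>a(n) = \<mu>(n) \<omega>(n) f(p(n))\<close> satisfies \<open>a = \<mu> * g\<close> with
  \<open>g(n) = f(P\<^sub>2(n)) - f(P(n))\<close>, which is bounded and, by hypothesis, has mean value zero. Hence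
  \<open>\<Sum>n\<le>N. a(n)/n = \<Sum>k\<le>N. g(k)/k \<cdot> m(N/k)\<close> with \<open>m(y) = \<Sum>n\<le>y. \<mu>(n)/n\<close>. For \<open>k\<close> close to \<open>N\<close> the
  mean value of \<open>g\<close> makes the sum small, and for the other \<open>k\<close> it suffices that \<open>|m(y)|/y\<close> is
  integrable at infinity. For the latter one bounds \<open>u \<cdot> m(e\<^sup>u)\<close> in \<open>L\<^sup>2\<close>: its Laplace transform is
  the negative of the derivative of \<open>1/(w \<zeta>(1+w))\<close>, which is square integrable on vertical lines
  uniformly as \<open>Re w \<rightarrow> 0\<close>, because \<open>1/\<zeta>\<close> and \<open>\<zeta>'\<close> grow at most like powers of \<open>log |t|\<close> (the
  quantitative 3-4-1 argument), and Plancherel applies. No zero-free region and no continuation to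
  the left of the line \<open>Re s = 1\<close> is needed.
\<close>

subsection \<open>Duality over divisors\<close>

text \<open>The convergence of \<open>m(y)\<close> to 0 would not be enough: the sum over
  \<open>k\<close> spreads over about \<open>log N\<close> scales, and a mean value of
  \<open>g\<close> without a rate controls only boundedly many of them. On the other scales the sum
  is bounded by an integral of \<open>|m(e^u)|\<close> over \<open>u\<close>, so absolute
  integrability is what must be proved. Plancherel yields only square integrability, and the weight
  \<open>u\<close> bridges the gap: Cauchy-Schwarz against \<open>1/u\<close> turns an
  \<open>L2\<close> bound for \<open>u m(e^u)\<close> into an \<open>L1\<close> tail of size
  \<open>1/sqrt a\<close>. On the transform side this weight is a differentiation, which is why the
  series with coefficients \<open>ln n\<close> and \<open>\<mu>(n) ln n\<close> accompany those with
  coefficients \<open>1\<close> and \<open>\<mu>(n)\<close>. The factor \<open>1/w\<close> beats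
  every power of \<open>log |t|\<close>, so crude exponents suffice and no constant is optimised.
  The transform is taken with a damping factor \<open>exp (- (x * u))\<close>, \<open>x > 0\<close>,
  which stays in the region of absolute convergence; only bounds uniform in \<open>x\<close> survive
  the passage to the limit.\<close>

lemma sum_subsets_insert:
  fixes h :: "'a set \<Rightarrow> 'b::comm_monoid_add"
  assumes "finite S" "x \<notin> S"
  shows "sum h (Pow (insert x S)) = sum h (Pow S) + (\<Sum>B\<in>Pow S. h (insert x B))"
proof -
  have inj: "inj_on (insert x) (Pow S)"
    using assms(2) by (auto simp: inj_on_def)
  have "sum h (Pow (insert x S)) = sum h (Pow S) + sum h (insert x ` Pow S)"
    unfolding Pow_insert using assms by (intro sum.union_disjoint) auto
  also have "sum h (insert x ` Pow S) = (\<Sum>B\<in>Pow S. h (insert x B))"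
    using inj by (simp add: sum.reindex)
  finally show ?thesis .
qed

lemma sum_Pow_alternating:
  assumes "finite S"
  shows "(\<Sum>B\<in>Pow S. (-1) ^ card B) = (if S = {} then 1 else (0::real))"
  using assms
proof (induction S rule: finite_induct)
  case (insert x S)
  have "card (insert x B) = Suc (card B)" if "B \<in> Pow S" for B
    using that insert by (auto simp: finite_subset card_insert_if)
  then show ?case
    using insert by (simp add: sum_subsets_insert sum_negf del: Pow_iff)
qed auto

text \<open>Toggling a fixed \<open>x\<close> flips the sign and changes the cardinality by one, so
  the terms weighted by \<open>card B\<close> cancel in pairs. What remains is minus the plain
  alternating sum over the subsets of the rest, which is nonzero only if the rest is empty.\<close>

lemma sum_Pow_alternating_card:
  assumes "finite S"
  shows "(\<Sum>B\<in>Pow S. (-1) ^ card B * real (card B)) = (if card S = 1 then -1 else 0)"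
  using assms
proof (induction S rule: finite_induct)
  case (insert x S)
  have "card (insert x B) = Suc (card B)" if "B \<in> Pow S" for B
    using that insert by (auto simp: finite_subset card_insert_if)
  then have "(\<Sum>B\<in>Pow (insert x S). (-1) ^ card B * real (card B)) = - (\<Sum>B\<in>Pow S. (-1) ^ card B)"
    using insert by (simp add: sum_subsets_insert sum_negf sum.distrib sum_subtractf algebra_simps del: Pow_iff)
  then show ?case
    using insert by (simp add: sum_Pow_alternating)
qed auto

text \<open>This is Alladi's duality for an abstract set of primes. The induction adds a new
  smallest element \<open>p\<close>: every set containing \<open>p\<close> has minimum
  \<open>p\<close>, so these sets together contribute \<open>f p\<close> times alternating sums over
  \<open>Pow S\<close>, which cancel once \<open>card S \<ge> 2\<close>. Hence only the two largest
  elements leave a trace, the largest with sign -1 and the second largest with sign +1.\<close>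

lemma sum_Pow_alternating_Min:
  fixes f :: "nat \<Rightarrow> real"
  assumes "finite S"
  shows "(\<Sum>A\<in>Pow S - {{}}. (-1) ^ card A * real (card A) * f (Min A)) =
    (if card S \<ge> 2 then f (Max {q\<in>S. q < Max S}) else 0) - (if S = {} then 0 else f (Max S))"
  using assms
proof (induction S rule: finite_linorder_min_induct)
  case (insert p S)
  \<comment> \<open>Giving the empty set the value 0 avoids the unspecified \<open>Min {}\<close>
    and lets the sum range over the full power set, as \<open>sum_subsets_insert\<close>
    requires.\<close>
  define h where "h A = (if A = {} then 0 else (-1) ^ card A * real (card A) * f (Min A))" for A
  have p: "p \<notin> S" using insert by auto
  have del: "(\<Sum>A\<in>Pow T - {{}}. (-1) ^ card A * real (card A) * f (Min A)) = sum h (Pow T)"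
    if "finite T" for T
  proof -
    have "(\<Sum>A\<in>Pow T - {{}}. (-1) ^ card A * real (card A) * f (Min A)) = sum h (Pow T - {{}})"
      by (intro sum.cong) (auto simp: h_def)
    also have "\<dots> = sum h (Pow T)"
      using that by (intro sum.mono_neutral_left) (auto simp: h_def)
    finally show ?thesis .
  qed
  have "h (insert p B) = - f p * ((-1) ^ card B + (-1) ^ card B * real (card B))" if "B \<in> Pow S" for B
  proof -
    have B: "finite B" "p \<notin> B" using that p insert by (auto intro: finite_subset)
    have "Min (insert p B) = p"
      using that insert B by (intro Min_eqI) (auto intro: less_imp_le)
    then show ?thesis using B by (simp add: h_def algebra_simps)
  qed
  then have "(\<Sum>B\<in>Pow S. h (insert p B)) = 
      - f p * ((\<Sum>B\<in>Pow S. (-1) ^ card B) + (\<Sum>B\<in>Pow S. (-1) ^ card B * real (card B)))"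
    by (subst sum.cong[OF refl]) (auto simp only: sum_distrib_left[symmetric] sum.distrib)
  also have "\<dots> = - f p * ((if S = {} then 1 else 0) + (if card S = 1 then -1 else 0))"
    using insert by (simp only: sum_Pow_alternating sum_Pow_alternating_card)
  finally have 1: "(\<Sum>B\<in>Pow S. h (insert p B)) = \<dots>" .
  have main: "sum h (Pow (insert p S)) = sum h (Pow S) 
      - f p * ((if S = {} then 1 else 0) + (if card S = 1 then -1 else 0))"
    using insert p 1 by (simp add: sum_subsets_insert)
  consider "S = {}" | "card S = 1" | "card S \<ge> 2"
    using insert by (metis One_nat_def Suc_1 card_0_eq not_less_eq_eq le_antisym le_0_eq nat_le_linear)
  then have "sum h (Pow (insert p S)) = (if card (insert p S) \<ge> 2 then f (Max {q\<in>insert p S. q < Max (insert p S)}) else 0)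
     - f (Max (insert p S))"
  proof cases
    case 1
    then show ?thesis by (simp add: sum_subsets_insert h_def)
  next
    case 2
    then obtain q where q: "S = {q}" by (auto simp: card_1_singleton_iff)
    with insert have "p < q" by auto
    then have "{r. (r = p \<or> r = q) \<and> r < q} = {p}" by auto
    then show ?thesis
      using main insert.IH q del \<open>p < q\<close> by (simp add: max_def)
  next
    case 3
    have ne: "S \<noteq> {}" using 3 by auto
    have M: "Max (insert p S) = Max S"
      using insert ne by (metis Max_in Max_insert less_imp_le max_def)
    obtain x y where xy: "x \<in> S" "y \<in> S" "x < y"
      using 3 by (metis card_le_Suc0_iff_eq card_ge_0_finite insert.hyps(1) not_less_eq_eq numeral_2_eq_2 linorder_neqE_nat)
    define Q where "Q = {q\<in>S. q < Max S}"
    have "x \<in> Q" using xy insert unfolding Q_def by (auto intro: less_le_trans)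
    have fin: "finite Q" using insert by (auto simp: Q_def)
    have pM: "p < Max S" using insert ne by auto
    have eq: "{q\<in>insert p S. q < Max (insert p S)} = insert p Q"
      using M pM by (auto simp: Q_def)
    have "Max (insert p Q) = Max Q"
    proof -
      have "p < x" "x \<le> Max Q" using insert xy fin \<open>x \<in> Q\<close> by auto
      then have "p \<le> Max Q" by linarith
      moreover have "Q \<noteq> {}" using \<open>x \<in> Q\<close> by auto
      ultimately show ?thesis using fin by (simp add: max_def)
    qed
    moreover have "sum h (Pow S) = f (Max Q) - f (Max S)"
      using insert.IH del[OF insert.hyps(1)] 3 ne by (simp add: Q_def)
    moreover have "card (insert p S) \<ge> 2" "card S \<noteq> 1"
      using p insert.hyps(1) 3 by simp_all
    ultimately show ?thesis
      unfolding main M eq[unfolded M] using ne by simp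
  qed
  then show ?case
    using del[of "insert p S"] insert.hyps by simp
qed auto

section \<open>Squarefree divisors as sets of primes\<close>

lemma omega_prod_primes:
  assumes "finite A" "\<And>p. p \<in> A \<Longrightarrow> prime p"
  shows "prime_factors (\<Prod>A) = A" "squarefree (\<Prod>A)" "omega (\<Prod>A) = card A" "\<Prod>A > (0::nat)"
proof -
  show 0: "\<Prod>A > 0"
    using assms by (intro prod_pos) (auto intro: prime_gt_0_nat)
  show 1: "prime_factors (\<Prod>A) = A"
    using assms by (subst prime_factors_prod) (auto simp: prime_prime_factors dest: prime_gt_0_nat)
  then show "omega (\<Prod>A) = card A" by (simp add: omega_def)
  show "squarefree (\<Prod>A)"
    using assms by (intro squarefree_prod_coprime) (auto intro: primes_coprime squarefree_prime)
qed

lemma prod_prime_factors_squarefree: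
  assumes "squarefree (n::nat)"
  shows "\<Prod>(prime_factors n) = n"
proof -
  have n: "n > 0" using assms by (metis not_squarefree_0 gr0I)
  have "n = (\<Prod>p\<in>prime_factors n. p ^ multiplicity p n)"
    using n prime_factorization_nat by simp
  also have "\<dots> = \<Prod>(prime_factors n)"
  proof (intro prod.cong refl)
    fix p assume p: "p \<in> prime_factors n"
    then have "multiplicity p n = 1"
      using assms n by (auto simp: squarefree_factorial_semiring'' prime_factors_multiplicity le_antisym)
    then show "p ^ multiplicity p n = p" by simp
  qed
  finally show ?thesis by simp
qed

text \<open>Only squarefree divisors carry a nonzero \<mu>, and \<open>prime_factors\<close> and
  \<open>Prod\<close> are mutually inverse between them and the subsets of
  \<open>prime_factors n\<close>. Divisor sums thereby become the power set sums above.\<close>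

lemma sum_moebius_divisors:
  fixes h :: "nat \<Rightarrow> real"
  assumes "n > 0"
  shows "(\<Sum>d | d dvd n. moebius_mu d * h d) = (\<Sum>A\<in>Pow (prime_factors n). (-1) ^ card A * h (\<Prod>A))"
proof -
  have fin: "finite {d. d dvd n}" using assms by auto
  have "(\<Sum>d | d dvd n. moebius_mu d * h d) = (\<Sum>d | d dvd n \<and> squarefree d. moebius_mu d * h d)"
    using fin by (intro sum.mono_neutral_right) (auto simp: moebius_mu_def)
  also have "\<dots> = (\<Sum>A\<in>Pow (prime_factors n). (-1) ^ card A * h (\<Prod>A))"
  proof (rule sum.reindex_bij_witness[of _ Prod prime_factors])
    fix d assume "d \<in> {d. d dvd n \<and> squarefree d}"
    then show "\<Prod>(prime_factors d) = d" "prime_factors d \<in> Pow (prime_factors n)"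
      "(-1) ^ card (prime_factors d) * h (\<Prod>(prime_factors d)) = moebius_mu d * h d"
      using assms dvd_prime_factors[of n d] by (auto simp: prod_prime_factors_squarefree moebius_mu_def omega_def)
  next
    fix A assume A: "A \<in> Pow (prime_factors n)"
    then have A': "finite A" "\<And>p. p \<in> A \<Longrightarrow> prime p"
      by (auto intro: finite_subset)
    show "prime_factors (\<Prod>A) = A" using A' by (rule omega_prod_primes)
    have "\<Prod>A dvd \<Prod>(prime_factors n)" using A by (intro prod_dvd_prod_subset) auto
    also have "\<dots> dvd (\<Prod>p\<in>prime_factors n. p ^ multiplicity p n)"
      by (intro prod_dvd_prod) (auto simp: prime_factors_multiplicity)
    also have "\<dots> = n" using assms prime_factorization_nat by simp
    finally show "\<Prod>A \<in> {d. d dvd n \<and> squarefree d}"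
      using omega_prod_primes[OF A'] by simp
  qed
  finally show ?thesis .
qed

lemma sum_moebius_divisors_eq:
  assumes "n > 0"
  shows "(\<Sum>d | d dvd n. real_of_int (moebius_mu d)) = (if n = 1 then 1 else 0)"
proof -
  have "prime_factors n = {} \<longleftrightarrow> n = 1"
    using assms by (auto simp: prime_factorization_empty_iff)
  then show ?thesis
    using sum_moebius_divisors[OF assms, of "\<lambda>_. 1"] by (simp add: sum_Pow_alternating)
qed

text \<open>The function \<open>a\<close> of the overview; \<open>pf_gap f\<close> below is its
  \<open>g\<close>. The guards give the value 0 where \<open>Min\<close> or \<open>Max\<close> would
  be applied to an empty set, so the duality also holds at \<open>n = 1\<close>, with both sides
  0.\<close>

definition twisted :: "(nat \<Rightarrow> real) \<Rightarrow> nat \<Rightarrow> real" where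
  "twisted f n = (if n \<ge> 2 then of_int (moebius_mu n) * real (omega n) * f (least_pf n) else 0)"

definition pf_gap :: "(nat \<Rightarrow> real) \<Rightarrow> nat \<Rightarrow> real" where
  "pf_gap f n = (if omega n \<ge> 2 then f (second_pf n) else 0) - (if n \<ge> 2 then f (greatest_pf n) else 0)"

lemma alladi_duality:
  assumes "n > 0"
  shows "(\<Sum>d | d dvd n. twisted f d) = pf_gap f n"
proof -
  have "twisted f d = moebius_mu d * (if d \<ge> 2 then real (omega d) * f (least_pf d) else 0)" for d
    by (simp add: twisted_def)
  then have "(\<Sum>d | d dvd n. twisted f d) = (\<Sum>A\<in>Pow (prime_factors n). (-1) ^ card A *
      (if \<Prod>A \<ge> 2 then real (omega (\<Prod>A)) * f (least_pf (\<Prod>A)) else 0))"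
    using sum_moebius_divisors[OF assms] by simp
  also have "\<dots> = (\<Sum>A\<in>Pow (prime_factors n) - {{}}. (-1) ^ card A *
      (if \<Prod>A \<ge> 2 then real (omega (\<Prod>A)) * f (least_pf (\<Prod>A)) else 0))"
    by (intro sum.mono_neutral_right) auto
  also have "\<dots> = (\<Sum>A\<in>Pow (prime_factors n) - {{}}. (-1) ^ card A * real (card A) * f (Min A))"
  proof (intro sum.cong refl)
    fix A assume "A \<in> Pow (prime_factors n) - {{}}"
    then have A: "finite A" "\<And>p. p \<in> A \<Longrightarrow> prime p" "A \<noteq> {}"
      by (auto intro: finite_subset)
    note * = omega_prod_primes[OF A(1,2)]
    have "\<Prod>A \<noteq> 1" using *(1) A(3) by auto
    then have "\<Prod>A \<ge> 2" using *(4) by linarith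
    then show "(-1) ^ card A * (if \<Prod>A \<ge> 2 then real (omega (\<Prod>A)) * f (least_pf (\<Prod>A)) else 0)
       = (-1) ^ card A * real (card A) * f (Min A)"
      using * by (simp add: least_pf_def)
  qed
  also have "\<dots> = pf_gap f n"
  proof -
    have "prime_factors n = {} \<longleftrightarrow> \<not> n \<ge> 2"
      using assms by (auto simp: prime_factorization_empty_iff)
    then show ?thesis
      by (subst sum_Pow_alternating_Min) (auto simp: pf_gap_def omega_def second_pf_def greatest_pf_def)
  qed
  finally show ?thesis .
qed

text \<open>Moebius inversion of \<open>alladi_duality\<close>: the pairs \<open>(d, e)\<close> with
  \<open>d * e\<close> dividing \<open>n\<close> are summed in the other order, and the sum of \<mu>
  over the divisors of \<open>n div e\<close> retains only \<open>e = n\<close>.\<close>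

lemma moebius_inversion_pf_gap:
  assumes "n > 0"
  shows "twisted f n = (\<Sum>d | d dvd n. moebius_mu d * pf_gap f (n div d))"
proof -
  have fin: "finite {d. d dvd n}" using assms by auto
  have "(\<Sum>d | d dvd n. moebius_mu d * pf_gap f (n div d)) =
     (\<Sum>d | d dvd n. \<Sum>e | e dvd n div d. moebius_mu d * twisted f e)"
    using assms by (intro sum.cong) (auto simp: alladi_duality[symmetric] sum_distrib_left elim!: dvdE)
  also have "\<dots> = (\<Sum>(d,e)\<in>(SIGMA d:{d. d dvd n}. {e. e dvd n div d}). moebius_mu d * twisted f e)"
    using assms by (subst sum.Sigma) (auto elim!: dvdE)
  also have "\<dots> = (\<Sum>(e,d)\<in>(SIGMA e:{e. e dvd n}. {d. d dvd n div e}). moebius_mu d * twisted f e)"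
    using assms by (intro sum.reindex_bij_witness[of _ "\<lambda>(a,b). (b,a)" "\<lambda>(a,b). (b,a)"])
      (auto elim!: dvdE simp: mult.commute mult.left_commute)
  also have "\<dots> = (\<Sum>e | e dvd n. \<Sum>d | d dvd n div e. moebius_mu d * twisted f e)"
    using assms by (subst sum.Sigma) (auto elim!: dvdE)
  also have "\<dots> = (\<Sum>e | e dvd n. twisted f e * (if n div e = 1 then 1 else 0))"
  proof (intro sum.cong refl)
    fix e assume "e \<in> {e. e dvd n}"
    then have "n div e > 0" using assms by (auto elim!: dvdE)
    from sum_moebius_divisors_eq[OF this]
    show "(\<Sum>d | d dvd n div e. moebius_mu d * twisted f e) = twisted f e * (if n div e = 1 then 1 else 0)"
      by (simp flip: sum_distrib_right)
  qed
  also have "\<dots> = (\<Sum>e\<in>{n}. twisted f e * (if n div e = 1 then 1 else 0))"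
    using assms fin by (intro sum.mono_neutral_right) (auto elim!: dvdE)
  also have "\<dots> = twisted f n" using assms by simp
  finally show ?thesis by simp
qed

subsection \<open>Dirichlet series\<close>

text \<open>The sum may start at 0 because \<open>0 powr z = 0\<close>.\<close>

definition dseries :: "(nat \<Rightarrow> complex) \<Rightarrow> complex \<Rightarrow> complex" where
  "dseries a s = (\<Sum>n. a n * of_nat n powr (-s))"

text \<open>A single growth condition covering the four coefficient sequences that occur:
  \<open>1\<close>, \<open>ln n\<close>, \<open>\<mu>(n)\<close> and \<open>\<mu>(n) ln n\<close>.
  It yields absolute convergence for \<open>Re s > 1\<close>.\<close>

definition log_bounded :: "(nat \<Rightarrow> complex) \<Rightarrow> bool" where
  "log_bounded a \<longleftrightarrow> (\<forall>n\<ge>1. norm (a n) \<le> 1 + ln (real n))"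

lemma norm_of_nat_powr: "norm (of_nat n powr (z::complex)) = real n powr Re z"
  by (subst norm_powr_real_powr) auto

lemma norm_dterm_le:
  assumes "log_bounded a" "Re s \<ge> \<sigma>"
  shows "norm (a n * of_nat n powr (-s)) \<le> (1 + ln (real n)) * real n powr (-\<sigma>)"
proof (cases "n = 0")
  case False
  then have "real n powr (- Re s) \<le> real n powr (-\<sigma>)"
    using assms by (intro powr_mono) auto
  then show ?thesis
    using False assms by (auto simp: norm_mult norm_of_nat_powr log_bounded_def intro!: mult_mono)
qed auto

lemma summable_ln_powr:
  assumes "\<sigma> > 1"
  shows "summable (\<lambda>n. (1 + ln (real n)) * real n powr (-\<sigma>))"
proof (rule summable_comparison_test_ev)
  \<comment> \<open>The logarithm is absorbed by \<open>n powr \<delta>\<close>, which uses up half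
    of the room between \<open>\<sigma>\<close> and 1.\<close>
  define \<delta> where "\<delta> = (\<sigma> - 1) / 2"
  have \<delta>: "\<delta> > 0" "-\<sigma> + \<delta> < -1" using assms by (auto simp: \<delta>_def field_simps)
  show "summable (\<lambda>n. (1 + 1/\<delta>) * real n powr (-\<sigma> + \<delta>))"
    using \<delta> by (intro summable_mult) (simp add: summable_real_powr_iff)
  have "norm ((1 + ln (real n)) * real n powr (-\<sigma>)) \<le> (1 + 1/\<delta>) * real n powr (-\<sigma> + \<delta>)" if "n \<ge> 1" for n
  proof -
    have "1 \<le> real n powr \<delta>" using that \<delta> by (intro ge_one_powr_ge_zero) auto
    moreover have "ln (real n) \<le> real n powr \<delta> / \<delta>" using that \<delta> by (intro ln_powr_bound) auto
    ultimately have "1 + ln (real n) \<le> (1 + 1/\<delta>) * real n powr \<delta>"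
      by (simp add: algebra_simps)
    then have "(1 + ln (real n)) * real n powr (-\<sigma>) \<le> (1 + 1/\<delta>) * real n powr \<delta> * real n powr (-\<sigma>)"
      by (intro mult_right_mono) auto
    then show ?thesis using that by (simp add: powr_add powr_diff powr_minus field_simps)
  qed
  then show "\<forall>\<^sub>F n in sequentially. norm ((1 + ln (real n)) * real n powr (-\<sigma>)) \<le> (1 + 1/\<delta>) * real n powr (-\<sigma> + \<delta>)"
    unfolding eventually_sequentially by blast
qed

lemma summable_dterm:
  assumes "log_bounded a" "Re s > 1"
  shows "summable (\<lambda>n. norm (a n * of_nat n powr (-s)))"
  by (rule summable_comparison_test_ev[OF _ summable_ln_powr[OF assms(2)]])
     (use norm_dterm_le[OF assms(1) order.refl, where s = s] in auto)

lemma dseries_has_sum: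
  assumes "log_bounded a" "Re s > 1"
  shows "((\<lambda>n. a n * of_nat n powr (-s)) has_sum dseries a s) UNIV"
  unfolding dseries_def using summable_dterm[OF assms]
  by (intro norm_summable_imp_has_sum summable_sums) (auto intro: summable_norm_cancel)

lemma dseries_sums:
  assumes "log_bounded a" "Re s > 1"
  shows "(\<lambda>n. a n * of_nat n powr (-s)) sums dseries a s"
  using dseries_has_sum[OF assms] by (rule has_sum_imp_sums)

lemma has_sum_mult_abs:
  fixes f :: "'a \<Rightarrow> complex" and g :: "'b \<Rightarrow> complex"
  assumes "(f has_sum S) A" "(g has_sum T) B" "(\<lambda>x. norm (f x)) summable_on A" "(\<lambda>x. norm (g x)) summable_on B"
  shows "((\<lambda>(x,y). f x * g y) has_sum S * T) (A \<times> B)"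
proof (rule has_sum_SigmaI)
  show "((\<lambda>y. case (x, y) of (x, y) \<Rightarrow> f x * g y) has_sum f x * T) B" for x
    using assms(2) by (simp add: has_sum_cmult_right)
  show "((\<lambda>x. f x * T) has_sum S * T) A"
    using assms(1) by (rule has_sum_cmult_left)
  have "(\<lambda>z. norm (case z of (x,y) \<Rightarrow> f x * g y)) summable_on A \<times> B"
    unfolding Infinite_Sum.abs_summable_on_Sigma_iff
    using assms(3,4)
    by (auto simp: norm_mult infsum_cmult_right' infsum_nonneg intro!: summable_on_cmult_right summable_on_cmult_left)
  then show "(\<lambda>(x,y). f x * g y) summable_on A \<times> B"
    by (rule Infinite_Sum.abs_summable_summable)
qed

text \<open>The double series is regrouped along \<open>(d, e) -> (d * e, d)\<close>. The conclusion
  speaks of \<open>sums\<close> because a convolution of two log-bounded sequences need not be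
  log-bounded: convolving 1 with 1 gives the divisor function.\<close>

lemma dseries_mult:
  assumes a: "log_bounded a" and b: "log_bounded b" and s: "Re s > 1"
    and c: "\<And>n. n > 0 \<Longrightarrow> c n = (\<Sum>d | d dvd n. a d * b (n div d))"
  shows "(\<lambda>n. c n * of_nat n powr (-s)) sums (dseries a s * dseries b s)"
proof -
  \<comment> \<open>The index 0 is removed because it has infinitely many divisors; the terms there
    are 0.\<close>
  define P where "P = {0::nat<..}"
  define f where "f n = a n * of_nat n powr (-s)" for n
  define g where "g n = b n * of_nat n powr (-s)" for n
  have f: "(f has_sum dseries a s) P"
    using dseries_has_sum[OF a s] by (rule has_sum_cong_neutral[THEN iffD1, rotated -1]) (auto simp: P_def f_def)
  have g: "(g has_sum dseries b s) P"
    using dseries_has_sum[OF b s] by (rule has_sum_cong_neutral[THEN iffD1, rotated -1]) (auto simp: P_def g_def)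
  have abs: "(\<lambda>x. norm (f x)) summable_on P" "(\<lambda>x. norm (g x)) summable_on P"
    using summable_dterm[OF a s] summable_dterm[OF b s]
    by (auto simp: f_def g_def intro!: summable_on_subset_banach[OF norm_summable_imp_summable_on])
  have "((\<lambda>(x,y). f x * g y) has_sum dseries a s * dseries b s) (P \<times> P)"
    by (rule has_sum_mult_abs[OF f g abs])
  also have "?this \<longleftrightarrow> ((\<lambda>(n,d). f d * g (n div d)) has_sum dseries a s * dseries b s) (SIGMA n:P. {d. d dvd n})"
    by (rule has_sum_reindex_bij_witness[of _ "\<lambda>(n,d). (d, n div d)" "\<lambda>(d,e). (d * e, d)"])
       (auto simp: P_def elim!: dvdE)
  finally have "((\<lambda>n. \<Sum>d | d dvd n. f d * g (n div d)) has_sum dseries a s * dseries b s) P"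
    by (rule has_sum_SigmaD) (auto simp: P_def intro!: has_sum_finite)
  also have "?this \<longleftrightarrow> ((\<lambda>n. c n * of_nat n powr (-s)) has_sum dseries a s * dseries b s) UNIV"
  proof (rule has_sum_cong_neutral)
    fix n assume "n \<in> P \<inter> UNIV"
    then have n: "n > 0" by (simp add: P_def)
    have "f d * g (n div d) = a d * b (n div d) * of_nat n powr (-s)" if dvd: "d dvd n" for d
    proof -
      obtain e where e: "n = d * e" using dvd by (rule dvdE)
      then have "d > 0" using n by auto
      then show ?thesis using e by (simp add: f_def g_def powr_times_real)
    qed
    then show "(\<Sum>d | d dvd n. f d * g (n div d)) = c n * of_nat n powr (-s)"
      using c[OF n] by (simp add: sum_distrib_right)
  qed (auto simp: P_def)
  finally show ?thesis by (rule has_sum_imp_sums)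
qed

section \<open>Comparison of sums with antiderivatives\<close>

lemma vector_derivative_mvt_bound:
  fixes f :: "real \<Rightarrow> complex"
  assumes "a \<le> b"
    and f: "\<And>x. a \<le> x \<Longrightarrow> x \<le> b \<Longrightarrow> (f has_vector_derivative f' x) (at x)"
    and \<phi>: "\<And>x. a \<le> x \<Longrightarrow> x \<le> b \<Longrightarrow> (\<phi> has_real_derivative \<phi>' x) (at x)"
    and B: "\<And>x. a \<le> x \<Longrightarrow> x \<le> b \<Longrightarrow> norm (f' x) \<le> \<phi>' x"
  shows "norm (f b - f a) \<le> \<phi> b - \<phi> a"
proof (cases "a = b")
  case False
  show ?thesis
  proof (rule differentiable_bound_general[where f' = f' and \<phi>' = \<phi>'])
    show "continuous_on {a..b} f"
      by (intro continuous_at_imp_continuous_on ballI has_vector_derivative_continuous[OF f]) auto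
    show "continuous_on {a..b} \<phi>"
      by (intro continuous_at_imp_continuous_on ballI DERIV_isCont[OF \<phi>]) auto
  qed (use assms False in \<open>auto simp: has_real_derivative_iff_has_vector_derivative\<close>)
qed auto

text \<open>A substitute for partial summation that avoids integrals: \<open>\<Psi>\<close> is an antiderivative of \<open>\<psi>\<close>.\<close>

lemma sum_vs_antiderivative:
  fixes \<psi> \<psi>' \<Psi> :: "real \<Rightarrow> complex"
  assumes \<Psi>: "\<And>u. u \<ge> real N \<Longrightarrow> (\<Psi> has_vector_derivative \<psi> u) (at u)"
    and \<psi>: "\<And>u. u \<ge> real N \<Longrightarrow> (\<psi> has_vector_derivative \<psi>' u) (at u)"
    and B: "\<And>n u. n \<ge> N \<Longrightarrow> u \<ge> real n \<Longrightarrow> norm (\<psi>' u) \<le> B n"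
    and K: "N \<le> K"
  shows "norm ((\<Sum>n\<in>{N..<K}. \<psi> (real (Suc n))) - (\<Psi> (real K) - \<Psi> (real N))) \<le> (\<Sum>n\<in>{N..<K}. B n)"
proof -
  have step: "norm (\<psi> (real (Suc n)) - (\<Psi> (real (Suc n)) - \<Psi> (real n))) \<le> B n" if n: "n \<ge> N" for n
  proof -
    \<comment> \<open>The increment of \<open>G\<close> from \<open>n\<close> to
      \<open>n + 1\<close> is minus the error of this step. Its derivative is the deviation of
      \<open>\<psi>\<close> from its value at the right endpoint, which a second use of the mean
      value inequality bounds by \<open>B n\<close>.\<close>
    define G where "G u = \<Psi> u - of_real u * \<psi> (real (Suc n))" for u
    have "norm (G (real (Suc n)) - G (real n)) \<le> B n * real (Suc n) - B n * real n"
    proof (rule vector_derivative_mvt_bound[where f' = "\<lambda>u. \<psi> u - \<psi> (real (Suc n))" and \<phi>' = "\<lambda>_. B n"])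
      fix u assume u: "real n \<le> u" "u \<le> real (Suc n)"
      show "(G has_vector_derivative \<psi> u - \<psi> (real (Suc n))) (at u)"
        unfolding G_def using \<Psi>[of u] u n
        by (auto intro!: derivative_eq_intros has_vector_derivative_real_field simp: has_vector_derivative_def scaleR_conv_of_real algebra_simps)
      have "norm (\<psi> (real (Suc n)) - \<psi> u) \<le> B n * real (Suc n) - B n * u"
        using u n by (intro vector_derivative_mvt_bound[where f' = \<psi>' and \<phi>' = "\<lambda>_. B n"])
          (auto intro!: \<psi> B derivative_eq_intros)
      also have "\<dots> = B n * (real (Suc n) - u)" by (simp add: algebra_simps)
      also have "\<dots> \<le> B n * 1"
        using u B[OF n order.refl] by (intro mult_left_mono) (auto intro: order_trans[OF norm_ge_zero])
      finally show "norm (\<psi> u - \<psi> (real (Suc n))) \<le> B n" by (simp add: norm_minus_commute)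
    qed (auto intro!: derivative_eq_intros)
    also have "G (real (Suc n)) - G (real n) = - (\<psi> (real (Suc n)) - (\<Psi> (real (Suc n)) - \<Psi> (real n)))"
      by (simp add: G_def algebra_simps)
    finally show ?thesis by (simp add: algebra_simps norm_minus_commute)
  qed
  have "(\<Sum>n\<in>{N..<K}. \<psi> (real (Suc n))) - (\<Psi> (real K) - \<Psi> (real N)) =
      (\<Sum>n\<in>{N..<K}. \<psi> (real (Suc n)) - (\<Psi> (real (Suc n)) - \<Psi> (real n)))"
    using sum_Suc_diff'[OF K, of "\<lambda>n. \<Psi> (real n)"] by (simp add: sum_subtractf)
  also have "norm \<dots> \<le> (\<Sum>n\<in>{N..<K}. B n)"
    by (rule sum_norm_le) (use step in auto)
  finally show ?thesis .
qed

text \<open>Telescoping against \<open>6 / sqrt n\<close>: with \<open>x = sqrt n\<close> and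
  \<open>y = sqrt (n + 1)\<close> one difference is \<open>6 / (x y (x + y))\<close>, and
  \<open>y \<le> 2 x\<close> makes the denominator at most \<open>6 x^3\<close>. This is the origin
  of the 6.\<close>

lemma sum_powr_three_halves:
  assumes "1 \<le> N" "N \<le> K"
  shows "(\<Sum>n\<in>{N..<K}. real n powr (-3/2)) \<le> 6 / sqrt (real N)"
proof -
  have "real n powr (-3/2) \<le> 6 / sqrt (real n) - 6 / sqrt (real (Suc n))" if n: "n \<ge> 1" for n
  proof -
    define x where "x = sqrt (real n)"
    define y where "y = sqrt (real (Suc n))"
    have x: "x \<ge> 1" "x > 0" using n by (auto simp: x_def)
    have xx: "x * x = real n" and yy: "y * y = real n + 1" by (auto simp: x_def y_def)
    have xy: "x \<le> y" by (auto simp: x_def y_def)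
    have "y * y \<le> (2 * x) * (2 * x)" using xx yy n by (auto simp: algebra_simps)
    then have y2: "y \<le> 2 * x" using x xy by (intro power2_le_imp_le[of y "2*x"]) (auto simp: power2_eq_square)
    have "real n powr (3/2) = real n powr 1 * real n powr (1/2)"
      by (simp only: powr_add[symmetric]) simp
    then have "real n powr (-3/2) = 1 / (real n powr 1 * real n powr (1/2))"
      using powr_minus_divide[of "real n" "3/2"] by simp
    then have 1: "real n powr (-3/2) = 1 / (x * x * x)"
      using n by (simp add: powr_half_sqrt xx flip: x_def)
    have "6 / x - 6 / y = 6 * (y * y - x * x) / (x * y * (x + y))"
      using x xy by (simp add: divide_simps) (simp add: algebra_simps)
    also have "\<dots> = 6 / (x * y * (x + y))" using xx yy by simp
    also have "\<dots> \<ge> 6 / (x * (2 * x) * (x + 2 * x))"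
      using x xy y2 by (intro divide_left_mono mult_mono mult_pos_pos add_mono) auto
    also have "6 / (x * (2 * x) * (x + 2 * x)) = 1 / (x * x * x)"
      using x by (simp add: field_simps)
    finally show ?thesis using 1 by (simp add: x_def y_def)
  qed
  then have "(\<Sum>n\<in>{N..<K}. real n powr (-3/2)) \<le> (\<Sum>n\<in>{N..<K}. 6 / sqrt (real n) - 6 / sqrt (real (Suc n)))"
    using assms by (intro sum_mono) auto
  also have "\<dots> = 6 / sqrt (real N) - 6 / sqrt (real K)"
    using sum_Suc_diff'[OF assms(2), of "\<lambda>n. - (6 / sqrt (real n))"] by simp
  also have "\<dots> \<le> 6 / sqrt (real N)" by simp
  finally show ?thesis .
qed

text \<open>The tail beyond \<open>N\<close> is compared with the integral of \<open>\<psi>\<close>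
  from \<open>N\<close> to infinity, which is \<open>- \<Psi> N\<close> because
  \<open>\<Psi>\<close> vanishes at infinity. The exponent \<open>-3/2\<close> instead of
  \<open>-2\<close> leaves room for the logarithm in the derivative of
  \<open>ln u * u powr (-s)\<close>, so that the lemma serves both \<open>zt\<close> and
  \<open>zt_ln\<close>.\<close>

lemma series_vs_antiderivative:
  fixes \<psi> \<psi>' \<Psi> :: "real \<Rightarrow> complex"
  assumes \<Psi>: "\<And>u. u \<ge> 1 \<Longrightarrow> (\<Psi> has_vector_derivative \<psi> u) (at u)"
    and \<psi>: "\<And>u. u \<ge> 1 \<Longrightarrow> (\<psi> has_vector_derivative \<psi>' u) (at u)"
    and B: "\<And>u. u \<ge> 1 \<Longrightarrow> norm (\<psi>' u) \<le> C * u powr (-3/2)" and C: "C \<ge> 0"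
    and lim: "(\<lambda>n. \<Psi> (real n)) \<longlonglongrightarrow> 0"
    and sums: "(\<lambda>n. \<psi> (real n)) sums S" and 0: "\<psi> 0 = 0"
    and N: "N \<ge> 1"
  shows "norm (S - (\<Sum>n=1..N. \<psi> (real n)) + \<Psi> (real N)) \<le> 6 * C / sqrt (real N)"
proof (rule Lim_norm_ubound[OF trivial_limit_sequentially])
  have "(\<lambda>K. \<Sum>n<K. \<psi> (real n)) \<longlonglongrightarrow> S" using sums by (simp add: sums_def)
  then have "(\<lambda>K. \<Sum>n<Suc K. \<psi> (real n)) \<longlonglongrightarrow> S" by (rule LIMSEQ_Suc)
  moreover have "(\<Sum>n<Suc K. \<psi> (real n)) = (\<Sum>n=1..K. \<psi> (real n))" for K
    by (subst lessThan_Suc_atMost, subst atMost_atLeast0) (simp add: sum.atLeast_Suc_atMost 0)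
  ultimately have "(\<lambda>K. \<Sum>n=1..K. \<psi> (real n)) \<longlonglongrightarrow> S" by simp
  from tendsto_diff[OF this lim]
  show "(\<lambda>K. (\<Sum>n=1..K. \<psi> (real n)) - \<Psi> (real K) - (\<Sum>n=1..N. \<psi> (real n)) + \<Psi> (real N))
     \<longlonglongrightarrow> S - (\<Sum>n=1..N. \<psi> (real n)) + \<Psi> (real N)"
    by (intro tendsto_intros) auto
  have "norm ((\<Sum>n=1..K. \<psi> (real n)) - \<Psi> (real K) - (\<Sum>n=1..N. \<psi> (real n)) + \<Psi> (real N)) \<le> 6 * C / sqrt (real N)"
    if K: "K \<ge> N" for K
  proof -
    have "(\<Sum>n=1..K. \<psi> (real n)) = (\<Sum>n=1..N. \<psi> (real n)) + (\<Sum>n\<in>{Suc N..<Suc K}. \<psi> (real n))"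
      using K N by (subst sum.union_disjoint[symmetric]) (auto intro!: sum.cong)
    also have "(\<Sum>n\<in>{Suc N..<Suc K}. \<psi> (real n)) = (\<Sum>n\<in>{N..<K}. \<psi> (real (Suc n)))"
      by (rule sum.shift_bounds_Suc_ivl)
    finally have "norm ((\<Sum>n=1..K. \<psi> (real n)) - \<Psi> (real K) - (\<Sum>n=1..N. \<psi> (real n)) + \<Psi> (real N)) =
       norm ((\<Sum>n\<in>{N..<K}. \<psi> (real (Suc n))) - (\<Psi> (real K) - \<Psi> (real N)))"
      by (simp add: algebra_simps)
    also have "\<dots> \<le> (\<Sum>n\<in>{N..<K}. C * real n powr (-3/2))"
    proof (rule sum_vs_antiderivative[where \<psi>' = \<psi>'])
      fix n and u :: real assume nu: "n \<ge> N" "u \<ge> real n"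
      then have "norm (\<psi>' u) \<le> C * u powr (-3/2)" using N by (intro B) auto
      also have "\<dots> \<le> C * real n powr (-3/2)"
        using nu N C by (intro mult_left_mono powr_mono2') auto
      finally show "norm (\<psi>' u) \<le> C * real n powr (-3/2)" .
    qed (use N K in \<open>auto intro!: \<Psi> \<psi>\<close>)
    also have "\<dots> \<le> C * (6 / sqrt (real N))"
      unfolding sum_distrib_left[symmetric] using C N K
      by (intro mult_left_mono sum_powr_three_halves) auto
    finally show ?thesis by (simp add: mult_ac)
  qed
  then show "\<forall>\<^sub>F K in sequentially. norm ((\<Sum>n=1..K. \<psi> (real n)) - \<Psi> (real K) - (\<Sum>n=1..N. \<psi> (real n)) + \<Psi> (real N)) \<le> 6 * C / sqrt (real N)"
    unfolding eventually_sequentially by blast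
qed

subsection \<open>The zeta series near the line Re s = 1\<close>

abbreviation zt :: "complex \<Rightarrow> complex" where
  "zt \<equiv> dseries (\<lambda>_. 1)"

abbreviation zt_ln :: "complex \<Rightarrow> complex" where
  "zt_ln \<equiv> dseries (\<lambda>n. of_real (ln (real n)))"

lemma log_bounded_1: "log_bounded (\<lambda>_. 1)"
  and log_bounded_ln: "log_bounded (\<lambda>n. of_real (ln (real n)))"
  by (auto simp: log_bounded_def)

lemma sum_inverse_le_ln':
  assumes "1 \<le> M" "M \<le> N"
  shows "(\<Sum>n=M..N. 1 / real n) \<le> 1 / real M + ln (real N / real M)"
  using assms(2)
proof (induction N rule: dec_induct)
  case (step N)
  have N: "real N > 0" "real M > 0" using step assms by auto
  have "ln (real N / real (Suc N)) \<le> real N / real (Suc N) - 1"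
    using N by (intro ln_le_minus_one) auto
  also have "\<dots> = - 1 / real (Suc N)" by (simp add: field_simps)
  finally have "1 / real (Suc N) \<le> ln (real (Suc N)) - ln (real N)"
    using N by (simp add: ln_div)
  with step N show ?case by (simp add: ln_div)
qed (use assms in auto)

lemma sum_inverse_le_ln:
  "N \<ge> 1 \<Longrightarrow> (\<Sum>n=1..N. 1 / real n) \<le> 1 + ln (real N)"
  using sum_inverse_le_ln'[of 1 N] by simp

text \<open>The cut-off \<open>N\<close> is about \<open>T^2\<close>: the error of the comparison
  with an antiderivative is of order \<open>T / sqrt N\<close>, hence bounded, while
  \<open>ln N\<close> stays below \<open>2 * L\<close>.\<close>

locale zeta_point =
  fixes s :: complex and T L :: real and N :: nat
  assumes s: "1 < Re s" "Re s \<le> 2"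
  defines "T \<equiv> 1 + \<bar>Im s\<bar>" and "L \<equiv> 1 + ln (1 + \<bar>Im s\<bar>)" and "N \<equiv> nat \<lceil>(1 + \<bar>Im s\<bar>)\<^sup>2\<rceil>"
begin

lemma T: "T \<ge> 1" by (simp add: T_def)

lemma N: "N \<ge> 1" "sqrt (real N) \<ge> T" "ln (real N) \<ge> 0" "1 + ln (real N) \<le> 2 * L"
proof -
  have T2: "T\<^sup>2 \<ge> 1" using T by (simp add: one_le_power)
  have 1: "real N \<ge> T\<^sup>2" "real N \<le> T\<^sup>2 + 1"
    by (auto simp: N_def T_def real_nat_ceiling_ge of_nat_ceiling)

  show "N \<ge> 1" using 1 T2 by linarith
  show "sqrt (real N) \<ge> T" using 1 T by (intro real_le_rsqrt) auto
  show "ln (real N) \<ge> 0" using 1 T2 by simp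
  have "ln (real N) \<le> ln (2 * T\<^sup>2)" using 1 T2 by (subst ln_le_cancel_iff) auto
  also have "\<dots> = ln 2 + 2 * ln T" using T by (simp add: ln_mult ln_realpow)
  also have "ln 2 \<le> (1::real)" using ln_le_minus_one[of "2::real"] by simp
  finally show "1 + ln (real N) \<le> 2 * L" by (simp add: L_def T_def)
qed

lemma norm_s: "norm s \<le> 2 * T"
  using cmod_le[of s] s by (simp add: T_def)

lemma s_minus_1: "s - 1 \<noteq> 0" "Re (s - 1) > 0"
  using s by auto

lemma norm_powr_le: "norm (of_real u powr (-s)) \<le> 1 / u" if "u \<ge> 1"
proof -
  have "norm (of_real u powr (-s)) = u powr (- Re s)"
    using that by (subst norm_powr_real_powr) auto
  also have "\<dots> \<le> u powr (-1)" using that s by (intro powr_mono) auto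
  also have "\<dots> = 1 / u" using that by (simp add: powr_minus_divide)
  finally show ?thesis .
qed

lemma norm_powr_le': "norm (of_real u powr (-s-1)) \<le> u powr (-2)" if "u \<ge> 1"
proof -
  have "norm (of_real u powr (-s-1)) = u powr (- Re s - 1)"
    using that by (subst norm_powr_real_powr) auto
  also have "\<dots> \<le> u powr (-2)" using that s by (intro powr_mono) auto
  finally show ?thesis .
qed

lemma not_nonpos: "complex_of_real u \<notin> \<real>\<^sub>\<le>\<^sub>0" if "u \<ge> 1" for u
  using that by (auto simp: complex_nonpos_Reals_iff)

lemma Ln_real: "Ln (complex_of_real u) = of_real (ln u)" if "u \<ge> 1" for u
  using that by (simp add: Ln_of_real)

lemma deriv_powr:
  "((\<lambda>u. of_real u powr (-s)) has_vector_derivative (-s) * of_real u powr (-s-1)) (at u)" if "u \<ge> 1"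
  using not_nonpos[OF that]
  by (intro has_vector_derivative_real_field has_field_derivative_powr)

lemma deriv_Psi0:
  "((\<lambda>u. - (of_real u powr (-(s-1))) / (s-1)) has_vector_derivative of_real u powr (-s)) (at u)" if "u \<ge> 1"
proof -
  have "((\<lambda>z. - (z powr (-(s-1))) / (s-1)) has_field_derivative
      - (- (s-1) * of_real u powr (-(s-1) - 1)) / (s-1)) (at (of_real u))"
    by (intro DERIV_cdivide DERIV_minus has_field_derivative_powr not_nonpos that)
  also have "- (- (s-1) * complex_of_real u powr (-(s-1) - 1)) / (s-1) = of_real u powr (-s)"
  proof -
    have "- (- w * P) / w = P" if "w \<noteq> 0" for w P :: complex
      using that by simp
    from this[OF s_minus_1(1)] show ?thesis by simp
  qed
  finally show ?thesis by (rule has_vector_derivative_real_field)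
qed

lemma deriv_ln_powr:
  "((\<lambda>u. of_real (ln u) * of_real u powr (-s)) has_vector_derivative
     of_real u powr (-s-1) * (1 - s * of_real (ln u))) (at u)" if u: "u \<ge> 1"
proof -
  have "((\<lambda>z. Ln z * z powr (-s)) has_field_derivative
     of_real u powr (-s-1) * (1 - s * of_real (ln u))) (at (of_real u))"
    using not_nonpos[OF u] u
    by (auto intro!: derivative_eq_intros simp: Ln_real powr_diff field_simps)
  then have "((\<lambda>u. Ln (of_real u) * of_real u powr (-s)) has_vector_derivative
     of_real u powr (-s-1) * (1 - s * of_real (ln u))) (at u)"
    by (rule has_vector_derivative_real_field)
  then show ?thesis
    by (rule has_vector_derivative_transform_within_open[where S = "{0<..}"])
       (use u in \<open>auto simp: Ln_of_real\<close>)
qed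

lemma deriv_Psi1:
  "((\<lambda>u. - (of_real (ln u) / (s-1) + 1 / (s-1)\<^sup>2) * of_real u powr (-(s-1))) has_vector_derivative
     of_real (ln u) * of_real u powr (-s)) (at u)" if u: "u \<ge> 1"
proof -
  have "((\<lambda>z. - (Ln z / (s-1) + 1 / (s-1)\<^sup>2) * z powr (-(s-1))) has_field_derivative
     - (inverse (of_real u) / (s-1) + 0) * of_real u powr (-(s-1)) 
     + (- (s-1) * of_real u powr (-(s-1) - 1)) * - (Ln (of_real u) / (s-1) + 1 / (s-1)\<^sup>2)) (at (of_real u))"
    by (intro DERIV_mult DERIV_minus DERIV_add DERIV_cdivide DERIV_const has_field_derivative_powr
        has_field_derivative_Ln not_nonpos that)
  also have "of_real u powr (-(s-1)) = of_real u * complex_of_real u powr (-s)"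
    using u powr_add[of "complex_of_real u" 1 "-s"] by simp
  also have "- (inverse (of_real u) / (s-1) + 0) * (of_real u * complex_of_real u powr (-s)) 
     + (- (s-1) * of_real u powr (-(s-1) - 1)) * - (Ln (of_real u) / (s-1) + 1 / (s-1)\<^sup>2)
     = of_real (ln u) * of_real u powr (-s)"
  proof -
    have "- (inverse z / w + 0) * (z * P) + (- w * P) * - (l / w + 1 / w\<^sup>2) = l * P"
      if "z \<noteq> 0" "w \<noteq> 0" for z w P l :: complex
      using that by (simp add: field_simps power2_eq_square)
    from this[of "of_real u" "s-1" "complex_of_real u powr (-s)" "of_real (ln u)"] show ?thesis
      using u s_minus_1(1) by (simp add: Ln_real)
  qed
  finally have "((\<lambda>z. - (Ln z / (s-1) + 1 / (s-1)\<^sup>2) * z powr (-(s-1))) has_field_derivative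
     of_real (ln u) * of_real u powr (-s)) (at (of_real u))" .
  then have "((\<lambda>u. - (Ln (of_real u) / (s-1) + 1 / (s-1)\<^sup>2) * of_real u powr (-(s-1))) has_vector_derivative
     of_real (ln u) * of_real u powr (-s)) (at u)"
    by (rule has_vector_derivative_real_field)
  then show ?thesis
    by (rule has_vector_derivative_transform_within_open[where S = "{0<..}"])
       (use u in \<open>auto simp: Ln_of_real\<close>)
qed

lemma powr_half_ge: 
  assumes "u \<ge> (1::real)"
  shows "u powr (-2) \<le> u powr (-3/2)" "u powr (-2) * ln u \<le> 2 * u powr (-3/2)"
proof -
  show "u powr (-2) \<le> u powr (-3/2)" using assms by (intro powr_mono) auto
  have "ln u \<le> 2 * u powr (1/2)" using ln_powr_bound[of u "1/2"] assms by simp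
  then have "u powr (-2) * ln u \<le> u powr (-2) * (2 * u powr (1/2))" by (intro mult_left_mono) auto
  also have "\<dots> = 2 * u powr (-2 + 1/2)" unfolding powr_add by simp
  finally show "u powr (-2) * ln u \<le> 2 * u powr (-3/2)" by simp
qed

text \<open>The pole is exactly \<open>- \<Psi> 1\<close> for the antiderivative in question.
  Subtracting it leaves the increment of \<open>\<Psi>\<close> from 1 to \<open>N\<close>, which is
  bounded by \<open>ln N\<close> or its square without any division by \<open>s - 1\<close>; hence
  the estimate is uniform up to \<open>s = 1\<close>. The constants are 34 = 30 + 2 + 2 and 38 = 30
  + 4 + 4, from the comparison error, the partial sum and the increment.\<close>

lemma norm_zt_minus_pole: "norm (zt s - 1 / (s-1)) \<le> 34 * L"
  and norm_zt_ln_minus_pole: "norm (zt_ln s - 1 / (s-1)\<^sup>2) \<le> 38 * L\<^sup>2"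
proof -
  define \<Psi>0 where "\<Psi>0 u = - (complex_of_real u powr (-(s-1))) / (s-1)" for u
  define \<Psi>1 where "\<Psi>1 u = - (of_real (ln u) / (s-1) + 1 / (s-1)\<^sup>2) * complex_of_real u powr (-(s-1))" for u
  have s1: "Re s > 1" by (rule s)
  have L: "L \<ge> 1" by (simp add: L_def)
  have decay: "(\<lambda>n. of_nat n powr (-(s-1))) \<longlonglongrightarrow> 0"
    using s by (intro tendsto_neg_powr_complex_of_nat filterlim_ident) auto
  have decay_ln: "(\<lambda>n. of_real (ln (real n)) * of_nat n powr (-(s-1))) \<longlonglongrightarrow> 0"
  proof (rule tendsto_norm_zero_cancel)
    have "((\<lambda>x. ln x * x powr (-(Re s - 1))) \<longlongrightarrow> 0) at_top"
      using s by real_asymp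
    then have "(\<lambda>n. ln (real n) * real n powr (-(Re s - 1))) \<longlonglongrightarrow> 0"
      by (rule filterlim_compose[OF _ filterlim_real_sequentially])
    moreover have "norm (of_real (ln (real n)) * of_nat n powr (-(s-1))) = ln (real n) * real n powr (-(Re s - 1))"
       if "n \<ge> 1" for n using that by (simp add: norm_mult norm_of_nat_powr)
    then have "\<forall>\<^sub>F n in sequentially. ln (real n) * real n powr (-(Re s - 1)) = norm (of_real (ln (real n)) * of_nat n powr (-(s-1)))"
      unfolding eventually_sequentially by metis
    ultimately show "(\<lambda>n. norm (complex_of_real (ln (real n)) * of_nat n powr (-(s-1)))) \<longlonglongrightarrow> 0"
      by (rule Lim_transform_eventually)
  qed
  have err: "6 * (5 * T) / sqrt (real N) \<le> 30"
    using N T by (simp add: divide_simps)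
  have "norm (zt s - (\<Sum>n=1..N. complex_of_real (real n) powr (-s)) + \<Psi>0 (real N)) \<le> 6 * (5 * T) / sqrt (real N)"
  proof (rule series_vs_antiderivative[where \<psi>' = "\<lambda>u. (-s) * complex_of_real u powr (-s-1)"])
    fix u :: real assume u: "u \<ge> 1"
    have "norm ((-s) * complex_of_real u powr (-s-1)) \<le> (2 * T) * u powr (-3/2)"
      unfolding norm_mult using norm_powr_le'[OF u] powr_half_ge(1)[OF u] norm_s T
      by (intro mult_mono) auto
    also have "\<dots> \<le> 5 * T * u powr (-3/2)" using T by (intro mult_right_mono) auto
    finally show "norm ((-s) * complex_of_real u powr (-s-1)) \<le> 5 * T * u powr (-3/2)" .
  qed (use N T deriv_powr deriv_Psi0 dseries_sums[OF log_bounded_1 s1] tendsto_divide[OF tendsto_minus[OF decay] tendsto_const[of "s-1"]] s_minus_1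
       in \<open>auto simp: \<Psi>0_def\<close>)
  with err have E0: "norm (zt s - (\<Sum>n=1..N. complex_of_real (real n) powr (-s)) + \<Psi>0 (real N)) \<le> 30"
    by linarith
  \<comment> \<open>Here \<open>5 * T\<close> arises as \<open>T + 2 * T * 2\<close>, the last
    factor coming from \<open>ln u \<le> 2 * sqrt u\<close>. The same constant is used for
    \<open>zt\<close>, so \<open>err\<close> covers both.\<close>
  have "norm (zt_ln s - (\<Sum>n=1..N. of_real (ln (real n)) * complex_of_real (real n) powr (-s)) + \<Psi>1 (real N)) \<le> 6 * (5 * T) / sqrt (real N)"
  proof (rule series_vs_antiderivative[where \<psi>' = "\<lambda>u. of_real u powr (-s-1) * (1 - s * of_real (ln u))"])
    fix u :: real assume u: "u \<ge> 1"
    have "norm (1 - s * of_real (ln u)) \<le> 1 + 2 * T * ln u"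
      using norm_triangle_ineq4[of 1 "s * of_real (ln u)"] mult_right_mono[OF norm_s, of "ln u"] u
      by (simp add: norm_mult)
    then have "norm (of_real u powr (-s-1) * (1 - s * of_real (ln u))) \<le> u powr (-2) * (1 + 2 * T * ln u)"
      unfolding norm_mult using norm_powr_le'[OF u] by (intro mult_mono) auto
    also have "\<dots> = u powr (-2) + 2 * T * (u powr (-2) * ln u)" by (simp add: algebra_simps)
    also have "\<dots> \<le> T * u powr (-3/2) + 2 * T * (2 * u powr (-3/2))"
      using powr_half_ge[OF u] T mult_right_mono[OF T, of "u powr (-3/2)"] by (intro add_mono mult_left_mono) auto
    finally show "norm (of_real u powr (-s-1) * (1 - s * of_real (ln u))) \<le> 5 * T * u powr (-3/2)" by simp
  next
    have "(\<lambda>n. - (of_real (ln (real n)) * of_nat n powr (-(s-1))) / (s-1) - of_nat n powr (-(s-1)) / (s-1)\<^sup>2) \<longlonglongrightarrow> - 0 / (s-1) - 0 / (s-1)\<^sup>2"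
      using s_minus_1 by (intro tendsto_intros decay decay_ln) auto
    then show "(\<lambda>n. \<Psi>1 (real n)) \<longlonglongrightarrow> 0"
      by (simp add: \<Psi>1_def algebra_simps)
  qed (use N T deriv_ln_powr deriv_Psi1 dseries_sums[OF log_bounded_ln s1] in \<open>auto simp: \<Psi>1_def\<close>)
  with err have E1: "norm (zt_ln s - (\<Sum>n=1..N. of_real (ln (real n)) * complex_of_real (real n) powr (-s)) + \<Psi>1 (real N)) \<le> 30"
    by linarith
  have S0: "norm (\<Sum>n=1..N. complex_of_real (real n) powr (-s)) \<le> 1 + ln (real N)"
    by (rule order_trans[OF sum_norm_le sum_inverse_le_ln[OF N(1)]])
       (use norm_powr_le[of "real n" for n] in auto)
  have S1: "norm (\<Sum>n=1..N. of_real (ln (real n)) * complex_of_real (real n) powr (-s)) \<le> ln (real N) * (1 + ln (real N))"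
  proof -
    have "norm (\<Sum>n=1..N. of_real (ln (real n)) * complex_of_real (real n) powr (-s)) \<le> (\<Sum>n=1..N. ln (real N) * (1 / real n))"
    proof (rule sum_norm_le)
      fix n assume n: "n \<in> {1..N}"
      then show "norm (of_real (ln (real n)) * complex_of_real (real n) powr (-s)) \<le> ln (real N) * (1 / real n)"
        unfolding norm_mult using norm_powr_le[of "real n"] by (intro mult_mono) auto
    qed
    also have "\<dots> \<le> ln (real N) * (1 + ln (real N))"
      unfolding sum_distrib_left[symmetric] using N sum_inverse_le_ln by (intro mult_left_mono) auto
    finally show ?thesis .
  qed
  have P0: "norm (\<Psi>0 (real N) - \<Psi>0 1) \<le> ln (real N) - ln 1"
    using N(1) by (intro vector_derivative_mvt_bound[where f' = "\<lambda>u. of_real u powr (-s)" and \<phi>' = "\<lambda>u. 1 / u"])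
       (auto simp: \<Psi>0_def intro!: norm_powr_le deriv_Psi0[simplified] derivative_eq_intros)
  have P1: "norm (\<Psi>1 (real N) - \<Psi>1 1) \<le> (ln (real N))\<^sup>2 - (ln 1)\<^sup>2"
  proof (intro vector_derivative_mvt_bound[where f' = "\<lambda>u. of_real (ln u) * of_real u powr (-s)" and \<phi>' = "\<lambda>u. 2 * ln u / u"])
    fix x :: real assume x: "1 \<le> x"
    then show "((\<lambda>x. (ln x)\<^sup>2) has_real_derivative 2 * ln x / x) (at x)"
      by (auto intro!: derivative_eq_intros)
    have "norm (of_real (ln x) * of_real x powr (-s)) \<le> (2 * ln x) * (1 / x)"
      unfolding norm_mult using norm_powr_le[OF x] x by (intro mult_mono) auto
    then show "norm (of_real (ln x) * of_real x powr (-s)) \<le> 2 * ln x / x" by simp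
    show "(\<Psi>1 has_vector_derivative of_real (ln x) * of_real x powr (-s)) (at x)"
      unfolding \<Psi>1_def by (rule deriv_Psi1[OF x])
  qed (use N in auto)
  have one: "\<Psi>0 1 = - 1 / (s-1)" "\<Psi>1 1 = - 1 / (s-1)\<^sup>2" by (simp_all add: \<Psi>0_def \<Psi>1_def)
  have "norm (zt s - 1 / (s-1)) \<le> 30 + (1 + ln (real N)) + ln (real N)"
    using norm_triangle_ineq4[of "(zt s - (\<Sum>n=1..N. complex_of_real (real n) powr (-s)) + \<Psi>0 (real N)) + (\<Sum>n=1..N. complex_of_real (real n) powr (-s))" "\<Psi>0 (real N) - \<Psi>0 1"]
      norm_triangle_ineq[of "zt s - (\<Sum>n=1..N. complex_of_real (real n) powr (-s)) + \<Psi>0 (real N)" "\<Sum>n=1..N. complex_of_real (real n) powr (-s)"]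
      E0 S0 P0 by (simp add: one)
  then show "norm (zt s - 1 / (s-1)) \<le> 34 * L" using N L by linarith
  have "norm (zt_ln s - 1 / (s-1)\<^sup>2) \<le> 30 + ln (real N) * (1 + ln (real N)) + (ln (real N))\<^sup>2"
    using norm_triangle_ineq4[of "(zt_ln s - (\<Sum>n=1..N. of_real (ln (real n)) * complex_of_real (real n) powr (-s)) + \<Psi>1 (real N)) + (\<Sum>n=1..N. of_real (ln (real n)) * complex_of_real (real n) powr (-s))" "\<Psi>1 (real N) - \<Psi>1 1"]
      norm_triangle_ineq[of "zt_ln s - (\<Sum>n=1..N. of_real (ln (real n)) * complex_of_real (real n) powr (-s)) + \<Psi>1 (real N)" "\<Sum>n=1..N. of_real (ln (real n)) * complex_of_real (real n) powr (-s)"]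
      E1 S1 P1 by (simp add: one)
  also have "\<dots> \<le> 30 * L\<^sup>2 + (2 * L) * (2 * L) + (2 * L)\<^sup>2"
    using N L one_le_power[OF L, of 2] by (intro add_mono mult_mono power_mono) auto
  also have "\<dots> = 38 * L\<^sup>2" by (simp add: power2_eq_square)
  finally show "norm (zt_ln s - 1 / (s-1)\<^sup>2) \<le> 38 * L\<^sup>2" .
qed

end

section \<open>The Dirichlet series of the Moebius function\<close>

abbreviation mt :: "complex \<Rightarrow> complex" where
  "mt \<equiv> dseries (\<lambda>n. of_int (moebius_mu n))"

abbreviation mt_ln :: "complex \<Rightarrow> complex" where
  "mt_ln \<equiv> dseries (\<lambda>n. of_int (moebius_mu n) * of_real (ln (real n)))"

lemma abs_moebius_mu_le_1: "\<bar>moebius_mu n\<bar> \<le> 1"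
  by (simp add: moebius_mu_def power_abs)

lemma norm_moebius_mu_le_1: "norm (of_int (moebius_mu n) :: complex) \<le> 1"
  using abs_moebius_mu_le_1[of n] by simp

lemma log_bounded_moebius: "log_bounded (\<lambda>n. of_int (moebius_mu n))"
  unfolding log_bounded_def
proof (intro allI impI)
  fix n :: nat assume "n \<ge> 1"
  then have "ln (real n) \<ge> 0" by simp
  then show "norm (of_int (moebius_mu n) :: complex) \<le> 1 + ln (real n)"
    using norm_moebius_mu_le_1[of n] by linarith
qed

lemma log_bounded_moebius_ln: "log_bounded (\<lambda>n. of_int (moebius_mu n) * of_real (ln (real n)))"
  unfolding log_bounded_def norm_mult
proof (intro allI impI)
  fix n :: nat assume "n \<ge> 1"
  then have "norm (of_int (moebius_mu n) :: complex) * norm (complex_of_real (ln (real n))) \<le> 1 * ln (real n)"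
    using norm_moebius_mu_le_1[of n] by (intro mult_mono) auto
  then show "norm (of_int (moebius_mu n) :: complex) * norm (complex_of_real (ln (real n))) \<le> 1 + ln (real n)"
    by simp
qed

lemma sum_moebius_divisors_complex:
  assumes "n > 0"
  shows "(\<Sum>d | d dvd n. of_int (moebius_mu d)) = (if n = 1 then 1 else (0::complex))"
proof -
  have "(\<Sum>d | d dvd n. of_int (moebius_mu d)) = complex_of_real (\<Sum>d | d dvd n. real_of_int (moebius_mu d))"
    by simp
  then show ?thesis unfolding sum_moebius_divisors_eq[OF assms] by simp
qed

lemma mt_zt:
  assumes "Re s > 1"
  shows "mt s * zt s = 1"
proof -
  have "(\<lambda>n. (if n = 1 then 1 else 0) * of_nat n powr (-s)) sums (mt s * zt s)"
    by (rule dseries_mult[OF log_bounded_moebius log_bounded_1 assms])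
       (simp add: sum_moebius_divisors_complex)
  moreover have "(\<lambda>n. (if n = 1 then 1 else 0) * of_nat n powr (-s)) = (\<lambda>n. if n = 1 then 1 else 0)"
    by auto
  ultimately show ?thesis
    using sums_unique2[OF _ sums_single[of 1 "\<lambda>_. 1::complex"]] by (metis (no_types, lifting))
qed

text \<open>This is \<open>(1/\<zeta>)' = - \<zeta>' / \<zeta>^2\<close>, obtained from coefficients
  rather than by differentiation. Since \<open>ln d + ln (n div d) = ln n\<close> for
  \<open>d\<close> dividing \<open>n > 0\<close>, the convolution of \<open>\<mu> ln\<close> with 1
  and that of \<open>\<mu>\<close> with \<open>ln\<close> add up to \<open>ln n\<close> times the
  divisor sum of \<mu>, which is 0 for every such \<open>n\<close>. Multiplication by
  \<open>mt\<close> then isolates \<open>mt_ln\<close>.\<close>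

lemma mt_ln_eq:
  assumes "Re s > 1"
  shows "mt_ln s = - (mt s)\<^sup>2 * zt_ln s"
proof -
  have "(\<lambda>n. (\<Sum>d | d dvd n. of_int (moebius_mu d) * of_real (ln (real d)) * 1) * of_nat n powr (-s)) sums (mt_ln s * zt s)"
    by (rule dseries_mult[OF log_bounded_moebius_ln log_bounded_1 assms]) simp
  moreover have "(\<lambda>n. (\<Sum>d | d dvd n. of_int (moebius_mu d) * of_real (ln (real (n div d)))) * of_nat n powr (-s)) sums (mt s * zt_ln s)"
    by (rule dseries_mult[OF log_bounded_moebius log_bounded_ln assms]) simp
  ultimately have "(\<lambda>n. (\<Sum>d | d dvd n. of_int (moebius_mu d) * of_real (ln (real d)) * 1) * of_nat n powr (-s) +
      (\<Sum>d | d dvd n. of_int (moebius_mu d) * of_real (ln (real (n div d)))) * of_nat n powr (-s)) sums (mt_ln s * zt s + mt s * zt_ln s)"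
    by (rule sums_add)
  moreover have "(\<Sum>d | d dvd n. of_int (moebius_mu d) * of_real (ln (real d)) * 1) * of_nat n powr (-s) +
      (\<Sum>d | d dvd n. of_int (moebius_mu d) * of_real (ln (real (n div d)))) * of_nat n powr (-s) = 0" for n
  proof (cases "n = 0")
    case False
    have "(\<Sum>d | d dvd n. of_int (moebius_mu d) * of_real (ln (real d)) * 1) +
      (\<Sum>d | d dvd n. of_int (moebius_mu d) * of_real (ln (real (n div d)))) = 
      (\<Sum>d | d dvd n. of_int (moebius_mu d) * complex_of_real (ln (real n)))"
      unfolding sum.distrib[symmetric]
    proof (intro sum.cong refl)
      fix d assume "d \<in> {d. d dvd n}"
      then obtain e where e: "n = d * e" by (auto elim: dvdE)
      then have "d > 0" "e > 0" using False by auto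
      then show "of_int (moebius_mu d) * of_real (ln (real d)) * 1 + of_int (moebius_mu d) * of_real (ln (real (n div d)))
         = of_int (moebius_mu d) * complex_of_real (ln (real n))"
        using e by (simp add: ln_mult algebra_simps)
    qed
    also have "\<dots> = 0"
      using False by (simp add: sum_distrib_right[symmetric] sum_moebius_divisors_complex)
    finally show ?thesis by (simp add: distrib_right[symmetric])
  qed auto
  ultimately have "(\<lambda>n::nat. 0) sums (mt_ln s * zt s + mt s * zt_ln s)" by simp
  then have "mt_ln s * zt s + mt s * zt_ln s = 0" using sums_unique2 sums_zero by blast
  then have "mt s * (mt_ln s * zt s + mt s * zt_ln s) = 0" by simp
  also have "mt s * (mt_ln s * zt s + mt s * zt_ln s) = (mt s * zt s) * mt_ln s + (mt s)\<^sup>2 * zt_ln s"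
    by (simp add: algebra_simps power2_eq_square)
  finally show ?thesis
    using mt_zt[OF assms] by (simp add: eq_neg_iff_add_eq_0)
qed

section \<open>The Euler product and the 3-4-1 inequality\<close>

lemma prod_of_nat_powr:
  "finite A \<Longrightarrow> (\<Prod>p\<in>A. complex_of_nat p powr z) = of_nat (\<Prod>A) powr z"
  by (induction A rule: finite_induct) (auto simp: powr_times_real simp del: of_nat_prod)

text \<open>The product over the primes up to \<open>N\<close> expands into the sum over the
  squarefree numbers composed of these primes. These finite sets eventually contain any given finite
  set of squarefree numbers, so the unconditional sum \<open>mt s\<close> is the limit.\<close>

lemma euler_product:
  assumes "Re s > 1"
  shows "(\<lambda>N. \<Prod>p | prime p \<and> p \<le> N. 1 - of_nat p powr (-s)) \<longlonglongrightarrow> mt s"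
proof -
  define P where "P N = {p::nat. prime p \<and> p \<le> N}" for N
  define f where "f n = of_int (moebius_mu n) * of_nat n powr (-s)" for n
  define S where "S = {n::nat. squarefree n}"
  define T where "T N = Prod ` Pow (P N)" for N
  have fin: "finite (P N)" for N by (simp add: P_def)
  have sub: "finite A" "\<And>p. p \<in> A \<Longrightarrow> prime p" if "A \<in> Pow (P N)" for A N
    using that finite_subset[OF _ fin] by (auto simp: P_def)
  have "(f has_sum mt s) S"
    using dseries_has_sum[OF log_bounded_moebius assms]
    by (rule has_sum_cong_neutral[THEN iffD1, rotated -1]) (auto simp: S_def f_def moebius_mu_def)
  then have "(sum f \<longlongrightarrow> mt s) (finite_subsets_at_top S)" by (simp add: has_sum_def)
  moreover have "filterlim T (finite_subsets_at_top S) sequentially"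
    unfolding filterlim_finite_subsets_at_top
  proof safe
    fix X assume X: "finite X" "X \<subseteq> S"
    have "finite (T N) \<and> X \<subseteq> T N \<and> T N \<subseteq> S" if N: "N \<ge> Max (insert 0 X)" for N
    proof (intro conjI subsetI)
      show "finite (T N)" using fin by (simp add: T_def)
      show "x \<in> S" if "x \<in> T N" for x
        using that omega_prod_primes(2)[OF sub] by (auto simp: T_def S_def)
      fix x assume x: "x \<in> X"
      then have sf: "squarefree x" using X by (auto simp: S_def)
      then have "x > 0" by (metis not_squarefree_0 gr0I)
      have "x \<le> N" using N X x by simp
      have "prime_factors x \<in> Pow (P N)"
        using \<open>x > 0\<close> \<open>x \<le> N\<close> by (auto simp: P_def prime_factors_dvd dest!: dvd_imp_le)
      then show "x \<in> T N"
        unfolding T_def by (rule image_eqI[where f = Prod, OF prod_prime_factors_squarefree[OF sf, symmetric]])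
    qed
    then show "\<forall>\<^sub>F N in sequentially. finite (T N) \<and> X \<subseteq> T N \<and> T N \<subseteq> S"
      unfolding eventually_sequentially by blast
  qed
  ultimately have "(\<lambda>N. sum f (T N)) \<longlonglongrightarrow> mt s" by (rule filterlim_compose)
  moreover have "sum f (T N) = (\<Prod>p\<in>P N. 1 - of_nat p powr (-s))" for N
  proof -
    have "inj_on Prod (Pow (P N))"
    proof (rule inj_on_inverseI)
      fix A assume "A \<in> Pow (P N)"
      from sub[OF this] show "prime_factors (\<Prod>A) = A" by (rule omega_prod_primes)
    qed
    then have "sum f (T N) = (\<Sum>A\<in>Pow (P N). f (\<Prod>A))"
      by (simp add: T_def sum.reindex)
    also have "\<dots> = (\<Sum>A\<in>Pow (P N). \<Prod>p\<in>A. - (of_nat p powr (-s)))"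
    proof (rule sum.cong[OF refl])
      fix A assume A: "A \<in> Pow (P N)"
      have A': "finite A" "\<And>p. p \<in> A \<Longrightarrow> prime p" using sub[OF A] by auto
      have "f (\<Prod>A) = (-1) ^ card A * of_nat (\<Prod>A) powr (-s)"
        by (simp add: f_def moebius_mu_def omega_prod_primes(2,3)[OF A'] del: of_nat_prod)
      then show "f (\<Prod>A) = (\<Prod>p\<in>A. - (of_nat p powr (-s)))"
        by (simp only: prod_uminus prod_of_nat_powr[OF A'(1)])
    qed
    also have "\<dots> = (\<Prod>p\<in>P N. - (of_nat p powr (-s)) + 1)"
      by (subst prod_add[OF fin]) simp
    finally show ?thesis by simp
  qed
  ultimately show ?thesis by (simp add: P_def)
qed

text \<open>The 3-4-1 inequality at a single prime, with \<open>r = p powr (- \<sigma>)\<close> and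
  \<open>c\<close> of the form \<open>p powr (- i t)\<close>. The negative logarithm of the product
  is a series with terms \<open>r^n / n\<close> times \<open>3 + 4 cos \<theta> + cos (2 \<theta>) =
  2 (1 + cos \<theta>)^2\<close>, where \<open>c^n = exp (i \<theta>)\<close>. The factors belong to
  \<open>1/\<zeta>\<close>, hence the upper bound 1.\<close>

lemma mertens_341:
  assumes r: "0 \<le> r" "r < 1" and c: "norm (c::complex) = 1"
  shows "norm (1 - complex_of_real r)^3 * norm (1 - of_real r * c)^4 * norm (1 - of_real r * c\<^sup>2) \<le> 1"
proof -
  have sums: "(\<lambda>n. Re ((of_real r * z)^n) / real n) sums - ln (norm (1 - of_real r * z))" if z: "norm z = 1" for z
  proof -
    have "norm (- (of_real r * z)) < 1" using r z by (simp add: norm_mult)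
    from Ln_series'[OF this] have "(\<lambda>n. - ((of_real r * z)^n) / of_nat n) sums ln (1 - of_real r * z)"
      by simp
    then have "(\<lambda>n. Re (- ((of_real r * z)^n) / of_nat n)) sums Re (ln (1 - of_real r * z))"
      by (rule sums_Re)
    moreover have "1 - of_real r * z \<noteq> 0"
      using \<open>norm (- (of_real r * z)) < 1\<close> by auto
    ultimately have "(\<lambda>n. Re (- ((of_real r * z)^n) / of_nat n)) sums ln (norm (1 - of_real r * z))"
      by simp
    from sums_minus[OF this] show ?thesis by simp
  qed
  have pos: "norm (1 - of_real r * z) > 0" if z: "norm z = 1" for z :: complex
  proof -
    have "norm (of_real r * z) < 1" using r z by (simp add: norm_mult)
    then show ?thesis by auto
  qed
  have c2: "norm (c\<^sup>2) = 1" using c by (simp add: norm_power)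
  define A where "A z = - ln (norm (1 - of_real r * z))" for z :: complex
  have total: "(\<lambda>n. 3 * (Re ((of_real r * 1)^n) / real n) + 4 * (Re ((of_real r * c)^n) / real n) + Re ((of_real r * c\<^sup>2)^n) / real n)
     sums (3 * A 1 + 4 * A c + A (c\<^sup>2))"
    unfolding A_def by (intro sums_add sums_mult sums c c2) auto
  have nonneg: "3 * (Re ((of_real r * 1)^n) / real n) + 4 * (Re ((of_real r * c)^n) / real n) + Re ((of_real r * c\<^sup>2)^n) / real n \<ge> 0" for n
  proof -
    define x y where "x = Re (c^n)" and "y = Im (c^n)"
    have xy: "x\<^sup>2 + y\<^sup>2 = 1"
      using c by (simp add: x_def y_def flip: cmod_power2) (simp add: norm_power)
    have "(c\<^sup>2)^n = (c^n)\<^sup>2"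
      unfolding power_mult[symmetric] by (simp only: mult.commute)
    then have "Re ((c\<^sup>2)^n) = x\<^sup>2 - y\<^sup>2"
      by (simp add: x_def y_def Re_power2)
    then have 1: "3 + 4 * Re (c^n) + Re ((c\<^sup>2)^n) = 2 * (1 + x)\<^sup>2"
      using xy by (simp add: x_def[symmetric] power2_eq_square algebra_simps)
    have "3 * (Re ((of_real r * 1)^n) / real n) + 4 * (Re ((of_real r * c)^n) / real n) + Re ((of_real r * c\<^sup>2)^n) / real n
       = r^n / real n * (3 + 4 * Re (c^n) + Re ((c\<^sup>2)^n))"
      by (simp add: power_mult_distrib flip: of_real_power) (simp add: algebra_simps add_divide_distrib)
    then show ?thesis unfolding 1 using r by simp
  qed
  have "0 \<le> 3 * A 1 + 4 * A c + A (c\<^sup>2)"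
    by (rule sums_le[OF nonneg sums_zero total])
  moreover define a where "a = norm (1 - complex_of_real r)"
  moreover define b where "b = norm (1 - complex_of_real r * c)"
  moreover define d where "d = norm (1 - complex_of_real r * c\<^sup>2)"
  moreover have abd: "a > 0" "b > 0" "d > 0"
    unfolding a_def b_def d_def using pos[of 1] pos[OF c] pos[OF c2] by (simp_all del: zero_less_norm_iff)
  ultimately have "ln (a^3 * b^4 * d) \<le> 0"
    by (simp add: A_def ln_mult ln_realpow)
  then have "a^3 * b^4 * d \<le> 1"
    using abd by (subst (asm) ln_le_zero_iff) auto
  then show ?thesis by (simp only: a_def b_def d_def)
qed

text \<open>The inequality holds prime by prime for the finite Euler products and passes to the
  limit. Being an upper bound for \<open>mt\<close>, it is a lower bound for its inverse
  \<open>zt\<close>.\<close>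

lemma mt_341:
  assumes "x > 0"
  shows "norm (mt (1 + of_real x))^3 * norm (mt (Complex (1 + x) t))^4 * norm (mt (Complex (1 + x) (2 * t))) \<le> 1"
proof (rule LIMSEQ_le_const2)
  define f where "f s N = (\<Prod>p | prime p \<and> p \<le> N. 1 - of_nat p powr (-s))" for s :: complex and N :: nat
  show "(\<lambda>N. norm (f (1 + of_real x) N)^3 * norm (f (Complex (1 + x) t) N)^4 * norm (f (Complex (1 + x) (2 * t)) N)) \<longlonglongrightarrow>
    norm (mt (1 + of_real x))^3 * norm (mt (Complex (1 + x) t))^4 * norm (mt (Complex (1 + x) (2 * t)))"
    unfolding f_def using assms by (intro tendsto_intros euler_product) auto
  have "norm (f (1 + of_real x) N)^3 * norm (f (Complex (1 + x) t) N)^4 * norm (f (Complex (1 + x) (2 * t)) N) \<le> 1" for N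
  proof -
    have "norm (f (1 + of_real x) N)^3 * norm (f (Complex (1 + x) t) N)^4 * norm (f (Complex (1 + x) (2 * t)) N) =
      (\<Prod>p | prime p \<and> p \<le> N. norm (1 - complex_of_nat p powr (-(1 + of_real x)))^3 * norm (1 - of_nat p powr (- Complex (1 + x) t))^4
         * norm (1 - of_nat p powr (- Complex (1 + x) (2 * t))))"
      by (simp add: f_def prod_norm[symmetric] prod_power_distrib prod.distrib)
    also have "\<dots> \<le> 1"
    proof (rule prod_le_1, safe)
      fix p :: nat assume p: "prime p"
      then have p1: "real p > 1" using prime_gt_1_nat by simp
      define r where "r = real p powr (-(1 + x))"
      define c where "c = complex_of_nat p powr (- (\<i> * of_real t))"
      have r: "0 \<le> r" "r < 1" using p1 assms by (auto simp: r_def powr_less_one)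
      have c: "norm c = 1" using p1 by (simp add: c_def norm_of_nat_powr)
      have rc: "of_real r = complex_of_nat p powr (-(1 + of_real x))"
        using p1 by (simp add: r_def powr_of_real[symmetric])
      have c2: "c\<^sup>2 = complex_of_nat p powr (- (\<i> * of_real (2 * t)))"
        by (simp add: c_def power2_eq_square mult_ac flip: powr_add)
      have t: "- Complex (1 + x) u = -(1 + of_real x) + (- (\<i> * of_real u))" for u
        by (simp add: complex_eq_iff)
      have e1: "complex_of_nat p powr (- Complex (1 + x) t) = of_real r * c"
        unfolding t powr_add rc c_def ..
      have e2: "complex_of_nat p powr (- Complex (1 + x) (2 * t)) = of_real r * c\<^sup>2"
        unfolding t powr_add rc c2 ..
      show "norm (1 - complex_of_nat p powr (-(1 + of_real x)))^3 * norm (1 - of_nat p powr (- Complex (1 + x) t))^4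
         * norm (1 - of_nat p powr (- Complex (1 + x) (2 * t))) \<le> 1"
        unfolding e1 e2 rc[symmetric] by (rule mertens_341[OF r c])
    qed (auto intro!: mult_nonneg_nonneg)
    finally show ?thesis .
  qed
  then show "\<exists>K. \<forall>N\<ge>K. norm (f (1 + of_real x) N)^3 * norm (f (Complex (1 + x) t) N)^4 * norm (f (Complex (1 + x) (2 * t)) N) \<le> 1"
    by blast
qed

section \<open>Upper and lower bounds for zeta to the right of Re s = 1\<close>

lemma zt_has_field_derivative:
  assumes "Re s > 1"
  shows "(zt has_field_derivative - zt_ln s) (at s)"
proof -
  define \<sigma> where "\<sigma> = (1 + Re s) / 2"
  have \<sigma>: "\<sigma> > 1" "\<sigma> < Re s" using assms by (auto simp: \<sigma>_def)
  define S where "S = {z. Re z \<ge> \<sigma>}"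
  have "((\<lambda>s. \<Sum>n. of_nat n powr (-s)) has_field_derivative (\<Sum>n. - (of_real (ln (real n)) * of_nat n powr (-s)))) (at s)"
  proof (rule has_field_derivative_series'(2))
    show "convex S" unfolding S_def by (rule convex_halfspace_Re_ge)
    show "((\<lambda>s. of_nat n powr (-s)) has_field_derivative - (of_real (ln (real n)) * of_nat n powr (-z))) (at z within S)" for n z
    proof (cases "n = 0")
      case False
      then have "((\<lambda>s. complex_of_nat n powr (-s)) has_field_derivative Ln (of_nat n) * of_nat n powr (-z) * (-1)) (at z)"
        by (intro DERIV_chain2[OF has_field_derivative_powr_right]) (auto intro!: derivative_eq_intros)
      also have "Ln (of_nat n) * of_nat n powr (-z) * (-1) = - (of_real (ln (real n)) * of_nat n powr (-z))"
        using False by (simp add: Ln_of_nat)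
      finally show ?thesis by (rule has_field_derivative_at_within)
    qed auto
    show "uniformly_convergent_on S (\<lambda>n z. \<Sum>i<n. - (complex_of_real (ln (real i)) * of_nat i powr (-z)))"
      by (rule Weierstrass_m_test'[OF _ summable_ln_powr[OF \<sigma>(1)]])
         (use norm_dterm_le[OF log_bounded_ln] in \<open>auto simp: S_def\<close>)
    show "s \<in> S" using \<sigma> by (simp add: S_def)
    show "summable (\<lambda>n. of_nat n powr (-s))"
      using dseries_sums[OF log_bounded_1 assms] by (simp add: sums_iff)
    have "{z. Re z > \<sigma>} \<subseteq> S" "open {z. Re z > \<sigma>}"
      by (auto simp: S_def open_halfspace_Re_gt)
    then show "s \<in> interior S" using \<sigma> by (auto intro: interiorI)
  qed
  moreover have "(\<Sum>n. - (of_real (ln (real n)) * of_nat n powr (-s))) = - zt_ln s"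
    using dseries_sums[OF log_bounded_ln assms] by (simp add: sums_iff suminf_minus)
  moreover have "(\<lambda>s. \<Sum>n. complex_of_nat n powr (-s)) = zt" by (simp add: dseries_def fun_eq_iff)
  ultimately show ?thesis by simp
qed

text \<open>The \<open>L\<close> of \<open>zeta_point\<close> as a function of the height. The
  summand 1 keeps it at least 1 for all \<open>t\<close>, so its powers increase with the exponent
  and absorb constants.\<close>

definition log_height :: "real \<Rightarrow> real" where
  "log_height t = 1 + ln (1 + \<bar>t\<bar>)"

lemma log_height_ge_1: "log_height t \<ge> 1"
  by (simp add: log_height_def)

lemma log_height_double: "log_height (2 * t) \<le> 2 * log_height t"
proof -
  have "ln (1 + \<bar>2 * t\<bar>) \<le> ln (2 * (1 + \<bar>t\<bar>))" by (subst ln_le_cancel_iff) auto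
  also have "\<dots> = ln 2 + ln (1 + \<bar>t\<bar>)" by (rule ln_mult_pos) auto
  also have "ln 2 \<le> (1::real)" using ln_le_minus_one[of "2::real"] by simp
  finally have "ln (1 + \<bar>2 * t\<bar>) \<le> 1 + ln (1 + \<bar>t\<bar>)" by simp
  moreover have "ln (1 + \<bar>t\<bar>) \<ge> 0" by (rule ln_ge_zero) simp
  moreover have "1 + a \<le> 2 * (1 + b)" if "a \<le> 1 + b" "0 \<le> b" for a b :: real
    using that by (simp add: algebra_simps)
  ultimately show ?thesis unfolding log_height_def by blast
qed

lemma zt_pole:
  assumes "1 < Re s" "Re s \<le> 2"
  shows "norm (zt s - 1 / (s-1)) \<le> 34 * log_height (Im s)"
    and "norm (zt_ln s - 1 / (s-1)\<^sup>2) \<le> 38 * (log_height (Im s))\<^sup>2"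
  using zeta_point.norm_zt_minus_pole zeta_point.norm_zt_ln_minus_pole assms
  by (auto simp: zeta_point_def log_height_def)

text \<open>The threshold 1/272 is half of 1/136, and for \<open>|s - 1| \<le> 1/136\<close> the bound
  \<open>zt_pole\<close> gives \<open>|(s - 1) zt s - 1| \<le> 1/2\<close>.\<close>

lemma zt_upper_away:
  assumes "1 < Re s" "Re s \<le> 2" "norm (s - 1) \<ge> 1/272"
  shows "norm (zt s) \<le> 306 * log_height (Im s)" "norm (zt_ln s) \<le> 80000 * (log_height (Im s))\<^sup>2"
proof -
  have L: "log_height (Im s) \<ge> 1" by (rule log_height_ge_1)
  have s: "s \<noteq> 1" using assms by auto
  have i: "norm (1 / (s-1)) \<le> 272"
    using assms s by (simp add: norm_divide divide_simps)
  have "norm (1 / (s-1)\<^sup>2) = norm (1 / (s-1))^2" by (simp add: norm_divide norm_power power_divide)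
  also have "\<dots> \<le> 272^2" using i by (intro power_mono) auto
  finally have i2: "norm (1 / (s-1)\<^sup>2) \<le> 73984" by simp
  have "norm (zt s) \<le> norm (zt s - 1 / (s-1)) + norm (1 / (s-1))"
    using norm_triangle_ineq[of "zt s - 1 / (s-1)" "1 / (s-1)"] by simp
  then show "norm (zt s) \<le> 306 * log_height (Im s)" using zt_pole(1)[OF assms(1,2)] i L by linarith
  have "norm (zt_ln s) \<le> norm (zt_ln s - 1 / (s-1)\<^sup>2) + norm (1 / (s-1)\<^sup>2)"
    using norm_triangle_ineq[of "zt_ln s - 1 / (s-1)\<^sup>2" "1 / (s-1)\<^sup>2"] by simp
  then show "norm (zt_ln s) \<le> 80000 * (log_height (Im s))\<^sup>2"
    using zt_pole(2)[OF assms(1,2)] i2 one_le_power[OF L, of 2] by linarith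
qed

text \<open>On the real axis \<open>zt\<close> is at most \<open>34 + 1/x \<le> 35/x\<close>, and
  612 is twice 306 because passing to height \<open>2 t\<close> at most doubles
  \<open>log_height\<close>. The resulting bound degenerates like \<open>x^(3/4)\<close> as
  \<open>x\<close> tends to 0, a defect that \<open>zt_lower\<close> repairs.\<close>

lemma zt_lower_341:
  assumes x: "0 < x" "x \<le> 1" and t: "\<bar>t\<bar> \<ge> 1/272"
  shows "norm (zt (Complex (1 + x) t)) ^ 4 * (612 * 35^3 * log_height t) \<ge> x^3"
proof -
  define a b c where "a = zt (1 + of_real x)" and "b = zt (Complex (1 + x) t)" and "c = zt (Complex (1 + x) (2 * t))"
  define a' b' c' where "a' = mt (1 + of_real x)" and "b' = mt (Complex (1 + x) t)" and "c' = mt (Complex (1 + x) (2 * t))"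
  have inv: "a' * a = 1" "b' * b = 1" "c' * c = 1"
    unfolding a_def b_def c_def a'_def b'_def c'_def using x by (auto intro!: mt_zt)
  have 341: "norm a'^3 * norm b'^4 * norm c' \<le> 1"
    unfolding a'_def b'_def c'_def by (rule mt_341[OF x(1)])
  have "1 = (norm a' * norm a)^3 * (norm b' * norm b)^4 * (norm c' * norm c)"
    by (simp add: inv flip: norm_mult)
  also have "\<dots> = (norm a'^3 * norm b'^4 * norm c') * (norm a^3 * norm b^4 * norm c)"
    by (simp add: power_mult_distrib)
  also have "\<dots> \<le> 1 * (norm a^3 * norm b^4 * norm c)"
    by (intro mult_right_mono 341) auto
  finally have 1: "1 \<le> norm a^3 * norm b^4 * norm c" by simp
  have "norm (a - 1 / of_real x) \<le> 34 * log_height 0"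
    using zt_pole(1)[of "1 + of_real x"] x by (simp add: a_def)
  then have "norm a \<le> 34 + norm (1 / complex_of_real x)"
    using norm_triangle_ineq[of "a - 1 / of_real x" "1 / of_real x"] by (simp add: log_height_def)
  then have a: "norm a \<le> 35 / x"
    using x by (simp add: norm_divide divide_simps)
  have "2 * \<bar>t\<bar> \<le> norm (Complex (1 + x) (2 * t) - 1)"
    using abs_Im_le_cmod[of "Complex (1 + x) (2 * t) - 1"] by (simp add: abs_mult)
  then have "norm c \<le> 306 * log_height (2 * t)"
    unfolding c_def using zt_upper_away(1)[of "Complex (1 + x) (2 * t)"] x t by simp
  then have c: "norm c \<le> 612 * log_height t" using log_height_double[of t] by linarith
  have "norm a^3 * norm b^4 * norm c \<le> (35 / x)^3 * norm b^4 * (612 * log_height t)"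
    using a c x by (intro mult_mono power_mono) auto
  with 1 have "1 \<le> (35 / x)^3 * norm b^4 * (612 * log_height t)" by linarith
  then show ?thesis
    using x by (simp add: b_def power_divide field_simps)
qed

text \<open>Two effects are balanced. The 3-4-1 bound at distance \<open>x0\<close> is of order
  \<open>x0^(3/4) L^(-1/4)\<close>, while a horizontal move by at most \<open>x0\<close> changes
  \<open>zt\<close> by \<open>O(L^2 x0)\<close>, since the derivative is \<open>O(L^2)\<close>. Both
  have the same order when \<open>x0\<close> is of order \<open>L^(-9)\<close>, and that common
  order is \<open>L^(-7)\<close>. Points closer to the line inherit the bound from
  \<open>x0\<close>.\<close>

lemma zt_lower:
  "\<exists>B>0. \<forall>x t. 0 < x \<longrightarrow> x \<le> 1/272 \<longrightarrow> \<bar>t\<bar> \<ge> 1/272 \<longrightarrow> norm (zt (Complex (1 + x) t)) \<ge> B / log_height t ^ 7"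
proof (intro exI conjI allI impI)
  \<comment> \<open>The choice of \<open>a\<close> ensures
    \<open>a^4 \<le> 1 / (612 * 35^3)\<close>, and that of \<open>k\<close> ensures
    \<open>80000 * k = a / 2\<close>. The 3-4-1 bound at \<open>x0\<close> is then
    \<open>k^3 * a / L^7\<close>, and the variation of \<open>zt\<close> is at most half of it,
    \<open>B / L^7\<close>.\<close>
  define a k :: real where "a = 1 / 80" and "k = a / 160000"
  define B where "B = k^3 * a / 2"
  show B: "B > 0" by (simp add: B_def k_def a_def)
  have k: "k > 0" "a > 0" by (simp_all add: k_def a_def)
  fix x t :: real assume x: "0 < x" "x \<le> 1/272" and t: "\<bar>t\<bar> \<ge> 1/272"
  define L where "L = log_height t"
  have L: "L \<ge> 1" "L > 0" using log_height_ge_1[of t] by (auto simp: L_def)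
  \<comment> \<open>At \<open>x0\<close> the lower bound from 3-4-1 is twice the possible variation of \<open>zt\<close> on \<open>{0..x0}\<close>.\<close>
  define x0 where "x0 = k^4 / L^9"
  have "k^4 \<le> 1/272" by (simp add: k_def a_def power_divide)
  moreover have "x0 \<le> k^4 / 1" unfolding x0_def using L k by (intro divide_left_mono) (auto intro: one_le_power)
  ultimately have x0: "x0 \<le> 1/272" by linarith
  have x0': "x0 > 0" using L k by (auto simp: x0_def)
  have large: "norm (zt (Complex (1 + y) t)) \<ge> 2 * B / L^7" if y: "x0 \<le> y" "y \<le> 1/272" for y
  proof (rule power_le_imp_le_base)
    have "(2 * B / L^7)^Suc 3 = (k^12 / L^27) * (a^4 / L)"
      using L by (simp add: B_def power_mult_distrib power_divide flip: power_mult) (simp add: field_simps flip: power_Suc power_add)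
    also have "k^12 / L^27 = x0^3" by (simp add: x0_def power_divide flip: power_mult)
    also have "x0^3 * (a^4 / L) \<le> y^3 * (1 / (612 * 35^3 * L))"
      using x0' y L by (intro mult_mono power_mono) (auto simp: a_def divide_simps)
    also have "\<dots> \<le> norm (zt (Complex (1 + y) t)) ^ 4"
      using zt_lower_341[of y t] x0' y t L by (simp add: L_def divide_simps)
    finally show "(2 * B / L^7)^Suc 3 \<le> norm (zt (Complex (1 + y) t)) ^ Suc 3" by simp
  qed auto
  have "norm (zt (Complex (1 + x) t)) \<ge> B / L^7"
  proof (cases "x0 \<le> x")
    case True
    have "B / L^7 \<le> 2 * B / L^7" using B L by (intro divide_right_mono) auto
    with large[OF True x(2)] show ?thesis by linarith
  next
    case False
    define S where "S = {z. 1 < Re z \<and> Re z \<le> 1 + 1/272 \<and> Im z = t}"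
    have "norm (zt (Complex (1 + x0) t) - zt (Complex (1 + x) t)) \<le> 80000 * L^2 * norm (Complex (1 + x0) t - Complex (1 + x) t)"
    proof (rule field_differentiable_bound)
      have "S = {z. 1 < Re z} \<inter> {z. Re z \<le> 1 + 1/272} \<inter> {z. Im z \<le> t} \<inter> {z. Im z \<ge> t}" by (auto simp: S_def)
      then show "convex S"
        by (simp only:) (intro convex_Int convex_halfspace_Re_gt convex_halfspace_Re_le convex_halfspace_Im_le convex_halfspace_Im_ge)
      show "(zt has_field_derivative - zt_ln z) (at z within S)" if "z \<in> S" for z
        using that by (intro has_field_derivative_at_within[OF zt_has_field_derivative]) (auto simp: S_def)
      show "norm (- zt_ln z) \<le> 80000 * L^2" if "z \<in> S" for z
      proof -
        have z: "1 < Re z" "Re z \<le> 2" "Im z = t" using that by (auto simp: S_def)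
        then have "1/272 \<le> norm (z - 1)"
          using t abs_Im_le_cmod[of "z - 1"] by simp
        from zt_upper_away(2)[OF z(1,2) this] show ?thesis using z(3) by (simp add: L_def)
      qed
    qed (use x x0 x0' in \<open>auto simp: S_def\<close>)
    also have "norm (Complex (1 + x0) t - Complex (1 + x) t) = x0 - x"
      using False by (simp add: complex_diff norm_complex_def)
    also have "80000 * L^2 * (x0 - x) \<le> 80000 * L^2 * x0" using x L by (intro mult_left_mono) auto
    also have "\<dots> = B / L^7"
    proof -
      have *: "L^9 = L^7 * L^2" "k^4 = k * k^3" by (simp_all flip: power_add power_Suc)
      have "80000 * L^2 * x0 = (80000 * k) * k^3 / L^7"
        unfolding x0_def * using L by (simp add: field_simps del: power_Suc)
      also have "80000 * k = a / 2" by (simp add: k_def)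
      finally show ?thesis by (simp add: B_def mult_ac)
    qed
    finally have "norm (zt (Complex (1 + x0) t) - zt (Complex (1 + x) t)) \<le> B / L^7" .
    moreover have "2 * B / L^7 \<le> norm (zt (Complex (1 + x0) t))" using x0 by (intro large) auto
    ultimately show ?thesis
      using norm_triangle_ineq2[of "zt (Complex (1 + x0) t)" "zt (Complex (1 + x) t)"] by simp
  qed
  then show "norm (zt (Complex (1 + x) t)) \<ge> B / log_height t ^ 7" by (simp add: L_def)
qed

text \<open>This is \<open>- (1 / ((s - 1) \<zeta>(s)))'\<close>, with \<open>zt_ln = - \<zeta>'\<close> and \<open>mt = 1/\<zeta>\<close>.\<close>

definition mu_laplace :: "complex \<Rightarrow> complex" where
  "mu_laplace s = (mt s)\<^sup>2 * (zt s - (s-1) * zt_ln s) / (s-1)\<^sup>2"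

text \<open>The numerator loses its pole: with \<open>w = s - 1\<close>,
  \<open>zt - w * zt_ln\<close> equals \<open>E1 - w * E2\<close> for the error terms of
  \<open>zt_pole\<close>, so \<open>mu_laplace\<close> is this times the square of
  \<open>1 / (w * zt)\<close>. Near \<open>s = 1\<close> the latter is bounded because
  \<open>w * zt\<close> is close to 1. Elsewhere \<open>zt_lower\<close> costs \<open>L^14\<close>
  and \<open>E2\<close> costs \<open>L^2\<close>, whence the exponent 16; the factor
  \<open>w\<close> against \<open>1 / w^2\<close> leaves the decay
  \<open>1 / (1 + |t|)\<close>.\<close>

lemma mu_laplace_bound_log:
  "\<exists>C>0. \<forall>x t. 0 < x \<longrightarrow> x \<le> 1/272 \<longrightarrow> norm (mu_laplace (Complex (1 + x) t)) \<le> C * log_height t ^ 16 / (1 + \<bar>t\<bar>)"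
proof -
  obtain B where B: "B > 0" and lower:
    "\<And>x t. 0 < x \<Longrightarrow> x \<le> 1/272 \<Longrightarrow> \<bar>t\<bar> \<ge> 1/272 \<Longrightarrow> norm (zt (Complex (1 + x) t)) \<ge> B / log_height t ^ 7"
    using zt_lower by blast
  \<comment> \<open>The first summand serves \<open>|t| \<le> 1/272\<close>, where the constant is
    \<open>288 = 4 * (34 + 38)\<close>. The second serves larger \<open>|t|\<close>, where
    \<open>9286 = 272 * 34 + 38\<close> and \<open>1 + |t| \<le> 273 * |t|\<close> combine to
    \<open>273 * 9286 < 3000000\<close>.\<close>
  define C where "C = 1152 + 3000000 / B\<^sup>2"
  show ?thesis
  proof (intro exI conjI allI impI)
    show "C > 0" using B by (auto simp: C_def intro!: add_pos_nonneg)
    fix x t :: real assume x: "0 < x" "x \<le> 1/272"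
    define s where "s = Complex (1 + x) t"
    define w where "w = s - 1"
    define L where "L = log_height t"
    have L: "L \<ge> 1" by (simp add: L_def log_height_ge_1)
    have s: "1 < Re s" "Re s \<le> 2" "Im s = t" using x by (auto simp: s_def)
    have w: "w \<noteq> 0" "Re w = x" "Im w = t" using x by (auto simp: w_def s_def complex_eq_iff)
    define E1 where "E1 = zt s - 1 / w"
    define E2 where "E2 = zt_ln s - 1 / w\<^sup>2"
    have E1: "norm E1 \<le> 34 * L" and E2: "norm E2 \<le> 38 * L\<^sup>2"
      using zt_pole[OF s(1,2)] s(3) by (simp_all add: E1_def E2_def w_def L_def)
    have inv: "mt s * zt s = 1" using s by (intro mt_zt)
    then have zt0: "zt s \<noteq> 0" by auto
    have mt: "mt s = 1 / zt s" using inv zt0 by (simp add: field_simps)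
    have EE: "zt s - w * zt_ln s = E1 - w * E2"
      using w by (simp add: E1_def E2_def power2_eq_square field_simps)
    have EEn: "norm (E1 - w * E2) \<le> 34 * L + norm w * (38 * L\<^sup>2)"
      using norm_triangle_ineq4[of E1 "w * E2"] E1 mult_left_mono[OF E2, of "norm w"] by (simp add: norm_mult)
    have mu_laplace: "mu_laplace s = (1 / (w * zt s))\<^sup>2 * (E1 - w * E2)"
      unfolding mu_laplace_def w_def[symmetric] EE mt by (simp add: power_mult_distrib power_divide)
    have LL: "L \<le> L^16" "L\<^sup>2 \<le> L^16" "L^15 \<le> L^16"
      using L power_increasing[of 1 16 L] by (auto intro: power_increasing)
    show "norm (mu_laplace (Complex (1 + x) t)) \<le> C * log_height t ^ 16 / (1 + \<bar>t\<bar>)"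
    proof (cases "\<bar>t\<bar> \<le> 1/272")
      case True
      have "norm w \<le> 1/136" using cmod_le[of w] w True x by auto
      have "ln (1 + \<bar>t\<bar>) \<le> \<bar>t\<bar>" by (rule ln_add_one_self_le_self) auto
      then have L2: "L \<le> 2" using True by (simp add: L_def log_height_def)
      have "norm (w * E1) \<le> 1/136 * (34 * 2)"
        unfolding norm_mult using \<open>norm w \<le> 1/136\<close> E1 L2 by (intro mult_mono) auto
      moreover have "w * zt s = 1 + w * E1" using w by (simp add: E1_def field_simps)
      ultimately have "norm (w * zt s) \<ge> 1/2"
        using norm_triangle_ineq2[of 1 "- (w * E1)"] by simp
      then have "norm (1 / (w * zt s)) \<le> 2" using w zt0 by (simp add: norm_divide divide_simps norm_mult)
      then have "norm (1 / (w * zt s))^2 \<le> 2^2" by (intro power_mono) auto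
      then have "norm (mu_laplace s) \<le> 4 * (34 * L + norm w * (38 * L\<^sup>2))"
        unfolding mu_laplace norm_mult norm_power using EEn by (intro mult_mono) auto
      also have "norm w * (38 * L\<^sup>2) \<le> 1 * (38 * L\<^sup>2)" using \<open>norm w \<le> 1/136\<close> by (intro mult_right_mono) auto
      also have "4 * (34 * L + 1 * (38 * L\<^sup>2)) \<le> 288 * L^16" using LL by simp
      also have "\<dots> \<le> C / 2 * L^16" using B L by (intro mult_right_mono) (auto simp: C_def)
      also have "\<dots> \<le> C * L^16 / (1 + \<bar>t\<bar>)"
      proof -
        have "C * L^16 / 2 \<le> C * L^16 / (1 + \<bar>t\<bar>)"
          using True L B by (intro divide_left_mono mult_nonneg_nonneg) (auto simp: C_def)
        then show ?thesis by simp
      qed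
      finally show ?thesis by (simp add: s_def L_def)
    next
      case False
      have tw: "\<bar>t\<bar> \<le> norm w" using abs_Im_le_cmod[of w] w by simp
      have "norm (zt s) \<ge> B / L^7" unfolding s_def L_def using False x by (intro lower) auto
      then have "norm (1 / zt s) \<le> L^7 / B"
        using zt0 B L by (simp add: norm_divide divide_simps mult_ac)
      then have "norm (1 / zt s)^2 \<le> (L^7 / B)^2" by (intro power_mono) auto
      then have "norm (1 / zt s)^2 * norm (E1 - w * E2) \<le> (L^7 / B)^2 * (34 * L + norm w * (38 * L\<^sup>2))"
        using EEn by (intro mult_mono) auto
      also have "\<dots> = (34 * L^15 + norm w * (38 * L^16)) / B\<^sup>2"
      proof -
        have *: "L^15 = L^14 * L" "L^16 = L^14 * L^2" by (simp_all flip: power_add power_Suc2)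
        show ?thesis unfolding * by (simp add: power_divide algebra_simps add_divide_distrib flip: power_mult)
      qed
      also have "\<dots> \<le> ((272 * norm w) * (34 * L^16) + norm w * (38 * L^16)) / B\<^sup>2"
      proof (intro divide_right_mono add_right_mono)
        have "1 * (34 * L^15) \<le> (272 * norm w) * (34 * L^16)"
          using tw False LL L by (intro mult_mono) auto
        then show "34 * L^15 \<le> (272 * norm w) * (34 * L^16)" by simp
      qed auto
      also have "\<dots> = 9286 * norm w * L^16 / B\<^sup>2" by (simp add: algebra_simps)
      finally have *: "norm (1 / zt s)^2 * norm (E1 - w * E2) \<le> 9286 * norm w * L^16 / B\<^sup>2" .
      have nw: "norm w > 0" using w by simp
      have "norm (mu_laplace s) = norm (1 / zt s)^2 * norm (E1 - w * E2) / norm w ^ 2"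
        unfolding mu_laplace by (simp add: norm_mult norm_power norm_divide power_mult_distrib power_divide)
      also have "\<dots> \<le> (9286 * norm w * L^16 / B\<^sup>2) / norm w ^ 2"
        by (intro divide_right_mono *) auto
      also have "\<dots> = (9286 / B\<^sup>2) * L^16 / norm w" using nw by (simp add: power2_eq_square field_simps)
      also have "\<dots> \<le> (9286 / B\<^sup>2) * L^16 / ((1 + \<bar>t\<bar>) / 273)"
        using tw False L nw by (intro divide_left_mono mult_nonneg_nonneg mult_pos_pos) auto
      also have "\<dots> = (273 * 9286 / B\<^sup>2) * L^16 / (1 + \<bar>t\<bar>)" by simp
      also have "\<dots> \<le> C * L^16 / (1 + \<bar>t\<bar>)"
      proof (intro divide_right_mono mult_right_mono)
        show "273 * 9286 / B\<^sup>2 \<le> C" unfolding C_def using B by (simp add: divide_simps)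
      qed (use L in auto)
      finally show ?thesis by (simp add: s_def L_def)
    qed
  qed
qed

text \<open>The 16 logarithms are traded for \<open>(1 + |t|) powr (1/4)\<close>, each costing the
  exponent 1/64 and a factor \<open>65 = 64 + 1\<close>. The decay \<open>-3/4\<close> that remains
  becomes \<open>-3/2\<close> after squaring, an integrable majorant independent of
  \<open>x\<close>.\<close>

lemma mu_laplace_bound:
  "\<exists>C>0. \<forall>x t. 0 < x \<longrightarrow> x \<le> 1/272 \<longrightarrow> (norm (mu_laplace (Complex (1 + x) t)))\<^sup>2 \<le> C * (1 + \<bar>t\<bar>) powr (-3/2)"
proof -
  obtain C where C: "C > 0"
    "\<And>x t. 0 < x \<Longrightarrow> x \<le> 1/272 \<Longrightarrow> norm (mu_laplace (Complex (1 + x) t)) \<le> C * log_height t ^ 16 / (1 + \<bar>t\<bar>)"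
    using mu_laplace_bound_log by blast
  have log_height: "log_height t \<le> 65 * (1 + \<bar>t\<bar>) powr (1/64)" for t
  proof -
    have "ln (1 + \<bar>t\<bar>) \<le> (1 + \<bar>t\<bar>) powr (1/64) / (1/64)" by (rule ln_powr_bound) auto
    moreover have "1 \<le> (1 + \<bar>t\<bar>) powr (1/64)" by (intro ge_one_powr_ge_zero) auto
    ultimately show ?thesis by (simp add: log_height_def)
  qed
  show ?thesis
  proof (intro exI[of _ "(C * 65^16)\<^sup>2"] conjI allI impI)
    fix x t :: real assume x: "0 < x" "x \<le> 1/272"
    define T where "T = 1 + \<bar>t\<bar>"
    have T: "T \<ge> 1" by (simp add: T_def)
    have "log_height t ^ 16 \<le> (65 * T powr (1/64))^16"
      using log_height[of t] log_height_ge_1[of t] by (intro power_mono) (auto simp: T_def)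
    also have "\<dots> = 65^16 * T powr (1/4)"
      using T by (simp add: power_mult_distrib powr_powr flip: powr_realpow)
    finally have "C * log_height t ^ 16 / T \<le> C * (65^16 * T powr (1/4)) / T"
      using C T by (intro divide_right_mono mult_left_mono) auto
    also have "\<dots> = (C * 65^16) * (T powr (1/4) / T powr 1)" using T by simp
    also have "T powr (1/4) / T powr 1 = T powr (1/4 - 1)" by (rule powr_diff[symmetric])
    finally have "norm (mu_laplace (Complex (1 + x) t)) \<le> (C * 65^16) * T powr (-3/4)"
      using C(2)[OF x, of t] by (simp add: T_def)
    then have "(norm (mu_laplace (Complex (1 + x) t)))\<^sup>2 \<le> ((C * 65^16) * T powr (-3/4))\<^sup>2"
      by (intro power_mono) auto
    also have "\<dots> = (C * 65^16)\<^sup>2 * (T powr (-3/4) * T powr (-3/4))"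
      by (simp only: power2_eq_square mult_ac)
    also have "T powr (-3/4) * T powr (-3/4) = T powr (-3/2)"
      by (simp flip: powr_add)
    finally show "(norm (mu_laplace (Complex (1 + x) t)))\<^sup>2 \<le> (C * 65^16)\<^sup>2 * (1 + \<bar>t\<bar>) powr (-3/2)"
      by (simp add: T_def)
  qed (use C in auto)
qed

subsection \<open>A Plancherel inequality\<close>

lemma integrable_lborel_product:
  fixes f g :: "real \<Rightarrow> complex"
  assumes "integrable lborel f" "integrable lborel g"
  shows "integrable (lborel \<Otimes>\<^sub>M lborel) (\<lambda>(x,y). f x * g y)"
proof (rule lborel_pair.Fubini_integrable)
  have [measurable]: "f \<in> borel_measurable lborel" "g \<in> borel_measurable lborel"
    using assms by auto
  show "(\<lambda>(x,y). f x * g y) \<in> borel_measurable (lborel \<Otimes>\<^sub>M lborel)"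
    by measurable
qed (use assms in \<open>auto simp: norm_mult\<close>)

text \<open>Fubini in the shape needed twice in \<open>fourier_gaussian\<close>, with an exponential
  of modulus 1 as the kernel \<open>k\<close>.\<close>

lemma lborel_integral_swap_mult:
  fixes f g :: "real \<Rightarrow> complex" and k :: "real \<Rightarrow> real \<Rightarrow> complex"
  assumes f: "integrable lborel f" and g: "integrable lborel g"
    and k[measurable]: "(\<lambda>(x,y). k x y) \<in> borel_measurable (lborel \<Otimes>\<^sub>M lborel)"
    and k1: "\<And>x y. norm (k x y) \<le> 1"
  shows "(\<integral>x. f x * (\<integral>y. g y * k x y \<partial>lborel) \<partial>lborel) = (\<integral>y. g y * (\<integral>x. f x * k x y \<partial>lborel) \<partial>lborel)"
proof -
  have [measurable]: "f \<in> borel_measurable lborel" "g \<in> borel_measurable lborel"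
    using assms by auto
  have "integrable (lborel \<Otimes>\<^sub>M lborel) (\<lambda>(x,y). f x * g y * k x y)"
  proof (rule Bochner_Integration.integrable_bound[OF integrable_lborel_product[OF f g]])
    show "(\<lambda>(x,y). f x * g y * k x y) \<in> borel_measurable (lborel \<Otimes>\<^sub>M lborel)"
      by measurable
    show "AE z in lborel \<Otimes>\<^sub>M lborel. norm (case z of (x, y) \<Rightarrow> f x * g y * k x y) \<le> norm (case z of (x, y) \<Rightarrow> f x * g y)"
      using k1 by (intro AE_I2) (auto simp: norm_mult mult_left_le split: prod.split)
  qed
  then have "(\<integral>y. (\<integral>x. f x * g y * k x y \<partial>lborel) \<partial>lborel) = (\<integral>x. (\<integral>y. f x * g y * k x y \<partial>lborel) \<partial>lborel)"
    by (rule lborel_pair.Fubini_integral)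
  moreover have "(\<integral>x. f x * g y * k x y \<partial>lborel) = g y * (\<integral>x. f x * k x y \<partial>lborel)" for y
    by (subst integral_mult_right_zero[symmetric]) (simp add: mult_ac)
  moreover have "(\<integral>y. f x * g y * k x y \<partial>lborel) = f x * (\<integral>y. g y * k x y \<partial>lborel)" for x
    by (subst integral_mult_right_zero[symmetric]) (simp add: mult_ac)
  ultimately show ?thesis by simp
qed

lemma std_normal_fourier:
  "(\<integral>t. of_real (std_normal_density t) * iexp (t * x) \<partial>lborel) = of_real (exp (- x\<^sup>2 / 2))"
proof -
  have "complex_of_real (exp (- x\<^sup>2 / 2)) = (CLINT t|std_normal_distribution. iexp (x * t))"
    using fun_cong[OF char_std_normal_distribution, of x] by (simp add: char_def)
  also have "\<dots> = (\<integral>t. std_normal_density t *\<^sub>R iexp (x * t) \<partial>lborel)"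
    by (subst integral_density) auto
  finally show ?thesis by (simp add: scaleR_conv_of_real mult_ac)
qed

text \<open>No factor stands in front, which puts \<open>1 / (2 * pi)\<close> into the Plancherel
  inequality.\<close>

definition fourier :: "(real \<Rightarrow> real) \<Rightarrow> real \<Rightarrow> complex" where
  "fourier h t = (\<integral>u. of_real (h u) * iexp (- (t * u)) \<partial>lborel)"

text \<open>The transform is damped by a Gaussian, which is its own Fourier transform, so that Fubini applies
  without assuming the transform to be integrable.\<close>

lemma fourier_gaussian:
  fixes h :: "real \<Rightarrow> real"
  assumes h: "integrable lborel h"
  shows "complex_of_real (\<integral>t. std_normal_density t * (norm (fourier h (t / \<epsilon>)))\<^sup>2 \<partial>lborel) =
    (\<integral>u. of_real (h u) * (\<integral>v. of_real (h v) * of_real (exp (- ((u - v) / \<epsilon>)\<^sup>2 / 2)) \<partial>lborel) \<partial>lborel)"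
proof -
  have [measurable]: "h \<in> borel_measurable borel" using h by auto
  define hc where "hc u = complex_of_real (h u)" for u
  define \<phi> where "\<phi> t = complex_of_real (std_normal_density t)" for t
  have hc: "integrable lborel hc" using h by (simp add: hc_def[abs_def])
  have \<phi>: "integrable lborel \<phi>" by (simp add: \<phi>_def[abs_def])
  have fourier_bound: "norm (fourier h t) \<le> (\<integral>u. norm (hc u) \<partial>lborel)" for t
    unfolding fourier_def hc_def by (rule order_trans[OF integral_norm_bound]) (simp add: norm_mult)
  have fourier_meas[measurable]: "fourier h \<in> borel_measurable borel"
    unfolding fourier_def[abs_def] by measurable
  \<comment> \<open>As \<open>h\<close> is real, conjugation only reverses the sign of the exponent.
    Writing one factor of the squared norm as this integral prepares the first exchange of
    integrals; opening up the other factor prepares the second.\<close>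
  have cnj: "cnj (fourier h t) = (\<integral>u. hc u * iexp (t * u) \<partial>lborel)" for t
    unfolding fourier_def by (subst Bochner_Integration.integral_cnj[symmetric]) (simp add: hc_def exp_cnj)
  have \<phi>f: "integrable lborel (\<lambda>t. \<phi> t * fourier h (t / \<epsilon>))"
  proof (rule Bochner_Integration.integrable_bound)
    show "integrable lborel (\<lambda>t. \<phi> t * of_real (\<integral>u. norm (hc u) \<partial>lborel))" using \<phi> by simp
    show "(\<lambda>t. \<phi> t * fourier h (t / \<epsilon>)) \<in> borel_measurable lborel" unfolding \<phi>_def by measurable
    show "AE t in lborel. norm (\<phi> t * fourier h (t / \<epsilon>)) \<le> norm (\<phi> t * of_real (\<integral>u. norm (hc u) \<partial>lborel))"
      using fourier_bound by (auto simp: norm_mult intro!: mult_left_mono order_trans[OF fourier_bound])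
  qed
  have "complex_of_real (\<integral>t. std_normal_density t * (norm (fourier h (t / \<epsilon>)))\<^sup>2 \<partial>lborel) =
     (\<integral>t. complex_of_real (std_normal_density t * (norm (fourier h (t / \<epsilon>)))\<^sup>2) \<partial>lborel)"
    by (rule integral_complex_of_real[symmetric])
  also have "\<dots> = (\<integral>t. (\<phi> t * fourier h (t / \<epsilon>)) * (\<integral>u. hc u * iexp (t / \<epsilon> * u) \<partial>lborel) \<partial>lborel)"
    unfolding cnj[symmetric] by (simp add: \<phi>_def mult.assoc flip: complex_norm_square)
  also have "\<dots> = (\<integral>u. hc u * (\<integral>t. (\<phi> t * fourier h (t / \<epsilon>)) * iexp (t / \<epsilon> * u) \<partial>lborel) \<partial>lborel)"
    by (rule lborel_integral_swap_mult[OF \<phi>f hc]) (auto simp: measurable_split_conv)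
  also have "\<dots> = (\<integral>u. hc u * (\<integral>v. hc v * of_real (exp (- ((u - v) / \<epsilon>)\<^sup>2 / 2)) \<partial>lborel) \<partial>lborel)"
  proof -
    have "(\<integral>t. (\<phi> t * fourier h (t / \<epsilon>)) * iexp (t / \<epsilon> * u) \<partial>lborel) =
       (\<integral>v. hc v * of_real (exp (- ((u - v) / \<epsilon>)\<^sup>2 / 2)) \<partial>lborel)" for u
    proof -
      have "(\<integral>t. (\<phi> t * fourier h (t / \<epsilon>)) * iexp (t / \<epsilon> * u) \<partial>lborel) =
         (\<integral>t. \<phi> t * (\<integral>v. hc v * iexp (t * ((u - v) / \<epsilon>)) \<partial>lborel) \<partial>lborel)"
      proof (intro Bochner_Integration.integral_cong refl)
        fix t
        have "fourier h (t / \<epsilon>) * iexp (t / \<epsilon> * u) = (\<integral>v. hc v * iexp (t * ((u - v) / \<epsilon>)) \<partial>lborel)"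
          unfolding fourier_def integral_mult_left_zero[symmetric]
          by (intro Bochner_Integration.integral_cong refl)
             (simp add: hc_def mult.assoc diff_divide_distrib algebra_simps flip: exp_add)
        then show "\<phi> t * fourier h (t / \<epsilon>) * iexp (t / \<epsilon> * u) = \<phi> t * (\<integral>v. hc v * iexp (t * ((u - v) / \<epsilon>)) \<partial>lborel)"
          by (simp add: mult.assoc)
      qed
      also have "\<dots> = (\<integral>v. hc v * (\<integral>t. \<phi> t * iexp (t * ((u - v) / \<epsilon>)) \<partial>lborel) \<partial>lborel)"
        by (rule lborel_integral_swap_mult[OF \<phi> hc]) (auto simp: measurable_split_conv)
      finally show ?thesis unfolding \<phi>_def std_normal_fourier .
    qed
    then show ?thesis by simp
  qed
  finally show ?thesis by (simp add: hc_def)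
qed

text \<open>The left side pairs \<open>h\<close> with its Gaussian average at scale
  \<open>\<epsilon>\<close>. By \<open>fourier_gaussian\<close> it is an integral of the squared
  transform against a Gaussian, whose density is at most \<open>1 / sqrt (2 * pi)\<close>; the other
  such factor normalises the averaging kernel. Rescaling \<open>t\<close> cancels the remaining
  \<open>\<epsilon>\<close>.\<close>

lemma gaussian_mollified_le:
  fixes h B :: "real \<Rightarrow> real"
  assumes h: "integrable lborel h" and B: "integrable lborel B"
    and hB: "\<And>t. (norm (fourier h t))\<^sup>2 \<le> B t" and \<epsilon>: "\<epsilon> > 0"
  shows "(\<integral>u. h u * (\<integral>w. h (u + \<epsilon> * w) * std_normal_density w \<partial>lborel) \<partial>lborel) \<le> (\<integral>t. B t \<partial>lborel) / (2 * pi)"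
proof -
  have [measurable]: "h \<in> borel_measurable borel" "B \<in> borel_measurable borel" using h B by auto
  have fourier_meas[measurable]: "fourier h \<in> borel_measurable borel"
    unfolding fourier_def[abs_def] by measurable
  have B0: "B t \<ge> 0" for t by (rule order_trans[OF _ hB]) simp
  have inner: "(\<integral>v. h v * exp (- ((u - v) / \<epsilon>)\<^sup>2 / 2) \<partial>lborel) =
      \<epsilon> * sqrt (2 * pi) * (\<integral>w. h (u + \<epsilon> * w) * std_normal_density w \<partial>lborel)" for u
  proof -
    have "(\<integral>v. h v * exp (- ((u - v) / \<epsilon>)\<^sup>2 / 2) \<partial>lborel) =
       \<bar>\<epsilon>\<bar> *\<^sub>R (\<integral>w. h (u + \<epsilon> * w) * exp (- ((u - (u + \<epsilon> * w)) / \<epsilon>)\<^sup>2 / 2) \<partial>lborel)"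
      using \<epsilon> by (intro lborel_integral_real_affine) auto
    also have "\<dots> = \<epsilon> * (\<integral>w. sqrt (2 * pi) * (h (u + \<epsilon> * w) * std_normal_density w) \<partial>lborel)"
      using \<epsilon> by (simp add: std_normal_density_def)
    finally show ?thesis by (simp only: integral_mult_right_zero mult.assoc)
  qed
  define Q where "Q = (\<integral>u. h u * (\<integral>w. h (u + \<epsilon> * w) * std_normal_density w \<partial>lborel) \<partial>lborel)"
  have "complex_of_real (\<integral>t. std_normal_density t * (norm (fourier h (t / \<epsilon>)))\<^sup>2 \<partial>lborel) =
     (\<integral>u. of_real (h u * (\<integral>v. h v * exp (- ((u - v) / \<epsilon>)\<^sup>2 / 2) \<partial>lborel)) \<partial>lborel)"
    unfolding fourier_gaussian[OF h] of_real_mult[symmetric] integral_complex_of_real ..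
  also have "\<dots> = of_real (\<integral>u. \<epsilon> * sqrt (2 * pi) * (h u * (\<integral>w. h (u + \<epsilon> * w) * std_normal_density w \<partial>lborel)) \<partial>lborel)"
    unfolding inner integral_complex_of_real by (simp add: mult_ac)
  also have "\<dots> = of_real (\<epsilon> * sqrt (2 * pi) * Q)"
    unfolding Q_def integral_mult_right_zero ..
  finally have "\<epsilon> * sqrt (2 * pi) * Q = (\<integral>t. std_normal_density t * (norm (fourier h (t / \<epsilon>)))\<^sup>2 \<partial>lborel)"
    using of_real_eq_iff by metis
  also have "\<dots> \<le> (\<integral>t. B (0 + (1/\<epsilon>) * t) / sqrt (2 * pi) \<partial>lborel)"
  proof (rule integral_mono')
    show "integrable lborel (\<lambda>t. B (0 + (1/\<epsilon>) * t) / sqrt (2 * pi))"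
      using \<epsilon> by (intro integrable_divide lborel_integrable_real_affine B) auto
    fix t
    have "std_normal_density t \<le> 1 / sqrt (2 * pi)"
      by (simp add: std_normal_density_def divide_right_mono)
    then have "std_normal_density t * (norm (fourier h (t / \<epsilon>)))\<^sup>2 \<le> 1 / sqrt (2 * pi) * B (t / \<epsilon>)"
      using hB by (intro mult_mono) auto
    then show "std_normal_density t * (norm (fourier h (t / \<epsilon>)))\<^sup>2 \<le> B (0 + (1/\<epsilon>) * t) / sqrt (2 * pi)" by simp
    show "0 \<le> B (0 + (1/\<epsilon>) * t) / sqrt (2 * pi)" using B0 by simp
  qed
  also have "\<dots> = (\<integral>t. B (0 + (1/\<epsilon>) * t) \<partial>lborel) / sqrt (2 * pi)" by simp
  also have "(\<integral>t. B (0 + (1/\<epsilon>) * t) \<partial>lborel) = \<epsilon> * (\<integral>t. B t \<partial>lborel)"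
    using lborel_integral_real_affine[of "1/\<epsilon>" B 0] \<epsilon> by simp
  finally have "\<epsilon> * (sqrt (2 * pi) * Q) \<le> \<epsilon> * ((\<integral>t. B t \<partial>lborel) / sqrt (2 * pi))" by (simp add: mult_ac)
  then have "sqrt (2 * pi) * Q \<le> (\<integral>t. B t \<partial>lborel) / sqrt (2 * pi)"
    using \<epsilon> by (rule mult_left_le_imp_le)
  then have "Q \<le> (\<integral>t. B t \<partial>lborel) / sqrt (2 * pi) / sqrt (2 * pi)"
    by (subst pos_le_divide_eq) (simp_all only: mult.commute real_sqrt_gt_0_iff, simp)
  then have "Q \<le> (\<integral>t. B t \<partial>lborel) / \<bar>2 * pi\<bar>"
    by (simp only: divide_divide_eq_left real_sqrt_mult_self)
  then show ?thesis by (simp add: Q_def)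
qed

text \<open>The scale in \<open>gaussian_mollified_le\<close> is sent to 0: the averages converge to
  \<open>h\<close> at its points of continuity, and boundedness of \<open>h\<close> supplies the
  majorant \<open>M * |h|\<close>. Continuity is asked for only almost everywhere because the
  functions in question may jump at logarithms of integers.\<close>

lemma plancherel_le:
  fixes h B :: "real \<Rightarrow> real"
  assumes h: "integrable lborel h" and M: "\<And>u. \<bar>h u\<bar> \<le> M" and cont: "AE u in lborel. isCont h u"
    and B: "integrable lborel B" and hB: "\<And>t. (norm (fourier h t))\<^sup>2 \<le> B t"
  shows "(\<integral>u. (h u)\<^sup>2 \<partial>lborel) \<le> (\<integral>t. B t \<partial>lborel) / (2 * pi)"
proof (rule LIMSEQ_le_const2)
  have [measurable]: "h \<in> borel_measurable borel" using h by auto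
  define \<epsilon> where "\<epsilon> n = inverse (real (Suc n))" for n
  have \<epsilon>: "\<epsilon> n > 0" for n by (simp add: \<epsilon>_def)
  have \<epsilon>0: "\<epsilon> \<longlonglongrightarrow> 0" unfolding \<epsilon>_def by (rule LIMSEQ_inverse_real_of_nat)
  have M0: "M \<ge> 0" using M[of 0] by linarith
  define I where "I n u = (\<integral>w. h (u + \<epsilon> n * w) * std_normal_density w \<partial>lborel)" for n u
  have Imeas[measurable]: "I n \<in> borel_measurable borel" for n
    unfolding I_def[abs_def] by measurable
  have I_le: "\<bar>I n u\<bar> \<le> M" for n u
  proof -
    have "norm (I n u) \<le> (\<integral>w. norm (h (u + \<epsilon> n * w) * std_normal_density w) \<partial>lborel)"
      unfolding I_def by (rule integral_norm_bound)
    also have "\<dots> \<le> (\<integral>w. M * std_normal_density w \<partial>lborel)"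
      using M M0 by (intro integral_mono') (auto simp: abs_mult intro!: mult_right_mono)
    also have "\<dots> = M" by simp
    finally show ?thesis by simp
  qed
  have I_lim: "(\<lambda>n. I n u) \<longlonglongrightarrow> h u" if u: "isCont h u" for u
  proof -
    have "(\<lambda>n. I n u) \<longlonglongrightarrow> (\<integral>w. h u * std_normal_density w \<partial>lborel)"
      unfolding I_def
    proof (rule integral_dominated_convergence[where w = "\<lambda>w. M * std_normal_density w"])
      show "AE w in lborel. (\<lambda>n. h (u + \<epsilon> n * w) * std_normal_density w) \<longlonglongrightarrow> h u * std_normal_density w"
      proof (intro AE_I2 tendsto_intros)
        fix w
        have "(\<lambda>n. u + \<epsilon> n * w) \<longlonglongrightarrow> u + 0 * w" by (intro tendsto_intros \<epsilon>0)
        then show "(\<lambda>n. h (u + \<epsilon> n * w)) \<longlonglongrightarrow> h u"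
          using u by (auto intro: isCont_tendsto_compose)
      qed
      show "AE w in lborel. norm (h (u + \<epsilon> n * w) * std_normal_density w) \<le> M * std_normal_density w" for n
        using M by (auto simp: abs_mult intro!: mult_right_mono)
    qed auto
    then show ?thesis by simp
  qed
  show "(\<lambda>n. \<integral>u. h u * I n u \<partial>lborel) \<longlonglongrightarrow> (\<integral>u. (h u)\<^sup>2 \<partial>lborel)"
  proof (rule integral_dominated_convergence[where w = "\<lambda>u. M * \<bar>h u\<bar>"])
    show "AE u in lborel. (\<lambda>n. h u * I n u) \<longlonglongrightarrow> (h u)\<^sup>2"
      using cont by eventually_elim (auto simp: power2_eq_square intro!: tendsto_intros I_lim)
    show "AE u in lborel. norm (h u * I n u) \<le> M * \<bar>h u\<bar>" for n
      using I_le by (auto simp: abs_mult mult.commute[of M] intro!: mult_left_mono)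
  qed (use h in auto)
  show "\<exists>N. \<forall>n\<ge>N. (\<integral>u. h u * I n u \<partial>lborel) \<le> (\<integral>t. B t \<partial>lborel) / (2 * pi)"
    using gaussian_mollified_le[OF h B hB \<epsilon>] by (auto simp: I_def)
qed

subsection \<open>Partial sums of mu(n) / n\<close>

text \<open>The function \<open>m\<close> of the overview. It is 0 for \<open>y < 1\<close>, so the
  transform of \<open>u * mu_sum (exp u)\<close> over the whole line is a Laplace transform.\<close>

definition mu_sum :: "real \<Rightarrow> real" where
  "mu_sum y = (\<Sum>n\<in>{1..nat \<lfloor>y\<rfloor>}. of_int (moebius_mu n) / real n)"

lemma integrable_decay:
  "integrable lborel (\<lambda>t::real. (1 + \<bar>t\<bar>) powr (-3/2))"
proof -
  define g where "g t = indicator {0..} t * (1 + t) powr (-3/2)" for t :: real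
  have "(\<integral>\<^sup>+t. ennreal ((1 + \<bar>t\<bar>) powr (-3/2)) * indicator {0..} t \<partial>lborel) = ennreal (0 - (-2) * (1 + 0) powr (-1/2))"
  proof (rule nn_integral_FTC_atLeast)
    show "((\<lambda>t::real. (-2) * (1 + t) powr (-1/2)) has_real_derivative (1 + \<bar>t\<bar>) powr (-3/2)) (at t)" if "0 \<le> t" for t
      using that by (auto intro!: derivative_eq_intros)
    show "((\<lambda>t::real. (-2) * (1 + t) powr (-1/2)) \<longlongrightarrow> 0) at_top" by real_asymp
  qed auto
  moreover have "ennreal (g t) = ennreal ((1 + \<bar>t\<bar>) powr (-3/2)) * indicator {0..} t" for t
    by (auto simp: g_def indicator_def)
  ultimately have "(\<integral>\<^sup>+t. ennreal (g t) \<partial>lborel) < \<infinity>" by simp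
  moreover have [measurable]: "g \<in> borel_measurable borel" unfolding g_def[abs_def] by measurable
  moreover have g0: "g t \<ge> 0" for t by (simp add: g_def)
  ultimately have g: "integrable lborel g" by (intro integrableI_nonneg) auto
  \<comment> \<open>Reflection supplies the negative half-line. At \<open>t = 0\<close> the two
    summands overlap, so their sum serves as a majorant and not as an equal.\<close>
  have "integrable lborel (\<lambda>t. g t + g (0 + (-1) * t))"
    by (intro Bochner_Integration.integrable_add lborel_integrable_real_affine g) auto
  then show ?thesis
    by (rule Bochner_Integration.integrable_bound) (auto simp: g_def indicator_def)
qed

section \<open>The Laplace transform of the damped partial sums\<close>

lemma laplace_tail_real:
  fixes x a :: real
  assumes x: "x > 0" and a: "a \<ge> 0"
  shows "has_bochner_integral lborel (\<lambda>u. indicator {a..} u * (u * exp (- (x * u)))) ((a / x + 1 / x\<^sup>2) * exp (- (x * a)))"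
proof (rule has_bochner_integral_nn_integral)
  have "(\<integral>\<^sup>+u. ennreal (u * exp (- (x * u))) * indicator {a..} u \<partial>lborel) = ennreal (0 - (- (a / x + 1 / x\<^sup>2) * exp (- (x * a))))"
  proof (rule nn_integral_FTC_atLeast)
    show "((\<lambda>u. - (u / x + 1 / x\<^sup>2) * exp (- (x * u))) has_real_derivative u * exp (- (x * u))) (at u)" for u
      using x by (auto intro!: derivative_eq_intros simp: field_simps power2_eq_square)
    show "((\<lambda>u. - (u / x + 1 / x\<^sup>2) * exp (- (x * u))) \<longlongrightarrow> 0) at_top" using x by real_asymp
  qed (use a in auto)
  moreover have "(\<integral>\<^sup>+u. ennreal (indicator {a..} u * (u * exp (- (x * u)))) \<partial>lborel) = (\<integral>\<^sup>+u. ennreal (u * exp (- (x * u))) * indicator {a..} u \<partial>lborel)"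
    by (intro nn_integral_cong) (auto simp: indicator_def)
  ultimately show "(\<integral>\<^sup>+u. ennreal (indicator {a..} u * (u * exp (- (x * u)))) \<partial>lborel) = ennreal ((a / x + 1 / x\<^sup>2) * exp (- (x * a)))"
    by (simp only: mult_minus_left diff_minus_eq_add add_0)
qed (use x a in \<open>auto simp: indicator_def\<close>)

text \<open>With \<open>a = ln n\<close> this is the transform of the contribution of a single
  \<open>n\<close> to \<open>u * mu_sum (exp u)\<close>. The real version gives the integrals of the
  norms, which justify termwise integration.\<close>

lemma laplace_tail_complex:
  fixes w :: complex and a :: real
  assumes w: "Re w > 0" and a: "a \<ge> 0"
  shows "integrable lborel (\<lambda>u. indicator {a..} u *\<^sub>R (of_real u * exp (- (w * of_real u))))"
    and "(\<integral>u. indicator {a..} u *\<^sub>R (of_real u * exp (- (w * of_real u))) \<partial>lborel) = (of_real a / w + 1 / w\<^sup>2) * exp (- (w * of_real a))"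
proof -
  define f where "f u = of_real u * exp (- (w * of_real u))" for u :: real
  define F where "F u = - (of_real u / w + 1 / w\<^sup>2) * exp (- (w * of_real u))" for u :: real
  have w0: "w \<noteq> 0" using w by auto
  have [measurable]: "f \<in> borel_measurable borel" unfolding f_def[abs_def] by measurable
  have norm_e: "norm (exp (- (w * of_real u))) = exp (- (Re w * u))" for u
    by (simp add: norm_exp_eq_Re)
  show *: "integrable lborel (\<lambda>u. indicator {a..} u *\<^sub>R (of_real u * exp (- (w * of_real u))))"
    unfolding f_def[symmetric]
  proof (rule Bochner_Integration.integrable_bound)
    show "integrable lborel (\<lambda>u. indicator {a..} u * (u * exp (- (Re w * u))))"
      using laplace_tail_real[OF w a] by (rule integrable.intros)
    show "AE u in lborel. norm (indicator {a..} u *\<^sub>R f u) \<le> norm (indicator {a..} u * (u * exp (- (Re w * u))))"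
      by (auto simp: f_def norm_mult norm_e abs_mult)
  qed measurable
  then have f_int: "set_integrable lborel {a..} f" by (simp add: set_integrable_def f_def)
  have "(LBINT u=ereal a..\<infinity>. f u) = 0 - F a"
  proof (rule interval_integral_FTC_integrable)
    show "(F has_vector_derivative f u) (at u)" for u
      unfolding F_def f_def
    proof (rule has_vector_derivative_real_field)
      show "((\<lambda>z. - (z / w + 1 / w\<^sup>2) * exp (- (w * z))) has_field_derivative of_real u * exp (- (w * of_real u))) (at (of_real u))"
        using w0 by (auto intro!: derivative_eq_intros simp: field_simps power2_eq_square)
    qed
    show "isCont f u" for u unfolding f_def by (intro continuous_intros)
    show "set_integrable lborel (einterval (ereal a) \<infinity>) f"
      by (rule set_integrable_subset[OF f_int]) (auto simp: einterval_def)
    have "isCont F a" unfolding F_def using w0 by (intro continuous_intros) auto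
    then show "((F \<circ> real_of_ereal) \<longlongrightarrow> F a) (at_right (ereal a))"
      unfolding ereal_tendsto_simps by (auto simp: isCont_def intro: tendsto_within_subset)
    have "(F \<longlongrightarrow> 0) at_top"
    proof (rule Lim_null_comparison)
      show "\<forall>\<^sub>F u in at_top. norm (F u) \<le> (\<bar>u\<bar> / norm w + 1 / (norm w)\<^sup>2) * exp (- (Re w * u))"
      proof (intro always_eventually allI)
        fix u :: real
        have "norm (- (of_real u / w + 1 / w\<^sup>2)) \<le> \<bar>u\<bar> / norm w + 1 / (norm w)\<^sup>2"
          unfolding norm_minus_cancel by (rule order_trans[OF norm_triangle_ineq]) (simp add: norm_divide norm_power)
        then show "norm (F u) \<le> (\<bar>u\<bar> / norm w + 1 / (norm w)\<^sup>2) * exp (- (Re w * u))"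
          unfolding F_def norm_mult norm_e by (intro mult_right_mono) auto
      qed
      show "((\<lambda>u. (\<bar>u\<bar> / norm w + 1 / (norm w)\<^sup>2) * exp (- (Re w * u))) \<longlongrightarrow> 0) at_top"
        using w w0 by real_asymp
    qed
    then show "((F \<circ> real_of_ereal) \<longlongrightarrow> 0) (at_left \<infinity>)"
      unfolding ereal_tendsto_simps .
  qed simp
  also have "(LBINT u=ereal a..\<infinity>. f u) = (\<integral>u. indicator {a<..} u *\<^sub>R f u \<partial>lborel)"
    by (simp add: interval_integral_to_infinity_eq set_lebesgue_integral_def)
  also have "\<dots> = (\<integral>u. indicator {a..} u *\<^sub>R f u \<partial>lborel)"
    using AE_lborel_singleton[of a] by (intro integral_cong_AE) (auto simp: indicator_def elim!: eventually_mono)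
  finally show "(\<integral>u. indicator {a..} u *\<^sub>R (of_real u * exp (- (w * of_real u))) \<partial>lborel) = (of_real a / w + 1 / w\<^sup>2) * exp (- (w * of_real a))"
    by (simp only: f_def F_def mult_minus_left diff_minus_eq_add add_0)
qed

text \<open>For each \<open>u\<close> the sum is finite; extending it over all \<open>n\<close> with
  step functions of \<open>u\<close> makes the summation range independent of \<open>u\<close>, so
  that it can be integrated term by term.\<close>

lemma mu_sum_exp_sums:
  "(\<lambda>n. of_int (moebius_mu n) / real n * indicator {ln (real n)..} u) sums mu_sum (exp u)"
proof -
  define N where "N = nat \<lfloor>exp u\<rfloor>"
  have *: "ln (real n) \<le> u \<longleftrightarrow> n \<le> N" if "n \<ge> 1" for n
  proof -
    have "ln (real n) \<le> u \<longleftrightarrow> real n \<le> exp u" using that by (metis exp_le_cancel_iff exp_ln of_nat_0_less_iff le_eq_less_or_eq less_one not_less_zero linorder_not_less)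
    also have "\<dots> \<longleftrightarrow> n \<le> N" unfolding N_def by (simp add: le_nat_iff le_floor_iff)
    finally show ?thesis .
  qed
  have "(\<lambda>n. of_int (moebius_mu n) / real n * indicator {ln (real n)..} u) sums
     (\<Sum>n\<in>{1..N}. of_int (moebius_mu n) / real n * indicator {ln (real n)..} u)"
  proof (rule sums_finite)
    fix n assume "n \<notin> {1..N}"
    then show "of_int (moebius_mu n) / real n * indicator {ln (real n)..} u = 0"
      using *[of n] by (cases "n = 0") auto
  qed simp
  also have "(\<Sum>n\<in>{1..N}. of_int (moebius_mu n) / real n * indicator {ln (real n)..} u) = mu_sum (exp u)"
    unfolding mu_sum_def N_def[symmetric] by (intro sum.cong) (auto simp: *)
  finally show ?thesis .
qed

text \<open>With \<open>s = 1 + w\<close> each \<open>n\<close> contributes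
  \<open>\<mu>(n) n^(-s) (ln n / w + 1 / w^2)\<close>, and the damping makes the norms summable. The
  total \<open>mt_ln / w + mt / w^2\<close> becomes \<open>mu_laplace\<close> through
  \<open>mt_ln_eq\<close> and \<open>mt * zt = 1\<close>.\<close>

lemma mu_sum_transform:
  fixes x t :: real
  assumes x: "x > 0"
  defines "h \<equiv> \<lambda>u. u * mu_sum (exp u) * exp (- (x * u))"
  shows "integrable lborel h" and "fourier h t = mu_laplace (Complex (1 + x) t)"
proof -
  have main: "integrable lborel (\<lambda>u. of_real (h u) * iexp (- (t * u)))"
    "(\<integral>u. of_real (h u) * iexp (- (t * u)) \<partial>lborel) = mu_laplace (Complex (1 + x) t)" for t
  proof -
    define w where "w = Complex x t"
    define s where "s = Complex (1 + x) t"
    have s: "s = 1 + w" "Re s > 1" using x by (auto simp: s_def w_def complex_eq_iff)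
    have w: "Re w > 0" "Re w = x" "w \<noteq> 0" using x by (auto simp: w_def complex_eq_iff)
    define f where "f n u = complex_of_real (of_int (moebius_mu n) / real n) * (indicator {ln (real n)..} u *\<^sub>R (of_real u * exp (- (w * of_real u))))" for n u
    have wt: "exp (- (w * of_real u)) = of_real (exp (- (x * u))) * iexp (- (t * u))" for u
    proof -
      have "- (w * of_real u) = of_real (- (x * u)) + \<i> * of_real (- (t * u))" by (simp add: w_def complex_eq_iff)
      then show ?thesis by (simp only: exp_add exp_of_real)
    qed
    have fs: "(\<lambda>n. f n u) sums (of_real (h u) * iexp (- (t * u)))" for u
    proof -
      have "(\<lambda>n. of_real (of_int (moebius_mu n) / real n * indicator {ln (real n)..} u) * (of_real u * exp (- (w * of_real u)))) sums
         (of_real (mu_sum (exp u)) * (of_real u * exp (- (w * of_real u))))"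
        by (intro sums_mult2 sums_of_real mu_sum_exp_sums)
      also have "of_real (mu_sum (exp u)) * (of_real u * exp (- (w * of_real u))) = of_real (h u) * iexp (- (t * u))"
        unfolding wt by (simp add: h_def)
      finally show ?thesis by (simp add: f_def scaleR_conv_of_real mult.assoc)
    qed
    have f0: "f 0 = (\<lambda>_. 0)" by (simp add: f_def fun_eq_iff)
    have f_int: "integrable lborel (f n)" for n
    proof (cases "n = 0")
      case False
      then show ?thesis unfolding f_def[abs_def] using w by (intro integrable_mult_right laplace_tail_complex) auto
    qed (simp add: f0)
    have f_summable: "summable (\<lambda>n. norm (f n u))" for u
    proof (rule summable_finite[of "{..nat \<lfloor>exp u\<rfloor>}"])
      fix n assume "n \<notin> {..nat \<lfloor>exp u\<rfloor>}"
      then have "exp u < real n" by (simp add: not_le) linarith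
      then have "u < ln (real n)" by (metis exp_gt_zero ln_exp ln_less_cancel_iff order_less_trans)
      then show "norm (f n u) = 0" by (simp add: f_def)
    qed simp
    have norm_int: "(\<integral>u. norm (f n u) \<partial>lborel) = \<bar>of_int (moebius_mu n) / real n\<bar> * ((ln (real n) / x + 1 / x\<^sup>2) * exp (- (x * ln (real n))))" if n: "n \<ge> 1" for n
    proof -
      have "norm (f n u) = \<bar>of_int (moebius_mu n) / real n\<bar> * (indicator {ln (real n)..} u * (u * exp (- (x * u))))" for u
      proof -
        have "ln (real n) \<ge> 0" using n by simp
        then show ?thesis
          unfolding f_def norm_mult norm_scaleR norm_of_real
          using w by (auto simp: norm_exp_eq_Re indicator_def abs_if)
      qed
      moreover have "(\<integral>u. indicator {ln (real n)..} u * (u * exp (- (x * u))) \<partial>lborel) = (ln (real n) / x + 1 / x\<^sup>2) * exp (- (x * ln (real n)))"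
        using n by (intro has_bochner_integral_integral_eq laplace_tail_real x) auto
      ultimately show ?thesis by simp
    qed
    have int_summable: "summable (\<lambda>n. \<integral>u. norm (f n u) \<partial>lborel)"
    proof (rule summable_comparison_test_ev)
      show "summable (\<lambda>n. (1 / x + 1 / x\<^sup>2) * ((1 + ln (real n)) * real n powr (- (1 + x))))"
        using x by (intro summable_mult summable_ln_powr) auto
      have "norm (\<integral>u. norm (f n u) \<partial>lborel) \<le> (1 / x + 1 / x\<^sup>2) * ((1 + ln (real n)) * real n powr (- (1 + x)))" if n: "n \<ge> 1" for n
      proof -
        have l: "ln (real n) \<ge> 0" using n by simp
        have e: "exp (- (x * ln (real n))) = real n powr (-x)" using n by (simp add: powr_def)
        have "\<bar>of_int (moebius_mu n) / real n\<bar> \<le> real n powr (-1)"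
          using abs_moebius_mu_le_1[of n] n by (simp add: powr_minus_divide abs_divide divide_right_mono)
        moreover have "ln (real n) / x + 1 / x\<^sup>2 \<le> (1 / x + 1 / x\<^sup>2) * (1 + ln (real n))"
        proof -
          have "(1 / x + 1 / x\<^sup>2) * (1 + ln (real n)) = ln (real n) / x + 1 / x\<^sup>2 + (1 / x + ln (real n) / x\<^sup>2)"
            by (simp add: algebra_simps add_divide_distrib)
          then show ?thesis using l x by simp
        qed
        ultimately have "(\<integral>u. norm (f n u) \<partial>lborel) \<le> real n powr (-1) * (((1 / x + 1 / x\<^sup>2) * (1 + ln (real n))) * real n powr (-x))"
          unfolding norm_int[OF n] e using l x by (intro mult_mono mult_right_mono) auto
        also have "\<dots> = (1 / x + 1 / x\<^sup>2) * ((1 + ln (real n)) * (real n powr (-1) * real n powr (-x)))" by (simp add: mult_ac)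
        also have "real n powr (-1) * real n powr (-x) = real n powr (- (1 + x))"
          unfolding powr_add[symmetric] by (rule arg_cong[of _ _ "(powr) (real n)"]) simp
        finally show ?thesis by simp
      qed
      then show "\<forall>\<^sub>F n in sequentially. norm (\<integral>u. norm (f n u) \<partial>lborel) \<le> (1 / x + 1 / x\<^sup>2) * ((1 + ln (real n)) * real n powr (- (1 + x)))"
        unfolding eventually_sequentially by blast
    qed
    have sum_eq: "(\<Sum>n. f n u) = of_real (h u) * iexp (- (t * u))" for u
      using fs[of u] by (simp add: sums_iff)
    show "integrable lborel (\<lambda>u. of_real (h u) * iexp (- (t * u)))"
      using integrable_suminf[OF f_int AE_I2[OF f_summable] int_summable] by (simp add: sum_eq)
    have "(\<lambda>n. \<integral>u. f n u \<partial>lborel) sums (\<integral>u. of_real (h u) * iexp (- (t * u)) \<partial>lborel)"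
      using sums_integral[OF f_int AE_I2[OF f_summable] int_summable] by (simp add: sum_eq)
    moreover have "(\<integral>u. f n u \<partial>lborel) = of_int (moebius_mu n) * of_real (ln (real n)) * of_nat n powr (-s) / w + of_int (moebius_mu n) * of_nat n powr (-s) / w\<^sup>2" for n
    proof (cases "n = 0")
      case False
      have "exp (- (w * of_real (ln (real n)))) = of_nat n * of_nat n powr (-s)"
      proof -
        have "complex_of_nat n powr 1 * of_nat n powr (-s) = of_nat n powr (-w)"
          unfolding powr_add[symmetric] by (simp add: s)
        moreover have "exp (complex_of_real (ln (real n))) = of_nat n"
          using False by (simp add: exp_of_real)
        ultimately show ?thesis using False by (simp add: powr_def Ln_of_nat mult.commute)
      qed
      then have "(\<integral>u. f n u \<partial>lborel) = of_real (of_int (moebius_mu n) / real n) * ((of_real (ln (real n)) / w + 1 / w\<^sup>2) * (of_nat n * of_nat n powr (-s)))"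
        unfolding f_def integral_mult_right_zero
        using False w by (subst laplace_tail_complex(2)) auto
      also have "\<dots> = of_int (moebius_mu n) * ((of_real (ln (real n)) / w + 1 / w\<^sup>2) * of_nat n powr (-s))"
        using False by simp
      finally show ?thesis by (simp add: algebra_simps)
    qed (simp add: f0)
    moreover have "(\<lambda>n. of_int (moebius_mu n) * of_real (ln (real n)) * of_nat n powr (-s) / w + of_int (moebius_mu n) * of_nat n powr (-s) / w\<^sup>2)
      sums (mt_ln s / w + mt s / w\<^sup>2)"
      by (intro sums_add sums_divide dseries_sums log_bounded_moebius_ln log_bounded_moebius s)
    ultimately have "(\<integral>u. of_real (h u) * iexp (- (t * u)) \<partial>lborel) = mt_ln s / w + mt s / w\<^sup>2"
      by (simp add: sums_iff)
    also have "\<dots> = mu_laplace s"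
    proof -
      have mz: "mt s * zt s = 1" by (rule mt_zt[OF s(2)])
      have "mu_laplace s = (mt s * (mt s * zt s) - w * ((mt s)\<^sup>2 * zt_ln s)) / w\<^sup>2"
        unfolding mu_laplace_def using s by (simp add: power2_eq_square algebra_simps)
      then show ?thesis unfolding mz mt_ln_eq[OF s(2)] using w by (simp add: field_simps power2_eq_square)
    qed
    finally show "(\<integral>u. of_real (h u) * iexp (- (t * u)) \<partial>lborel) = mu_laplace (Complex (1 + x) t)" by (simp add: s_def)
  qed
  show "fourier h t = mu_laplace (Complex (1 + x) t)" unfolding fourier_def by (rule main)
  show "integrable lborel h" using main(1)[of 0] by (simp add: complex_of_real_integrable_eq)
qed

section \<open>Size, slow variation and continuity of the partial sums\<close>

lemma mu_sum_neg: "u < 0 \<Longrightarrow> mu_sum (exp u) = 0"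
proof -
  assume "u < 0"
  then have "exp u < 1" by simp
  then have "nat \<lfloor>exp u\<rfloor> = 0" by (simp add: floor_le_iff le_nat_iff nat_eq_iff2 floor_eq_iff) 
  then show ?thesis by (simp add: mu_sum_def)
qed

lemma abs_moebius_div_le: "\<bar>of_int (moebius_mu n) / real n\<bar> \<le> 1 / real n"
  using abs_moebius_mu_le_1[of n] by (simp add: abs_divide divide_right_mono)

text \<open>The increment is dominated by a piece of the harmonic series. In the variable
  \<open>u = ln y\<close> this says that \<open>mu_sum (exp u)\<close> moves with at most unit
  speed, up to an error \<open>exp (- u)\<close>.\<close>

lemma mu_sum_slow:
  assumes "1 \<le> y" "y \<le> z"
  shows "\<bar>mu_sum z - mu_sum y\<bar> \<le> 1 / y + ln (z / y)"
proof -
  define M where "M = nat \<lfloor>y\<rfloor>"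
  define N where "N = nat \<lfloor>z\<rfloor>"
  have M: "M \<ge> 1" "real M \<le> y" "y < real (Suc M)" unfolding M_def using assms by (auto simp: le_nat_iff) linarith+
  have N: "N \<ge> M" "real N \<le> z" unfolding N_def M_def using assms by (auto intro!: nat_mono floor_mono)
  have "mu_sum z - mu_sum y = (\<Sum>n\<in>{Suc M..N}. of_int (moebius_mu n) / real n)"
  proof -
    have "{1..N} = {1..M} \<union> {Suc M..N}" using M N by auto
    then have "mu_sum z = mu_sum y + (\<Sum>n\<in>{Suc M..N}. of_int (moebius_mu n) / real n)"
      unfolding mu_sum_def M_def[symmetric] N_def[symmetric]
      by (simp only:) (subst sum.union_disjoint, auto)
    then show ?thesis by simp
  qed
  also have "\<bar>\<dots>\<bar> \<le> (\<Sum>n\<in>{Suc M..N}. 1 / real n)"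
    by (intro order_trans[OF sum_abs] sum_mono abs_moebius_div_le)
  also have "\<dots> \<le> 1 / y + ln (z / y)"
  proof (cases "Suc M \<le> N")
    case True
    then have "(\<Sum>n\<in>{Suc M..N}. 1 / real n) \<le> 1 / real (Suc M) + ln (real N / real (Suc M))"
      by (intro sum_inverse_le_ln') auto
    also have "\<dots> \<le> 1 / y + ln (z / y)"
    proof (intro add_mono)
      show "1 / real (Suc M) \<le> 1 / y" using M assms by (intro divide_left_mono) auto
      have "real N / real (Suc M) \<le> z / y" using M N assms by (intro frac_le) auto
      then show "ln (real N / real (Suc M)) \<le> ln (z / y)" using True by (intro ln_mono) auto
    qed
    finally show ?thesis .
  next
    case False
    then show ?thesis using assms by (auto intro!: add_nonneg_nonneg)
  qed
  finally show ?thesis .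
qed

lemma abs_mu_sum_exp_le: "\<bar>mu_sum (exp u)\<bar> \<le> 2 + \<bar>u\<bar>"
proof (cases "u < 0")
  case False
  have "mu_sum 1 = 1"
    by (simp add: mu_sum_def moebius_mu_def omega_def)
  then show ?thesis using mu_sum_slow[of 1 "exp u"] False by simp
qed (simp add: mu_sum_neg)

lemma isCont_mu_sum_exp:
  assumes "exp u \<notin> \<int>"
  shows "isCont (\<lambda>u. mu_sum (exp u)) u"
proof -
  have "\<forall>\<^sub>F v in nhds u. \<lfloor>exp v\<rfloor> = \<lfloor>exp u\<rfloor>"
    using assms by (intro eventually_floor_eq) (auto intro: tendsto_intros filterlim_ident)
  then have "\<forall>\<^sub>F v in nhds u. mu_sum (exp v) = mu_sum (exp u)"
    by eventually_elim (simp add: mu_sum_def)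
  then have "isCont (\<lambda>u. mu_sum (exp u)) u \<longleftrightarrow> isCont (\<lambda>_. mu_sum (exp u)) u"
    by (rule isCont_cong)
  then show ?thesis by simp
qed

lemma AE_isCont_mu_sum_exp: "AE u in lborel. isCont (\<lambda>u. mu_sum (exp u)) u"
proof -
  have "{u::real. exp u \<in> \<int>} \<subseteq> ln ` \<int>" by (force simp: image_iff intro: bexI[of _ "exp _"])
  moreover have "countable (ln ` (\<int> :: real set))" by (intro countable_image) (simp add: Ints_def)
  ultimately have "countable {u::real. exp u \<in> \<int>}" by (rule countable_subset)
  then have "AE u in lborel. u \<notin> {u::real. exp u \<in> \<int>}"
    by (intro AE_not_in countable_imp_null_set_lborel)
  then show ?thesis by eventually_elim (auto intro: isCont_mu_sum_exp)
qed

lemma damped_bounded: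
  assumes "x > 0"
  shows "\<exists>M. \<forall>u. \<bar>u * mu_sum (exp u) * exp (- (x * u))\<bar> \<le> M"
proof (intro exI allI)
  fix u :: real
  show "\<bar>u * mu_sum (exp u) * exp (- (x * u))\<bar> \<le> 2 * (1 / x) + (2 / x)\<^sup>2"
  proof (cases "u < 0")
    case False
    \<comment> \<open>This is applied with \<open>v = x * u\<close>, and with
      \<open>v = x / 2 * u\<close> followed by squaring: the linear bound for
      \<open>mu_sum (exp u)\<close> produces a term \<open>u^2\<close>, and halving the exponent
      gives each factor \<open>u\<close> its own exponential.\<close>
    have e: "v * exp (- v) \<le> 1" if "v \<ge> 0" for v :: real
    proof -
      have "v \<le> exp v" using exp_ge_add_one_self[of v] by linarith
      then show ?thesis by (simp add: exp_minus divide_simps)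
    qed
    have 1: "u * exp (- (x * u)) \<le> 1 / x" using e[of "x * u"] False assms by (simp add: field_simps)
    have 2: "u * exp (- (x / 2 * u)) \<le> 2 / x" using e[of "x / 2 * u"] False assms by (simp add: field_simps)
    have "u\<^sup>2 * exp (- (x * u)) = (u * exp (- (x / 2 * u)))\<^sup>2"
      by (simp add: power_mult_distrib flip: exp_of_nat_mult)
    also have "\<dots> \<le> (2 / x)\<^sup>2" using 2 False by (intro power_mono) auto
    finally have 3: "u\<^sup>2 * exp (- (x * u)) \<le> (2 / x)\<^sup>2" .
    have "\<bar>u * mu_sum (exp u) * exp (- (x * u))\<bar> \<le> u * (2 + u) * exp (- (x * u))"
      unfolding abs_mult using abs_mu_sum_exp_le[of u] False by (intro mult_mono) auto
    also have "\<dots> = 2 * (u * exp (- (x * u))) + u\<^sup>2 * exp (- (x * u))" by (simp add: algebra_simps power2_eq_square)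
    finally show ?thesis using 1 3 by linarith
  qed (use assms in \<open>auto simp: mu_sum_neg\<close>)
qed

text \<open>For the damped function \<open>plancherel_le\<close> gives a bound \<open>D\<close>
  independent of \<open>x\<close>. On \<open>{0..U}\<close> undoing the damping costs at most
  \<open>exp (2 * x * U)\<close>, which tends to 1 as \<open>x\<close> tends to 0 with
  \<open>U\<close> fixed.\<close>

lemma mu_sum_L2_bound:
  "\<exists>C>0. \<forall>U\<ge>0. integrable lborel (\<lambda>u. indicator {0..U} u * (u * mu_sum (exp u))\<^sup>2) \<and>
     (\<integral>u. indicator {0..U} u * (u * mu_sum (exp u))\<^sup>2 \<partial>lborel) \<le> C"
proof -
  obtain C where C: "C > 0" "\<And>x t. 0 < x \<Longrightarrow> x \<le> 1/272 \<Longrightarrow> (norm (mu_laplace (Complex (1 + x) t)))\<^sup>2 \<le> C * (1 + \<bar>t\<bar>) powr (-3/2)"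
    using mu_laplace_bound by blast
  define h where "h x u = u * mu_sum (exp u) * exp (- (x * u))" for x u
  define B where "B t = C * (1 + \<bar>t\<bar>) powr (-3/2)" for t :: real
  define D where "D = (\<integral>t. B t \<partial>lborel) / (2 * pi)"
  have B: "integrable lborel B" unfolding B_def[abs_def] by (intro integrable_mult_right integrable_decay)
  have D0: "D \<ge> 0" unfolding D_def B_def using C by (intro divide_nonneg_nonneg integral_nonneg) auto
  have h_int: "integrable lborel (h x)" if "x > 0" for x
    using mu_sum_transform(1)[OF that] by (simp add: h_def[abs_def])
  have h2: "integrable lborel (\<lambda>u. (h x u)\<^sup>2)" if x: "x > 0" for x
  proof -
    obtain M where M: "\<And>u. \<bar>h x u\<bar> \<le> M" using damped_bounded[OF x] by (auto simp: h_def)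
    then have "M \<ge> 0" using abs_ge_zero order_trans by blast
    have [measurable]: "h x \<in> borel_measurable borel" using h_int[OF x] by auto
    show ?thesis
    proof (rule Bochner_Integration.integrable_bound)
      show "integrable lborel (\<lambda>u. M * h x u)" using h_int[OF x] by simp
      show "AE u in lborel. norm ((h x u)\<^sup>2) \<le> norm (M * h x u)"
      proof (intro AE_I2)
        fix u
        have "\<bar>h x u\<bar> * \<bar>h x u\<bar> \<le> M * \<bar>h x u\<bar>" by (intro mult_right_mono M) auto
        then show "norm ((h x u)\<^sup>2) \<le> norm (M * h x u)"
          using \<open>M \<ge> 0\<close> by (simp add: power2_eq_square abs_mult)
      qed
    qed measurable
  qed
  have le: "(\<integral>u. (h x u)\<^sup>2 \<partial>lborel) \<le> D" if x: "0 < x" "x \<le> 1/272" for x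
  proof -
    obtain M where M: "\<And>u. \<bar>h x u\<bar> \<le> M" using damped_bounded[OF x(1)] by (auto simp: h_def)
    have "AE u in lborel. isCont (h x) u"
      using AE_isCont_mu_sum_exp by eventually_elim (auto simp: h_def[abs_def] intro!: continuous_intros)
    moreover have "(norm (fourier (h x) t))\<^sup>2 \<le> B t" for t
      using C(2)[OF x] mu_sum_transform(2)[OF x(1)] by (simp add: h_def[abs_def] B_def)
    ultimately show ?thesis unfolding D_def by (intro plancherel_le[OF h_int[OF x(1)] M _ B]) auto
  qed
  have dom: "indicator {0..U} u * (u * mu_sum (exp u))\<^sup>2 \<le> exp (2 * x * U) * (h x u)\<^sup>2" if "0 < x" for x u U
  proof (cases "u \<in> {0..U}")
    case True
    have "(u * mu_sum (exp u))\<^sup>2 = exp (2 * x * u) * (h x u)\<^sup>2"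
      by (simp add: h_def power_mult_distrib mult_ac flip: exp_of_nat_mult exp_add)
    also have "\<dots> \<le> exp (2 * x * U) * (h x u)\<^sup>2" using True that by (intro mult_right_mono) auto
    finally show ?thesis using True by simp
  qed auto
  have int: "integrable lborel (\<lambda>u. indicator {0..U} u * (u * mu_sum (exp u))\<^sup>2)" for U
  proof (rule Bochner_Integration.integrable_bound)
    show "integrable lborel (\<lambda>u. exp (2 * 1 * U) * (h 1 u)\<^sup>2)" using h2[of 1] by simp
    have [measurable]: "h 1 \<in> borel_measurable borel" using h_int[of 1] by auto
    have "(\<lambda>u. mu_sum (exp u) * u) = (\<lambda>u. h 1 u * exp u)"
      by (simp add: h_def mult_ac fun_eq_iff flip: exp_add)
    then have "(\<lambda>u. u * mu_sum (exp u)) = (\<lambda>u. h 1 u * exp u)" by (simp add: mult.commute)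
    then have [measurable]: "(\<lambda>u. u * mu_sum (exp u)) \<in> borel_measurable borel" by simp
    show "(\<lambda>u. indicator {0..U} u * (u * mu_sum (exp u))\<^sup>2) \<in> borel_measurable lborel" by measurable
    show "AE u in lborel. norm (indicator {0..U} u * (u * mu_sum (exp u))\<^sup>2) \<le> norm (exp (2 * 1 * U) * (h 1 u)\<^sup>2)"
      using dom[of 1 U] by (intro AE_I2) (simp add: abs_mult)
  qed
  have bound: "(\<integral>u. indicator {0..U} u * (u * mu_sum (exp u))\<^sup>2 \<partial>lborel) \<le> D" if U: "U \<ge> 0" for U
  proof (rule LIMSEQ_le_const)
    \<comment> \<open>These values of \<open>x\<close> tend to 0 and stay within the range
      \<open>0 < x \<le> 1/272\<close> of \<open>mu_laplace_bound\<close>.\<close>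
    have "(\<lambda>n. 1 / (272 + real n)) \<longlonglongrightarrow> 0" by real_asymp
    then have "(\<lambda>n. exp (2 * (1 / (272 + real n)) * U) * D) \<longlonglongrightarrow> exp (2 * 0 * U) * D" by (intro tendsto_intros)
    then show "(\<lambda>n. exp (2 * (1 / (272 + real n)) * U) * D) \<longlonglongrightarrow> D" by simp
    have "(\<integral>u. indicator {0..U} u * (u * mu_sum (exp u))\<^sup>2 \<partial>lborel) \<le> exp (2 * (1 / (272 + real n)) * U) * D" for n
    proof -
      define x where "x = 1 / (272 + real n)"
      have x: "0 < x" "x \<le> 1/272" by (auto simp: x_def divide_simps)
      have "(\<integral>u. indicator {0..U} u * (u * mu_sum (exp u))\<^sup>2 \<partial>lborel) \<le> (\<integral>u. exp (2 * x * U) * (h x u)\<^sup>2 \<partial>lborel)"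
        by (intro integral_mono int integrable_mult_right h2 x dom)
      also have "\<dots> = exp (2 * x * U) * (\<integral>u. (h x u)\<^sup>2 \<partial>lborel)" by simp
      also have "\<dots> \<le> exp (2 * x * U) * D" by (intro mult_left_mono le x) auto
      finally show ?thesis by (simp add: x_def)
    qed
    then show "\<exists>N. \<forall>n\<ge>N. (\<integral>u. indicator {0..U} u * (u * mu_sum (exp u))\<^sup>2 \<partial>lborel) \<le> exp (2 * (1 / (272 + real n)) * U) * D" by blast
  qed
  show ?thesis
  proof (intro exI[of _ "D + 1"] conjI allI impI int)
    show "(\<integral>u. indicator {0..U} u * (u * mu_sum (exp u))\<^sup>2 \<partial>lborel) \<le> D + 1" if "U \<ge> 0" for U
      using bound[OF that] by simp
  qed (use D0 in simp)
qed

text \<open>Measurability is read off from the integrability of the function damped with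
  \<open>x = 1\<close> by dividing out the weight. The weight vanishes at \<open>u = 0\<close>, so
  the value there is restored separately.\<close>

lemma measurable_mu_sum_exp [measurable]: "(\<lambda>u. mu_sum (exp u)) \<in> borel_measurable borel"
proof -
  have "(\<lambda>u. u * mu_sum (exp u) * exp (- (1 * u))) \<in> borel_measurable borel"
    using mu_sum_transform(1)[of 1] by auto
  then have "(\<lambda>u. (u * mu_sum (exp u) * exp (- (1 * u))) * exp u / u) \<in> borel_measurable borel" by measurable
  moreover have "(u * mu_sum (exp u) * exp (- (1 * u))) * exp u / u = (if u = 0 then 0 else mu_sum (exp u))" for u
    by (simp add: mult.assoc flip: exp_add)
  ultimately have "(\<lambda>u. if u = 0 then 0 else mu_sum (exp u)) \<in> borel_measurable borel" by simp
  then have "(\<lambda>u. if u = 0 then mu_sum (exp 0) else (if u = 0 then 0 else mu_sum (exp u))) \<in> borel_measurable borel" by measurable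
  moreover have "(\<lambda>u. if u = 0 then mu_sum (exp 0) else (if u = 0 then 0 else mu_sum (exp u))) = (\<lambda>u. mu_sum (exp u))" by auto
  ultimately show ?thesis by simp
qed

section \<open>From the mean square to absolute integrability and to the limit\<close>

lemma integrable_indicator_Icc: "integrable lborel (indicator {a..b::real} :: real \<Rightarrow> real)"
  by (rule integrable_real_indicator) (auto simp: emeasure_lborel_Icc_eq)

lemma integrable_abs_mu_sum: "integrable lborel (\<lambda>u. indicator {a..b} u * \<bar>mu_sum (exp u)\<bar>)"
proof (rule Bochner_Integration.integrable_bound)
  show "integrable lborel (\<lambda>u. indicator {a..b} u * (2 + (\<bar>a\<bar> + \<bar>b\<bar>)))" by (intro integrable_mult_left integrable_indicator_Icc)
  show "AE u in lborel. norm (indicator {a..b} u * \<bar>mu_sum (exp u)\<bar>) \<le> norm (indicator {a..b} u * (2 + (\<bar>a\<bar> + \<bar>b\<bar>)))"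
  proof (intro AE_I2)
    fix u show "norm (indicator {a..b} u * \<bar>mu_sum (exp u)\<bar>) \<le> norm (indicator {a..b} u * (2 + (\<bar>a\<bar> + \<bar>b\<bar>)))"
      using abs_mu_sum_exp_le[of u] by (auto simp: indicator_def)
  qed
qed measurable

text \<open>Cauchy-Schwarz against \<open>1/u\<close>, carried out pointwise as a weighted
  inequality between the two means. The weight \<open>l = 1 / sqrt a\<close> balances the fixed
  \<open>L2\<close> bound with the integral of \<open>1 / u^2\<close>, which is at most
  \<open>1/a\<close>. The bound does not involve \<open>b\<close>, so it controls the whole
  tail.\<close>

lemma mu_sum_L1_tail:
  "\<exists>C>0. \<forall>a b. 0 < a \<longrightarrow> (\<integral>u. indicator {a..b} u * \<bar>mu_sum (exp u)\<bar> \<partial>lborel) \<le> C / sqrt a"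
proof -
  obtain C where C: "C > 0" "\<And>U. U \<ge> 0 \<Longrightarrow> integrable lborel (\<lambda>u. indicator {0..U} u * (u * mu_sum (exp u))\<^sup>2)"
     "\<And>U. U \<ge> 0 \<Longrightarrow> (\<integral>u. indicator {0..U} u * (u * mu_sum (exp u))\<^sup>2 \<partial>lborel) \<le> C"
    using mu_sum_L2_bound by blast
  have "(\<integral>u. indicator {a..b} u * \<bar>mu_sum (exp u)\<bar> \<partial>lborel) \<le> (C + 1) / sqrt a" if a: "0 < a" for a b
  proof (cases "a \<le> b")
    case True
    define l where "l = 1 / sqrt a"
    have l: "l > 0" "1 / l = sqrt a" using a by (auto simp: l_def)
    have inv: "has_bochner_integral lborel (\<lambda>u. indicator {a..b} u * (1 / u\<^sup>2)) (- 1 / b - (- 1 / a))"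
    proof -
      have "has_bochner_integral lborel (\<lambda>u. (1 / u\<^sup>2) * indicator {a..b} u) (- 1 / b - (- 1 / a))"
        using a True by (intro has_bochner_integral_FTC_Icc_nonneg)
          (auto intro!: derivative_eq_intros continuous_intros simp: power2_eq_square)
      then show ?thesis by (simp add: mult.commute)
    qed
    have "indicator {a..b} u * \<bar>mu_sum (exp u)\<bar> \<le>
        l / 2 * (indicator {0..b} u * (u * mu_sum (exp u))\<^sup>2) + sqrt a / 2 * (indicator {a..b} u * (1 / u\<^sup>2))" for u
    proof (cases "u \<in> {a..b}")
      case True
      then have u: "u > 0" "u \<in> {0..b}" using a by auto
      define y where "y = u * \<bar>mu_sum (exp u)\<bar>"
      have "0 \<le> (l * y - 1 / u)\<^sup>2 / l" using l by simp
      also have "\<dots> = l * y\<^sup>2 - 2 * y / u + (1 / l) * (1 / u\<^sup>2)"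
        using l u by (simp add: power2_eq_square field_simps)
      finally have "y / u \<le> l / 2 * y\<^sup>2 + sqrt a / 2 * (1 / u\<^sup>2)" unfolding l by simp
      then show ?thesis using True u by (simp add: y_def power_mult_distrib)
    qed (use l in auto)
    then have "(\<integral>u. indicator {a..b} u * \<bar>mu_sum (exp u)\<bar> \<partial>lborel) \<le>
       (\<integral>u. l / 2 * (indicator {0..b} u * (u * mu_sum (exp u))\<^sup>2) + sqrt a / 2 * (indicator {a..b} u * (1 / u\<^sup>2)) \<partial>lborel)"
      using a True by (intro integral_mono integrable_abs_mu_sum Bochner_Integration.integrable_add integrable_mult_right C(2) integrable.intros[OF inv]) auto
    also have "\<dots> = l / 2 * (\<integral>u. indicator {0..b} u * (u * mu_sum (exp u))\<^sup>2 \<partial>lborel) + sqrt a / 2 * (- 1 / b - (- 1 / a))"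
      unfolding has_bochner_integral_integral_eq[OF inv, symmetric] integral_mult_right_zero[symmetric]
      using a True by (intro Bochner_Integration.integral_add integrable_mult_right C(2) integrable.intros[OF inv]) auto
    also have "\<dots> \<le> l / 2 * C + sqrt a / 2 * (1 / a)"
      using a True l by (intro add_mono mult_left_mono C(3)) auto
    also have "sqrt a / 2 * (1 / a) = l / 2" using a by (simp add: l_def field_simps)
    also have "l / 2 * C + l / 2 \<le> (C + 1) * l"
    proof -
      have "0 < C * l" using C(1) l by simp
      moreover have "(C + 1) * l = C * l + l" "l / 2 * C = C * l / 2" by (simp_all add: algebra_simps)
      ultimately show ?thesis using l by linarith
    qed
    finally show ?thesis by (simp add: l_def)
  qed (use C(1) a in simp)
  then show ?thesis using C(1) by (intro exI[of _ "C + 1"]) auto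
qed

text \<open>Since \<open>mu_sum\<close> oscillates slowly, its values are controlled by its integrals.\<close>

lemma mu_sum_average:
  assumes "0 \<le> a" "a \<le> b"
  shows "(b - a) * \<bar>mu_sum (exp b)\<bar> \<le> (\<integral>u. indicator {a..b} u * \<bar>mu_sum (exp u)\<bar> \<partial>lborel) + (b - a) * (exp (- a) + (b - a))"
proof -
  have "(b - a) * \<bar>mu_sum (exp b)\<bar> = (\<integral>u. indicator {a..b} u * \<bar>mu_sum (exp b)\<bar> \<partial>lborel)"
    using assms by simp
  also have "\<dots> \<le> (\<integral>u. indicator {a..b} u * \<bar>mu_sum (exp u)\<bar> + indicator {a..b} u * (exp (- a) + (b - a)) \<partial>lborel)"
  proof (intro integral_mono Bochner_Integration.integrable_add integrable_abs_mu_sum)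
    fix u :: real
    show "indicator {a..b} u * \<bar>mu_sum (exp b)\<bar> \<le> indicator {a..b} u * \<bar>mu_sum (exp u)\<bar> + indicator {a..b} u * (exp (- a) + (b - a))"
    proof (cases "u \<in> {a..b}")
      case True
      have "\<bar>mu_sum (exp b) - mu_sum (exp u)\<bar> \<le> 1 / exp u + ln (exp b / exp u)"
        using True assms by (intro mu_sum_slow) auto
      also have "\<dots> = exp (- u) + (b - u)" by (simp add: exp_minus inverse_eq_divide flip: exp_diff)
      also have "\<dots> \<le> exp (- a) + (b - a)" using True by (intro add_mono) auto
      finally show ?thesis using True by simp
    qed auto
  qed (intro integrable_mult_left integrable_indicator_Icc)+
  also have "\<dots> = (\<integral>u. indicator {a..b} u * \<bar>mu_sum (exp u)\<bar> \<partial>lborel) + (\<integral>u. indicator {a..b} u * (exp (- a) + (b - a)) \<partial>lborel)"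
    by (intro Bochner_Integration.integral_add integrable_abs_mu_sum integrable_mult_left integrable_indicator_Icc)
  also have "(\<integral>u. indicator {a..b} u * (exp (- a) + (b - a)) \<partial>lborel) = (b - a) * (exp (- a) + (b - a))"
    using assms by simp
  finally show ?thesis .
qed

text \<open>The convergence of \<open>\<Sum> \<mu>(n) / n\<close> to 0, a form of the prime number
  theorem. An average over a logarithmic window of length \<open>c\<close> ending at
  \<open>ln y\<close> bounds \<open>mu_sum y\<close> by the \<open>L1\<close> tail divided by
  \<open>c\<close>, plus the variation within the window, which is \<open>c\<close> up to a
  vanishing term; \<open>c = e / 2\<close> leaves room for the rest.\<close>

lemma mu_sum_tendsto_0: "(mu_sum \<longlongrightarrow> 0) at_top"
proof (rule tendstoI)
  fix e :: real assume e: "e > 0"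
  define c where "c = e / 2"
  have c: "c > 0" "c < e" using e by (auto simp: c_def)
  obtain C where C: "C > 0" "\<And>a b. 0 < a \<Longrightarrow> (\<integral>u. indicator {a..b} u * \<bar>mu_sum (exp u)\<bar> \<partial>lborel) \<le> C / sqrt a"
    using mu_sum_L1_tail by blast
  have "((\<lambda>y. C / sqrt (ln y - c) / c + exp (- (ln y - c)) + c) \<longlongrightarrow> c) at_top"
    using C c by real_asymp
  then have "\<forall>\<^sub>F y in at_top. C / sqrt (ln y - c) / c + exp (- (ln y - c)) + c < e"
    using c by (intro order_tendstoD)
  moreover have "\<forall>\<^sub>F y in at_top. y > exp c" by (rule eventually_gt_at_top)
  ultimately show "\<forall>\<^sub>F y in at_top. dist (mu_sum y) 0 < e"
  proof eventually_elim
    case (elim y)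
    have y: "y > 0" using elim(2) by (metis exp_gt_zero order_less_trans)
    then have ly: "ln y > c" using elim(2) by (metis exp_less_cancel_iff exp_ln)
    have "c * \<bar>mu_sum y\<bar> \<le> (\<integral>u. indicator {ln y - c..ln y} u * \<bar>mu_sum (exp u)\<bar> \<partial>lborel) + c * (exp (- (ln y - c)) + c)"
      using mu_sum_average[of "ln y - c" "ln y"] ly c y by simp
    also have "\<dots> \<le> C / sqrt (ln y - c) + c * (exp (- (ln y - c)) + c)"
      using ly by (intro add_right_mono C(2)) auto
    also have "\<dots> = c * (C / sqrt (ln y - c) / c + exp (- (ln y - c)) + c)" using c by (simp add: field_simps)
    also have "\<dots> < c * e" using elim(1) c by simp
    finally show ?case using c by simp
  qed
qed

subsection \<open>The Tauberian argument\<close>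

lemma sum_div_by_parts:
  fixes g :: "nat \<Rightarrow> real"
  defines "G \<equiv> \<lambda>n. \<Sum>k=1..n. g k"
  assumes "a \<le> b"
  shows "(\<Sum>k\<in>{a<..b}. g k / real k) = G b / real (b + 1) - G a / real (a + 1) + (\<Sum>k\<in>{a<..b}. G k / (real k * real (k + 1)))"
  using assms(2)
proof (induction b rule: dec_induct)
  case (step b)
  have "{a<..Suc b} = insert (Suc b) {a<..b}" using step by auto
  then have *: "(\<Sum>k\<in>{a<..Suc b}. h k) = h (Suc b) + (\<Sum>k\<in>{a<..b}. h k)" for h :: "nat \<Rightarrow> real"
    by simp
  have G: "G (Suc b) = G b + g (Suc b)" by (simp add: G_def)
  have "a / (c + 1) + a / (c * (c + 1)) = a / c" if "c > 0" for a c :: real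
  proof -
    have "a / (c + 1) + a / (c * (c + 1)) = (a * c + a) / (c * (c + 1))"
      using that by (simp add: add_divide_distrib)
    also have "a * c + a = a * (c + 1)" by (simp add: algebra_simps)
    finally show ?thesis using that by simp
  qed
  from this[of "real (Suc b)" "G b + g (Suc b)"]
  have "(G b + g (Suc b)) / real (Suc b + 1) + (G b + g (Suc b)) / (real (Suc b) * real (Suc b + 1)) = (G b + g (Suc b)) / real (Suc b)"
    by simp
  moreover have "(G b + g (Suc b)) / real (Suc b) = G b / real (b + 1) + g (Suc b) / real (Suc b)"
    by (simp add: add_divide_distrib)
  ultimately show ?case
    unfolding * step.IH G by linarith
qed simp

text \<open>The ratio of the ends of the block is bounded, so a mean value without a rate suffices.
  Summation by parts leaves two boundary terms of size \<open>\<delta>\<close> and a sum with at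
  most \<open>K * (a + 1)\<close> terms of size \<open>\<delta> / (a + 1)\<close>. The choice
  \<open>\<delta> = e / (3 + K)\<close> makes the total \<open>(2 + K) * \<delta>\<close> smaller
  than \<open>e\<close>.\<close>

lemma sum_div_block_tendsto_0:
  fixes g :: "nat \<Rightarrow> real"
  assumes mean: "(\<lambda>N. (\<Sum>n=1..N. g n) / real N) \<longlonglongrightarrow> 0" and K: "1 \<le> m" "m \<le> K"
  shows "(\<lambda>N. \<Sum>k\<in>{N div K<..N div m}. g k / real k) \<longlonglongrightarrow> 0"
proof (rule tendstoI)
  fix e :: real assume e: "e > 0"
  define \<delta> where "\<delta> = e / (3 + real K)"
  have \<delta>: "\<delta> > 0" using e by (simp add: \<delta>_def)
  define G where "G n = (\<Sum>k=1..n. g k)" for n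
  obtain n0 where n0: "\<And>n. n \<ge> n0 \<Longrightarrow> norm (G n / real n - 0) < \<delta>"
    using LIMSEQ_D[OF mean \<delta>] by (auto simp: G_def)
  have G: "\<bar>G n\<bar> \<le> \<delta> * real n" if "n \<ge> n0" for n
    using n0[OF that] by (cases "n = 0") (auto simp: G_def abs_divide field_simps)
  have "dist (\<Sum>k\<in>{N div K<..N div m}. g k / real k) 0 < e" if N: "N \<ge> K * n0" for N
  proof -
    define a where "a = N div K"
    define b where "b = N div m"
    have a: "a \<ge> n0" using N K unfolding a_def by (metis div_le_mono nonzero_mult_div_cancel_left not_one_le_zero order_trans)
    have ab: "a \<le> b" unfolding a_def b_def using K by (intro div_le_mono2) auto
    have "N < K * (a + 1)" using K dividend_less_div_times[of K N] unfolding a_def by (simp add: mult.commute)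
    moreover have "b \<le> N" by (simp add: b_def)
    ultimately have "b < K * (a + 1)" by linarith
    then have bK: "real b \<le> real K * (real a + 1)"
      by (metis less_imp_le of_nat_le_iff of_nat_mult of_nat_add of_nat_1)
    have Gb: "\<bar>G n / real (n + 1)\<bar> \<le> \<delta>" if "n \<ge> n0" for n
    proof -
      have "\<bar>G n\<bar> \<le> \<delta> * real (n + 1)" using G[OF that] \<delta> by (simp add: algebra_simps)
      then show ?thesis by (simp add: abs_divide divide_simps)
    qed
    have "\<bar>\<Sum>k\<in>{a<..b}. G k / (real k * real (k + 1))\<bar> \<le> (\<Sum>k\<in>{a<..b}. \<delta> / (real a + 1))"
    proof (intro order_trans[OF sum_abs] sum_mono)
      fix k assume k: "k \<in> {a<..b}"
      have "\<bar>G k / (real k * real (k + 1))\<bar> = \<bar>G k / real (k + 1)\<bar> / real k" by (simp add: abs_divide abs_mult)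
      also have "\<dots> \<le> \<delta> / (real a + 1)"
        using k a Gb[of k] \<delta> by (intro frac_le) auto
      finally show "\<bar>G k / (real k * real (k + 1))\<bar> \<le> \<delta> / (real a + 1)" .
    qed
    also have "\<dots> = real (b - a) * (\<delta> / (real a + 1))" by simp
    also have "\<dots> \<le> (real K * (real a + 1)) * (\<delta> / (real a + 1))"
      using bK \<delta> by (intro mult_right_mono) auto
    also have "\<dots> = real K * \<delta>" by simp
    finally have 1: "\<bar>\<Sum>k\<in>{a<..b}. G k / (real k * real (k + 1))\<bar> \<le> real K * \<delta>" .
    have "(\<Sum>k\<in>{a<..b}. g k / real k) = G b / real (b + 1) - G a / real (a + 1) + (\<Sum>k\<in>{a<..b}. G k / (real k * real (k + 1)))"
      unfolding G_def by (rule sum_div_by_parts[OF ab])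
    then have "\<bar>\<Sum>k\<in>{a<..b}. g k / real k\<bar> \<le> \<delta> + \<delta> + real K * \<delta>"
      using 1 Gb[of a] Gb[of b] a ab by linarith
    also have "\<dots> < (3 + real K) * \<delta>" using \<delta> by (simp add: algebra_simps)
    also have "\<dots> = e" using K by (simp add: \<delta>_def)
    finally show ?thesis by (simp add: a_def b_def)
  qed
  then show "\<forall>\<^sub>F N in sequentially. dist (\<Sum>k\<in>{N div K<..N div m}. g k / real k) 0 < e"
    unfolding eventually_sequentially by blast
qed

lemma mu_sum_of_nat_div: "mu_sum (real N / real k) = (\<Sum>m\<in>{1..N div k}. of_int (moebius_mu m) / real m)"
  by (simp add: mu_sum_def floor_divide_of_nat_eq)

text \<open>For \<open>k > N div K\<close> only indices \<open>m \<le> K\<close> occur in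
  \<open>mu_sum (N / k)\<close>. Exchanging the sums therefore gives a fixed number of blocks, each
  of which vanishes in the limit.\<close>

lemma top_range_tendsto_0:
  fixes g :: "nat \<Rightarrow> real"
  assumes mean: "(\<lambda>N. (\<Sum>n=1..N. g n) / real N) \<longlonglongrightarrow> 0" and K: "K \<ge> 1"
  shows "(\<lambda>N. \<Sum>k\<in>{N div K<..N}. g k / real k * mu_sum (real N / real k)) \<longlonglongrightarrow> 0"
proof -
  have "(\<Sum>k\<in>{N div K<..N}. g k / real k * mu_sum (real N / real k)) =
      (\<Sum>m\<in>{1..K}. of_int (moebius_mu m) / real m * (\<Sum>k\<in>{N div K<..N div m}. g k / real k))" for N
  proof -
    have iff: "m \<le> N div k \<longleftrightarrow> k \<le> N div m" if "m > 0" "k > 0" for m k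
      using that by (simp add: less_eq_div_iff_mult_less_eq mult.commute)
    have small: "m \<le> K" if "m \<le> N div k" "N div K < k" for m k
    proof (rule ccontr)
      assume "\<not> m \<le> K"
      then have "N div m \<le> N div K" using K by (intro div_le_mono2) auto
      moreover have "k \<le> N div m" using iff[of m k] that \<open>\<not> m \<le> K\<close> by auto
      ultimately show False using that by linarith
    qed
    have "(\<Sum>k\<in>{N div K<..N}. g k / real k * mu_sum (real N / real k)) =
       (\<Sum>k\<in>{N div K<..N}. \<Sum>m\<in>{1..N div k}. of_int (moebius_mu m) / real m * (g k / real k))"
      by (simp add: mu_sum_of_nat_div sum_distrib_left mult.commute)
    also have "\<dots> = (\<Sum>(k,m)\<in>(SIGMA k:{N div K<..N}. {1..N div k}). of_int (moebius_mu m) / real m * (g k / real k))"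
      by (rule sum.Sigma) auto
    also have "\<dots> = (\<Sum>(m,k)\<in>(SIGMA m:{1..K}. {N div K<..N div m}). of_int (moebius_mu m) / real m * (g k / real k))"
    proof (rule sum.reindex_bij_witness[of _ "\<lambda>(a,b). (b,a)" "\<lambda>(a,b). (b,a)"])
      fix z assume "z \<in> (SIGMA k:{N div K<..N}. {1..N div k})"
      then obtain k m where z: "z = (k, m)" "N div K < k" "1 \<le> m" "m \<le> N div k" by auto
      have "k \<le> N div m" using iff[of m k] z by auto
      moreover have "m \<le> K" using small[of m k] z by auto
      ultimately show "(case z of (a, b) \<Rightarrow> (b, a)) \<in> (SIGMA m:{1..K}. {N div K<..N div m})"
        using z by simp
    next
      fix z assume "z \<in> (SIGMA m:{1..K}. {N div K<..N div m})"
      then obtain m k where z: "z = (m, k)" "N div K < k" "1 \<le> m" "k \<le> N div m" by auto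
      have "m \<le> N div k" using iff[of m k] z by auto
      moreover have "k \<le> N" using z(4) div_le_dividend[of N m] by (rule order_trans)
      ultimately show "(case z of (a, b) \<Rightarrow> (b, a)) \<in> (SIGMA k:{N div K<..N}. {1..N div k})"
        using z by simp
    qed auto
    also have "\<dots> = (\<Sum>m\<in>{1..K}. \<Sum>k\<in>{N div K<..N div m}. of_int (moebius_mu m) / real m * (g k / real k))"
      by (rule sum.Sigma[symmetric]) auto
    finally show ?thesis by (simp add: sum_distrib_left)
  qed
  moreover have "(\<lambda>N. \<Sum>m\<in>{1..K}. of_int (moebius_mu m) / real m * (\<Sum>k\<in>{N div K<..N div m}. g k / real k)) \<longlonglongrightarrow>
     (\<Sum>m\<in>{1..K}. of_int (moebius_mu m) / real m * 0)"
    by (intro tendsto_sum tendsto_mult tendsto_const sum_div_block_tendsto_0[OF mean]) auto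
  ultimately show ?thesis by simp
qed

section \<open>The middle range as a Riemann sum\<close>

lemma sum_integrals_le:
  fixes L :: "nat \<Rightarrow> real"
  assumes "p \<le> q" and L: "\<And>k. p \<le> k \<Longrightarrow> L (Suc k) \<le> L k"
  shows "(\<Sum>k\<in>{p..<q}. \<integral>u. indicator {L (Suc k)..L k} u * \<bar>mu_sum (exp u)\<bar> \<partial>lborel) \<le>
    (\<integral>u. indicator {L q..L p} u * \<bar>mu_sum (exp u)\<bar> \<partial>lborel)"
  using assms(1)
proof (induction q rule: dec_induct)
  case base
  show ?case by (simp add: integral_nonneg)
next
  case (step q)
  have Lq: "L q \<le> L p" using step(1) by (induction q rule: dec_induct) (auto intro: order_trans[OF L])
  have "(\<Sum>k\<in>{p..<Suc q}. \<integral>u. indicator {L (Suc k)..L k} u * \<bar>mu_sum (exp u)\<bar> \<partial>lborel) \<le>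
      (\<integral>u. indicator {L q..L p} u * \<bar>mu_sum (exp u)\<bar> \<partial>lborel) + (\<integral>u. indicator {L (Suc q)..L q} u * \<bar>mu_sum (exp u)\<bar> \<partial>lborel)"
    using step by simp
  also have "\<dots> = (\<integral>u. indicator {L q..L p} u * \<bar>mu_sum (exp u)\<bar> + indicator {L (Suc q)..L q} u * \<bar>mu_sum (exp u)\<bar> \<partial>lborel)"
    by (intro Bochner_Integration.integral_add[symmetric] integrable_abs_mu_sum)
  also have "\<dots> = (\<integral>u. indicator {L (Suc q)..L p} u * \<bar>mu_sum (exp u)\<bar> \<partial>lborel)"
  proof (rule integral_cong_AE)
    show "AE u in lborel. indicator {L q..L p} u * \<bar>mu_sum (exp u)\<bar> + indicator {L (Suc q)..L q} u * \<bar>mu_sum (exp u)\<bar> =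
       indicator {L (Suc q)..L p} u * \<bar>mu_sum (exp u)\<bar>"
      using AE_lborel_singleton[of "L q"] Lq L[OF step(1)]
      by (auto simp: indicator_def elim!: eventually_mono)
  qed measurable
  finally show ?case .
qed

lemma sum_inverse_squares_le:
  assumes "1 \<le> p" "p \<le> q"
  shows "(\<Sum>k\<in>{Suc p..<Suc q}. 1 / (real k)\<^sup>2) \<le> 1 / real p - 1 / real q"
  using assms(2)
proof (induction q rule: dec_induct)
  case (step q)
  have "1 / (c + 1)\<^sup>2 \<le> 1 / c - 1 / (c + 1)" if "c > 0" for c :: real
  proof -
    have "1 / (c + 1)\<^sup>2 \<le> 1 / (c * (c + 1))" using that by (intro divide_left_mono) (auto simp: power2_eq_square)
    also have "\<dots> = 1 / c - 1 / (c + 1)" using that by (simp add: field_simps)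
    finally show ?thesis .
  qed
  from this[of "real q"] show ?case using step assms by (simp add: add.commute)
qed simp

text \<open>The interval from \<open>ln (N / (k + 1))\<close> to \<open>ln (N / k)\<close> has
  length between \<open>1 / (2 k)\<close> and \<open>1 / k\<close>, so
  \<open>|mu_sum (N / k)| / k\<close> is at most twice the integral over it, up to the variation
  measured by \<open>mu_sum_average\<close>. Summed over \<open>k\<close>, the variation costs
  \<open>4 / K + 2 / P\<close>, and the intervals join into one tail integral that starts at or
  beyond \<open>ln (K / 2)\<close>.\<close>

lemma middle_range_bound:
  fixes g :: "nat \<Rightarrow> real"
  assumes C: "\<And>a b. 0 < a \<Longrightarrow> (\<integral>u. indicator {a..b} u * \<bar>mu_sum (exp u)\<bar> \<partial>lborel) \<le> C / sqrt a" and "C > 0"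
    and M: "\<And>n. n \<ge> 1 \<Longrightarrow> \<bar>g n\<bar> \<le> M"
    and K: "K \<ge> 3" and P: "P \<ge> 1" and N: "N \<ge> K * P" 
  shows "\<bar>\<Sum>k\<in>{P<..N div K}. g k / real k * mu_sum (real N / real k)\<bar> \<le> M * (2 * C / sqrt (ln (real K / 2)) + 4 / real K + 2 / real P)"
proof -
  have M0: "M \<ge> 0" using M[of 1] by linarith
  define Q where "Q = N div K"
  have PQ: "P \<le> Q" using N K unfolding Q_def by (metis div_le_mono nonzero_mult_div_cancel_left not_numeral_le_zero)
  have "N \<ge> K * 1" using N P by (meson mult_le_mono2 order_trans)
  then have NK: "N \<ge> K" "N > 0" using K by auto
  have QN: "real Q \<le> real N / real K" unfolding Q_def by (rule of_nat_div_le_of_nat)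
  define L where "L k = ln (real N / real k)" for k
  have Lmono: "L (Suc k) \<le> L k" if "k \<ge> 1" for k
    using that NK by (auto simp: L_def intro!: ln_mono divide_left_mono)
  \<comment> \<open>This makes all the left endpoints \<open>L (Suc k)\<close> nonnegative, as
    \<open>mu_sum_average\<close> demands.\<close>
  have Q1: "Suc Q \<le> N"
  proof -
    have "Q \<le> N div 3" unfolding Q_def using K by (intro div_le_mono2) auto
    then show ?thesis using NK K by linarith
  qed
  have each: "\<bar>mu_sum (real N / real k)\<bar> / real k \<le> 2 * (\<integral>u. indicator {L (Suc k)..L k} u * \<bar>mu_sum (exp u)\<bar> \<partial>lborel) + (4 / real N + 2 * (1 / (real k)\<^sup>2))"
    if k: "k \<in> {P<..Q}" for k
  proof -
    define x where "x = real k"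
    have x: "x \<ge> 1" using k P by (auto simp: x_def)
    define d where "d = L k - L (Suc k)"
    have d: "d = ln ((x + 1) / x)" using NK x k unfolding d_def L_def x_def by (simp add: ln_div add.commute)
    have d1: "d \<le> 1 / x"
    proof -
      have "d \<le> (x + 1) / x - 1" unfolding d using x by (intro ln_le_minus_one) auto
      then show ?thesis using x by (simp add: field_simps)
    qed
    have d2: "d \<ge> 1 / (2 * x)"
    proof -
      have "ln (x / (x + 1)) \<le> x / (x + 1) - 1" using x by (intro ln_le_minus_one) auto
      also have "\<dots> = - (1 / (x + 1))" using x by (simp add: field_simps)
      finally have "1 / (x + 1) \<le> d" using x by (simp add: d ln_div)
      moreover have "1 / (2 * x) \<le> 1 / (x + 1)" using x by (intro divide_left_mono) auto
      ultimately show ?thesis by linarith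
    qed
    have d0: "d \<ge> 0" using d2 x by (intro order_trans[OF _ d2]) auto
    have L0: "0 \<le> L (Suc k)" unfolding L_def using k Q1 by (intro ln_ge_zero) auto
    have eL: "exp (L k) = real N / real k" "exp (- L (Suc k)) = (x + 1) / real N"
      using NK k by (auto simp: L_def exp_minus x_def)
    have "d * \<bar>mu_sum (real N / real k)\<bar> \<le> (\<integral>u. indicator {L (Suc k)..L k} u * \<bar>mu_sum (exp u)\<bar> \<partial>lborel) + d * ((x + 1) / real N + d)"
      using mu_sum_average[OF L0 Lmono[of k]] k P unfolding eL d_def[symmetric] by simp
    also have "d * ((x + 1) / real N + d) \<le> (1 / x) * ((2 * x) / real N + 1 / x)"
      using d1 d0 x NK by (intro mult_mono add_mono divide_right_mono) auto
    also have "\<dots> = 2 / real N + 1 / x\<^sup>2" using x by (simp add: algebra_simps power2_eq_square)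
    finally have 1: "d * \<bar>mu_sum (real N / real k)\<bar> \<le> (\<integral>u. indicator {L (Suc k)..L k} u * \<bar>mu_sum (exp u)\<bar> \<partial>lborel) + (2 / real N + 1 / x\<^sup>2)" by simp
    have "\<bar>mu_sum (real N / real k)\<bar> / real k = 2 * ((1 / (2 * x)) * \<bar>mu_sum (real N / real k)\<bar>)" by (simp add: x_def)
    also have "\<dots> \<le> 2 * (d * \<bar>mu_sum (real N / real k)\<bar>)" using d2 by (intro mult_left_mono mult_right_mono) auto
    finally show ?thesis using 1 by (simp add: x_def)
  qed
  have "\<bar>\<Sum>k\<in>{P<..Q}. g k / real k * mu_sum (real N / real k)\<bar> \<le> (\<Sum>k\<in>{P<..Q}. M * (\<bar>mu_sum (real N / real k)\<bar> / real k))"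
  proof (intro order_trans[OF sum_abs] sum_mono)
    fix k assume "k \<in> {P<..Q}"
    then have "\<bar>g k\<bar> * (\<bar>mu_sum (real N / real k)\<bar> / real k) \<le> M * (\<bar>mu_sum (real N / real k)\<bar> / real k)"
      by (intro mult_right_mono M) auto
    then show "\<bar>g k / real k * mu_sum (real N / real k)\<bar> \<le> M * (\<bar>mu_sum (real N / real k)\<bar> / real k)"
      by (simp add: abs_mult abs_divide)
  qed
  also have "\<dots> \<le> (\<Sum>k\<in>{P<..Q}. M * (2 * (\<integral>u. indicator {L (Suc k)..L k} u * \<bar>mu_sum (exp u)\<bar> \<partial>lborel) + (4 / real N + 2 * (1 / (real k)\<^sup>2))))"
    by (intro sum_mono mult_left_mono each M0) auto
  also have "\<dots> = M * (2 * (\<Sum>k\<in>{P<..Q}. \<integral>u. indicator {L (Suc k)..L k} u * \<bar>mu_sum (exp u)\<bar> \<partial>lborel) +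
      (\<Sum>k\<in>{P<..Q}. 4 / real N) + 2 * (\<Sum>k\<in>{P<..Q}. 1 / (real k)\<^sup>2))"
    by (simp only: sum_distrib_left sum.distrib add.assoc distrib_left)
  also have "\<dots> \<le> M * (2 * (C / sqrt (ln (real K / 2))) + 4 / real K + 2 * (1 / real P))"
  proof (intro mult_left_mono add_mono M0)
    have set: "{P<..Q} = {Suc P..<Suc Q}" by auto
    have "(\<Sum>k\<in>{P<..Q}. \<integral>u. indicator {L (Suc k)..L k} u * \<bar>mu_sum (exp u)\<bar> \<partial>lborel) \<le>
        (\<integral>u. indicator {L (Suc Q)..L (Suc P)} u * \<bar>mu_sum (exp u)\<bar> \<partial>lborel)"
      unfolding set using PQ Lmono by (intro sum_integrals_le) auto
    \<comment> \<open>From \<open>Q \<le> N / K\<close> and \<open>1 \<le> N / K\<close> one gets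
      \<open>Q + 1 \<le> 2 N / K\<close>; the extra 1 is why \<open>ln (K / 2)\<close> and not
      \<open>ln K\<close> appears.\<close>
    also have LK: "L (Suc Q) \<ge> ln (real K / 2)"
    proof -
      have "real Q * real K \<le> real N" using QN K by (simp add: field_simps)
      then have "real (Suc Q) * real K \<le> 2 * real N" using NK by (simp add: algebra_simps)
      then have "real (Suc Q) \<le> real N / real K + real N / real K" using K by (simp add: field_simps)
      then have "real K / 2 * real (Suc Q) \<le> real K / 2 * (real N / real K + real N / real K)" by (intro mult_left_mono) auto
      also have "\<dots> = real N" using K by simp
      finally have "real K / 2 \<le> real N / real (Suc Q)" by (simp add: pos_le_divide_eq)
      then show ?thesis unfolding L_def using K by (intro ln_mono) auto
    qed
    have lnK: "ln (real K / 2) > 0" using K by simp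
    have "(\<integral>u. indicator {L (Suc Q)..L (Suc P)} u * \<bar>mu_sum (exp u)\<bar> \<partial>lborel) \<le> C / sqrt (L (Suc Q))"
      using lnK LK by (intro C) auto
    also have "\<dots> \<le> C / sqrt (ln (real K / 2))"
      using lnK LK \<open>C > 0\<close> by (intro divide_left_mono) auto
    finally show "(\<Sum>k\<in>{P<..Q}. \<integral>u. indicator {L (Suc k)..L k} u * \<bar>mu_sum (exp u)\<bar> \<partial>lborel) \<le> C / sqrt (ln (real K / 2))" .
    have "(\<Sum>k\<in>{P<..Q}. 4 / real N) = real (Q - P) * (4 / real N)" by simp
    also have "\<dots> \<le> real N / real K * (4 / real N)" using QN by (intro mult_right_mono) auto
    also have "\<dots> = 4 / real K" using NK by simp
    finally show "(\<Sum>k\<in>{P<..Q}. 4 / real N) \<le> 4 / real K" .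
    have "(\<Sum>k\<in>{P<..Q}. 1 / (real k)\<^sup>2) \<le> 1 / real P - 1 / real Q"
      unfolding set using P PQ by (intro sum_inverse_squares_le)
    then show "(\<Sum>k\<in>{P<..Q}. 1 / (real k)\<^sup>2) \<le> 1 / real P"
      by (rule order_trans) simp
  qed auto
  finally show ?thesis by (simp add: Q_def)
qed

text \<open>For the first \<open>K\<close> indices the pointwise limit of \<open>mu_sum\<close>
  suffices, and beyond \<open>N div K\<close> the mean value of \<open>g\<close> does. The range
  between has a bound that is uniform in \<open>N\<close> and tends to 0 with growing
  \<open>K\<close>, so \<open>K\<close> is fixed before \<open>N\<close> grows. \<open>K\<close>
  also serves as the lower cut \<open>P\<close>, and \<open>N \<ge> K * K\<close> puts the three
  ranges in order.\<close>

lemma convolution_tendsto_0: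
  fixes g :: "nat \<Rightarrow> real"
  assumes M: "\<And>n. n \<ge> 1 \<Longrightarrow> \<bar>g n\<bar> \<le> M" and mean: "(\<lambda>N. (\<Sum>n=1..N. g n) / real N) \<longlonglongrightarrow> 0"
  shows "(\<lambda>N. \<Sum>k=1..N. g k / real k * mu_sum (real N / real k)) \<longlonglongrightarrow> 0"
proof (rule tendstoI)
  fix e :: real assume e: "e > 0"
  obtain C where C: "C > 0" "\<And>a b. 0 < a \<Longrightarrow> (\<integral>u. indicator {a..b} u * \<bar>mu_sum (exp u)\<bar> \<partial>lborel) \<le> C / sqrt a"
    using mu_sum_L1_tail by blast
  have "((\<lambda>K. M * (2 * C / sqrt (ln (real K / 2)) + 4 / real K + 2 / real K)) \<longlongrightarrow> 0) sequentially"
    by real_asymp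
  then have "\<forall>\<^sub>F K in sequentially. M * (2 * C / sqrt (ln (real K / 2)) + 4 / real K + 2 / real K) < e / 3"
    using e by (intro order_tendstoD) auto
  moreover have "\<forall>\<^sub>F K in sequentially. K \<ge> (3::nat)" by (rule eventually_ge_at_top)
  ultimately have "\<forall>\<^sub>F K in sequentially. M * (2 * C / sqrt (ln (real K / 2)) + 4 / real K + 2 / real K) < e / 3 \<and> K \<ge> (3::nat)"
    by eventually_elim auto
  then obtain K :: nat where K: "K \<ge> 3" "M * (2 * C / sqrt (ln (real K / 2)) + 4 / real K + 2 / real K) < e / 3"
    unfolding eventually_sequentially by blast
  have low: "(\<lambda>N. \<Sum>k\<in>{1..K}. g k / real k * mu_sum (real N / real k)) \<longlonglongrightarrow> (\<Sum>k\<in>{1..K}. g k / real k * 0)"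
  proof (intro tendsto_sum tendsto_mult tendsto_const filterlim_compose[OF mu_sum_tendsto_0])
    fix k assume "k \<in> {1..K}"
    then show "filterlim (\<lambda>N. real N / real k) at_top sequentially" by real_asymp
  qed
  have top: "(\<lambda>N. \<Sum>k\<in>{N div K<..N}. g k / real k * mu_sum (real N / real k)) \<longlonglongrightarrow> 0"
    using K by (intro top_range_tendsto_0 mean) auto
  have "\<forall>\<^sub>F N in sequentially. \<bar>\<Sum>k\<in>{1..K}. g k / real k * mu_sum (real N / real k)\<bar> < e / 3"
    using tendstoD[OF low, of "e / 3"] e by simp
  moreover have "\<forall>\<^sub>F N in sequentially. \<bar>\<Sum>k\<in>{N div K<..N}. g k / real k * mu_sum (real N / real k)\<bar> < e / 3"
    using tendstoD[OF top, of "e / 3"] e by simp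
  moreover have "\<forall>\<^sub>F N in sequentially. N \<ge> K * K" by (rule eventually_ge_at_top)
  ultimately show "\<forall>\<^sub>F N in sequentially. dist (\<Sum>k=1..N. g k / real k * mu_sum (real N / real k)) 0 < e"
  proof eventually_elim
    case (elim N)
    define s where "s k = g k / real k * mu_sum (real N / real k)" for k
    have split: "{1..N} = {1..K} \<union> ({K<..q} \<union> {q<..N})" if "K \<le> q" "q \<le> N" for q
      using that K by auto
    have "K \<le> N div K" using elim(3) K by (metis div_le_mono nonzero_mult_div_cancel_left not_numeral_le_zero)
    from split[OF this div_le_dividend] have "(\<Sum>k=1..N. s k) = (\<Sum>k=1..K. s k) + ((\<Sum>k\<in>{K<..N div K}. s k) + (\<Sum>k\<in>{N div K<..N}. s k))"
      using \<open>K \<le> N div K\<close> by (simp only:) (subst sum.union_disjoint, force, force, force, subst sum.union_disjoint, auto)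
    moreover have "\<bar>\<Sum>k\<in>{K<..N div K}. s k\<bar> \<le> M * (2 * C / sqrt (ln (real K / 2)) + 4 / real K + 2 / real K)"
      unfolding s_def using K elim by (intro middle_range_bound C M) auto
    moreover have "\<bar>a + (b + c)\<bar> < e" if "\<bar>a\<bar> < e / 3" "\<bar>b\<bar> \<le> m" "m < e / 3" "\<bar>c\<bar> < e / 3" for a b c m :: real
      using that by linarith
    ultimately have "\<bar>\<Sum>k=1..N. s k\<bar> < e"
      using elim(1,2) K(2) unfolding s_def[symmetric] by metis
    then show ?case by (simp add: s_def)
  qed
qed

section \<open>The convolution identity and the conclusion\<close>

lemma sum_twisted_eq:
  "(\<Sum>n=1..N. twisted f n / real n) = (\<Sum>k=1..N. pf_gap f k / real k * mu_sum (real N / real k))"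
proof -
  have "(\<Sum>n=1..N. twisted f n / real n) = (\<Sum>n=1..N. \<Sum>d | d dvd n. moebius_mu d / real d * (pf_gap f (n div d) / real (n div d)))"
  proof (intro sum.cong refl)
    fix n assume "n \<in> {1..N}"
    then have n: "n > 0" by simp
    have "moebius_mu d * pf_gap f (n div d) / real n = moebius_mu d / real d * (pf_gap f (n div d) / real (n div d))" if "d dvd n" for d
      using that n by (auto elim!: dvdE)
    then show "twisted f n / real n = (\<Sum>d | d dvd n. moebius_mu d / real d * (pf_gap f (n div d) / real (n div d)))"
      unfolding moebius_inversion_pf_gap[OF n] sum_divide_distrib by (intro sum.cong) auto
  qed
  also have "\<dots> = (\<Sum>(n,d)\<in>(SIGMA n:{1..N}. {d. d dvd n}). moebius_mu d / real d * (pf_gap f (n div d) / real (n div d)))"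
    by (rule sum.Sigma) auto
  also have "\<dots> = (\<Sum>(k,d)\<in>(SIGMA k:{1..N}. {1..N div k}). moebius_mu d / real d * (pf_gap f k / real k))"
  proof (rule sum.reindex_bij_witness[of _ "\<lambda>(k,d). (k * d, d)" "\<lambda>(n,d). (n div d, d)"])
    fix z assume "z \<in> (SIGMA n:{1..N}. {d. d dvd n})"
    then obtain n d where z: "z = (n, d)" and n: "1 \<le> n" "n \<le> N" and dn: "d dvd n" by auto
    from dn obtain k where k: "n = d * k" by (rule dvdE)
    then have "d > 0" "k > 0" using n by auto
    then show "(case case z of (n, d) \<Rightarrow> (n div d, d) of (k, d) \<Rightarrow> (k * d, d)) = z"
      "(case z of (n, d) \<Rightarrow> (n div d, d)) \<in> (SIGMA k:{1..N}. {1..N div k})"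
      "(case case z of (n, d) \<Rightarrow> (n div d, d) of (k, d) \<Rightarrow> moebius_mu d / real d * (pf_gap f k / real k)) =
        (case z of (n, d) \<Rightarrow> moebius_mu d / real d * (pf_gap f (n div d) / real (n div d)))"
      using n by (auto simp: z k less_eq_div_iff_mult_less_eq intro: order_trans[of k "d * k"])
  next
    fix z assume "z \<in> (SIGMA k:{1..N}. {1..N div k})"
    then obtain k d where z: "z = (k, d)" and kd: "1 \<le> k" "k \<le> N" "1 \<le> d" "d \<le> N div k" by auto
    then show "(case case z of (k, d) \<Rightarrow> (k * d, d) of (n, d) \<Rightarrow> (n div d, d)) = z"
      "(case z of (k, d) \<Rightarrow> (k * d, d)) \<in> (SIGMA n:{1..N}. {d. d dvd n})"
      by (auto simp: less_eq_div_iff_mult_less_eq mult.commute)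
  qed
  also have "\<dots> = (\<Sum>k=1..N. \<Sum>d=1..N div k. moebius_mu d / real d * (pf_gap f k / real k))"
    by (rule sum.Sigma[symmetric]) auto
  also have "\<dots> = (\<Sum>k=1..N. pf_gap f k / real k * mu_sum (real N / real k))"
    by (simp add: mu_sum_of_nat_div sum_distrib_left mult.commute)
  finally show ?thesis .
qed

text \<open>The function \<open>f\<close> is bounded on primes only, so a bound for
  \<open>pf_gap f\<close> requires that \<open>f\<close> be evaluated at primes there.\<close>

lemma prime_greatest_pf: "n \<ge> 2 \<Longrightarrow> prime (greatest_pf n)"
proof -
  assume "n \<ge> 2"
  then have "prime_factors n \<noteq> {}" by (auto simp: prime_factorization_empty_iff)
  then have "Max (prime_factors n) \<in> prime_factors n" by (intro Max_in) auto
  then show ?thesis by (auto simp: greatest_pf_def)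
qed

lemma prime_second_pf: "omega n \<ge> 2 \<Longrightarrow> prime (second_pf n)"
proof -
  assume n: "omega n \<ge> 2"
  define S where "S = prime_factors n"
  have S: "finite S" "card S \<ge> 2" using n by (auto simp: S_def omega_def)
  then have "S \<noteq> {}" by auto
  then have M: "Max S \<in> S" using S by (intro Max_in)
  have "card (S - {Max S}) \<noteq> 0" using S M by simp
  then have "S - {Max S} \<noteq> {}" by fastforce
  then obtain q where "q \<in> S" "q \<noteq> Max S" by auto
  then have "q \<in> {q \<in> S. q < Max S}" using S by (simp add: le_neq_trans)
  then have "Max {q \<in> S. q < Max S} \<in> {q \<in> S. q < Max S}" using S by (intro Max_in) auto
  then have "second_pf n \<in> S" by (simp add: second_pf_def greatest_pf_def S_def)
  then show ?thesis by (auto simp: S_def)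
qed

lemma omega_ge_2_imp: "omega n \<ge> 2 \<Longrightarrow> n \<ge> 2"
proof (rule ccontr)
  assume "omega n \<ge> 2" "\<not> n \<ge> 2"
  then have "n = 0 \<or> n = 1" by auto
  with \<open>omega n \<ge> 2\<close> show False by (auto simp: omega_def)
qed

theorem theorem13:
  fixes f :: "nat \<Rightarrow> real" and \<kappa> :: real
  assumes "bounded (f ` {p. prime p})"
    and "asymp_linear (\<lambda>x. \<Sum>n | 2 \<le> n \<and> real n \<le> x. f (greatest_pf n)) \<kappa>"
    and "asymp_linear (\<lambda>x. \<Sum>n | 2 \<le> n \<and> real n \<le> x \<and> omega n \<ge> 2. f (second_pf n)) \<kappa>"
  shows "(\<lambda>n. if n \<ge> 2 then of_int (moebius_mu n) * real (omega n) * f (least_pf n) / real n else 0) sums 0"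
proof -
  obtain M where M: "\<And>p. prime p \<Longrightarrow> \<bar>f p\<bar> \<le> M"
    using assms(1) by (auto simp: bounded_iff)
  have M0: "M \<ge> 0" using M[OF two_is_prime_nat] by linarith
  have bound: "\<bar>pf_gap f n\<bar> \<le> 2 * M" for n
  proof -
    have "\<bar>if omega n \<ge> 2 then f (second_pf n) else 0\<bar> \<le> M" using M0 by (auto intro: M prime_second_pf)
    moreover have "\<bar>if n \<ge> 2 then f (greatest_pf n) else 0\<bar> \<le> M" using M0 by (auto intro: M prime_greatest_pf)
    ultimately show ?thesis unfolding pf_gap_def by linarith
  qed
  \<comment> \<open>Both asymptotics are specialised to integers and subtracted. Here the equality
    of the two constants enters: it makes the mean value of \<open>pf_gap f\<close> equal to
    0.\<close>
  have "(\<lambda>N. (\<Sum>n | 2 \<le> n \<and> real n \<le> real N \<and> omega n \<ge> 2. f (second_pf n)) / real N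
      - (\<Sum>n | 2 \<le> n \<and> real n \<le> real N. f (greatest_pf n)) / real N) \<longlonglongrightarrow> \<kappa> - \<kappa>"
    by (intro tendsto_diff filterlim_compose[OF assms(2)[unfolded asymp_linear_def] filterlim_real_sequentially]
        filterlim_compose[OF assms(3)[unfolded asymp_linear_def] filterlim_real_sequentially])
  moreover have "(\<Sum>n | 2 \<le> n \<and> real n \<le> real N \<and> omega n \<ge> 2. f (second_pf n)) / real N
      - (\<Sum>n | 2 \<le> n \<and> real n \<le> real N. f (greatest_pf n)) / real N = (\<Sum>n=1..N. pf_gap f n) / real N" for N
  proof -
    have "(\<Sum>n | 2 \<le> n \<and> real n \<le> real N \<and> omega n \<ge> 2. f (second_pf n)) = (\<Sum>n=1..N. if omega n \<ge> 2 then f (second_pf n) else 0)"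
      by (intro sum.mono_neutral_cong_left) (auto dest: omega_ge_2_imp)
    moreover have "(\<Sum>n | 2 \<le> n \<and> real n \<le> real N. f (greatest_pf n)) = (\<Sum>n=1..N. if n \<ge> 2 then f (greatest_pf n) else 0)"
      by (intro sum.mono_neutral_cong_left) auto
    ultimately show ?thesis by (simp add: pf_gap_def sum_subtractf diff_divide_distrib)
  qed
  ultimately have "(\<lambda>N. (\<Sum>n=1..N. pf_gap f n) / real N) \<longlonglongrightarrow> 0" by simp
  then have "(\<lambda>N. \<Sum>n=1..N. twisted f n / real n) \<longlonglongrightarrow> 0"
    unfolding sum_twisted_eq by (rule convolution_tendsto_0[OF bound])
  \<comment> \<open>The partial sums in \<open>sums\<close> start at 0 and exclude the upper end:
    the term at 0 is 0, and \<open>LIMSEQ_imp_Suc\<close> undoes the shift by one.\<close>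
  moreover have "(\<Sum>n=1..N. twisted f n / real n) = (\<Sum>n<Suc N. twisted f n / real n)" for N
    by (intro sum.mono_neutral_left) (auto simp: twisted_def)
  ultimately have "(\<lambda>N. \<Sum>n<Suc N. twisted f n / real n) \<longlonglongrightarrow> 0" by simp
  then have "(\<lambda>n. twisted f n / real n) sums 0"
    unfolding sums_def by (rule LIMSEQ_imp_Suc)
  moreover have "twisted f n / real n = (if n \<ge> 2 then of_int (moebius_mu n) * real (omega n) * f (least_pf n) / real n else 0)" for n
    by (simp add: twisted_def)
  ultimately show ?thesis by simp
qed

end
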